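(* Let $B$ be a connected flag building set on $[n]$ with flag ordering $O$. Then $\gamma(B)=f(\Gamma(O))$, where $\gamma(B)$ denotes the $\gamma$-polynomial of the nestohedron $P_B$.
   Context: A building set $B$ on a finite set $S$ is a collection of nonempty subsets of $S$ such that (i) if $I,J\in B$ and $I\cap J\neq\emptyset$ then $I\cup J\in B$, and (ii) $\{i\}\in B$ for all $i\in S$; it is connected if $S\in B$. For $I\subseteq[n]$, $\Delta_I$ is the convex hull of the standard basis vectors $e_i$, $i\in I$, and for $B$ on $[n]$ the nestohedron is $P_B=\sum_{I\in B}\Delta_I$ (a simple polytope). $B$ is flag if $P_B$ is flag (every family of pairwise intersecting facets has nonempty intersection). A minimal flag building set on $S$ is a connected flag building set on $S$ no proper subset of which is a connected flag building set on $S$ (equivalently, the sets of leaf-descendants of the vertices of a rooted binary tree with leaf set $S$). For non-singleton $b\in B$, a decomposition of $b$ in $B$ is a subset of $B$ forming a minimal flag building set on $b$. A flag ordering $O=(D,b_1,\dots,b_k)$ of a connected flag building set $B$ on $[n]$ consists of a decomposition $D$ of $[n]$ in $B$ and an enumeration $b_1,\dots,b_k$ of $B\setminus D$ such that $B_j:=D\cup\{b_1,\dots,b_j\}$ is a flag building set for all $0\le j\le k$ ($B_0=D$). For $j\in[k]$: $U_j=\{i<j: b_i\not\subseteq b_j$ and there is no $b\in B_{i-1}$ with $b\setminus b_j=b_i\setminus b_j\}$; $V_j=\{i<j: b_i\subseteq b_j$ and there is $b\in B_{i-1}$ with $b_i\subsetneq b\subsetneq b_j\}$. $\Gamma(O)$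 is the simplicial complex on vertices $v(b_1),\dots,v(b_k)$ whose faces are the cliques of the graph in which, for $i<j$, $v(b_i)$ and $v(b_j)$ are adjacent iff $i\in U_j\cup V_j$ (for $k=0$ it has only the empty face). For a $(d-1)$-dimensional simplicial complex $\Delta$, $f(\Delta)(t)=\sum_{i=0}^{d}f_it^i$, $f_0=1$, $f_i$ = number of $(i-1)$-dimensional faces; $h(\Delta)(t)=(t-1)^df(\Delta)(1/(t-1))$; for a homology sphere $h(\Delta)(t)=\sum_{i}\gamma_it^i(1+t)^{d-2i}$ and $\gamma(\Delta)(t)=\sum_i\gamma_it^i$. For a simple polytope $P$, $\gamma(P)=\gamma(\Delta_P)$ where $\Delta_P$ is the boundary complex of the polar dual of $P$. *)

theory Defs
  imports "HOL-Analysis.Analysis" "HOL-Computational_Algebra.Polynomial"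
begin

section \<open>Building sets and nestohedra\<close>

text \<open>
  The ground set \<open>[n]\<close> is a type \<open>'n\<close> of class \<open>finite\<close>, with \<open>n = CARD('n)\<close>.  Building sets on a
  subset \<open>S\<close> live in the same type, and their nestohedra in the same space \<open>real ^ 'n\<close>.
\<close>

definition building_set :: "'n set \<Rightarrow> 'n set set \<Rightarrow> bool" where
  "building_set S B \<longleftrightarrow>
     (\<forall>I\<in>B. I \<noteq> {} \<and> I \<subseteq> S) \<and>
     (\<forall>I\<in>B. \<forall>J\<in>B. I \<inter> J \<noteq> {} \<longrightarrow> I \<union> J \<in> B) \<and>
     (\<forall>i\<in>S. {i} \<in> B)"

definition coord_simplex :: "'n::finite set \<Rightarrow> (real ^ 'n) set" where
  "coord_simplex I = convex hull ((\<lambda>i. axis i 1) ` I)"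

text \<open>The sum below is the Minkowski sum, from the addition on sets of \<open>HOL-Library.Set_Algebras\<close>.\<close>

definition nestohedron :: "'n::finite set set \<Rightarrow> (real ^ 'n) set" where
  "nestohedron B = (\<Sum>I\<in>B. coord_simplex I)"

definition flag_polytope :: "'a::euclidean_space set \<Rightarrow> bool" where
  "flag_polytope P \<longleftrightarrow>
     (\<forall>\<F>. (\<forall>F\<in>\<F>. F facet_of P) \<and> (\<forall>F\<in>\<F>. \<forall>G\<in>\<F>. F \<inter> G \<noteq> {}) \<longrightarrow> \<Inter>\<F> \<noteq> {})"

definition flag_building_set :: "'n::finite set \<Rightarrow> 'n set set \<Rightarrow> bool" where
  "flag_building_set S B \<longleftrightarrow> building_set S B \<and> flag_polytope (nestohedron B)"

definition connected_flag_building_set :: "'n::finite set \<Rightarrow> 'n set set \<Rightarrow> bool" where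
  "connected_flag_building_set S B \<longleftrightarrow> flag_building_set S B \<and> S \<in> B"

definition minimal_flag_building_set :: "'n::finite set \<Rightarrow> 'n set set \<Rightarrow> bool" where
  "minimal_flag_building_set S B \<longleftrightarrow>
     connected_flag_building_set S B \<and> (\<forall>B'. B' \<subset> B \<longrightarrow> \<not> connected_flag_building_set S B')"

text \<open>For a singleton \<open>c = {i}\<close> this yields the degenerate decomposition \<open>{{i}}\<close>.\<close>

definition decomposition :: "'n::finite set set \<Rightarrow> 'n set \<Rightarrow> 'n set set \<Rightarrow> bool" where
  "decomposition B c D \<longleftrightarrow> D \<subseteq> B \<and> minimal_flag_building_set c D"


section \<open>Flag orderings and the complex \<open>\<Gamma>(O)\<close>\<close>

text \<open>
  A flag ordering \<open>O = (D, b\<^sub>1, \<dots>, b\<^sub>k)\<close> is given by \<open>D\<close>, the length \<open>k\<close> and a function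
  \<open>b\<close> on \<open>nat\<close>, of which only the values at \<open>1, \<dots>, k\<close> are used.
\<close>

definition partial_set :: "'n set set \<Rightarrow> (nat \<Rightarrow> 'n set) \<Rightarrow> nat \<Rightarrow> 'n set set" where
  "partial_set D b j = D \<union> b ` {1..j}"

definition flag_ordering ::
    "'n::finite set \<Rightarrow> 'n set set \<Rightarrow> 'n set set \<Rightarrow> nat \<Rightarrow> (nat \<Rightarrow> 'n set) \<Rightarrow> bool" where
  "flag_ordering S B D k b \<longleftrightarrow>
     decomposition B S D \<and> bij_betw b {1..k} (B - D) \<and>
     (\<forall>j\<le>k. flag_building_set S (partial_set D b j))"

definition U_set :: "'n set set \<Rightarrow> (nat \<Rightarrow> 'n set) \<Rightarrow> nat \<Rightarrow> nat set" where
  "U_set D b j =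
     {i. 1 \<le> i \<and> i < j \<and> \<not> b i \<subseteq> b j \<and> \<not> (\<exists>c\<in>partial_set D b (i - 1). c - b j = b i - b j)}"

definition V_set :: "'n set set \<Rightarrow> (nat \<Rightarrow> 'n set) \<Rightarrow> nat \<Rightarrow> nat set" where
  "V_set D b j =
     {i. 1 \<le> i \<and> i < j \<and> b i \<subseteq> b j \<and> (\<exists>c\<in>partial_set D b (i - 1). b i \<subset> c \<and> c \<subset> b j)}"

text \<open>
  An abstract simplicial complex is the set of its faces, each face being a set of vertices; the
  empty face is included.  The vertex \<open>v(b\<^sub>i)\<close> is represented by the index \<open>i\<close>.
\<close>

definition Gamma_complex :: "'n set set \<Rightarrow> nat \<Rightarrow> (nat \<Rightarrow> 'n set) \<Rightarrow> nat set set" where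
  "Gamma_complex D k b =
     {\<sigma>. \<sigma> \<subseteq> {1..k} \<and> (\<forall>i\<in>\<sigma>. \<forall>j\<in>\<sigma>. i < j \<longrightarrow> i \<in> U_set D b j \<union> V_set D b j)}"


section \<open>\<open>f\<close>-, \<open>h\<close>- and \<open>\<gamma>\<close>-polynomials of finite abstract simplicial complexes\<close>

text \<open>
  \<open>complex_rank K\<close> is the \<open>d\<close> for which \<open>K\<close> is \<open>(d - 1)\<close>-dimensional; \<open>face_count K i\<close> is the
  number of faces with \<open>i\<close> vertices, i.e.\ of dimension \<open>i - 1\<close>.
\<close>

definition complex_rank :: "'v set set \<Rightarrow> nat" where
  "complex_rank K = Max (card ` K)"

definition face_count :: "'v set set \<Rightarrow> nat \<Rightarrow> nat" where
  "face_count K i = card {\<sigma>\<in>K. card \<sigma> = i}"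

definition f_poly :: "'v set set \<Rightarrow> real poly" where
  "f_poly K = (\<Sum>i\<le>complex_rank K. monom (real (face_count K i)) i)"

text \<open>
  The expression \<open>(t - 1)\<^sup>d f(1 / (t - 1))\<close> with the denominators cleared, cf. \<open>poly_h_poly\<close> below;
  \<open>[:-1, 1:]\<close> is the polynomial \<open>t - 1\<close>.
\<close>

definition h_poly :: "'v set set \<Rightarrow> real poly" where
  "h_poly K =
     (\<Sum>i\<le>complex_rank K. smult (real (face_count K i)) ([:-1, 1:] ^ (complex_rank K - i)))"

lemma poly_h_poly:
  fixes t :: real
  assumes "t \<noteq> 1"
  shows "poly (h_poly K) t = (t - 1) ^ complex_rank K * poly (f_poly K) (1 / (t - 1))"
proof -
  have *: "(t - 1) ^ (complex_rank K - i) = (t - 1) ^ complex_rank K * (1 / (t - 1)) ^ i"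
    if "i \<le> complex_rank K" for i
    using assms that by (simp add: power_diff power_one_over divide_simps)
  have "poly (h_poly K) t =
      (\<Sum>i\<le>complex_rank K. real (face_count K i) * (t - 1) ^ (complex_rank K - i))"
    by (simp add: h_poly_def poly_sum)
  also have "\<dots> = (t - 1) ^ complex_rank K * poly (f_poly K) (1 / (t - 1))"
    unfolding f_poly_def poly_sum poly_monom sum_distrib_left
    by (rule sum.cong) (simp_all only: atMost_iff * mult_ac)
  finally show ?thesis .
qed

text \<open>
  \<open>\<gamma> = \<Sum> \<gamma>\<^sub>i t\<^sup>i\<close> with \<open>h = \<Sum> \<gamma>\<^sub>i t\<^sup>i (1 + t)\<^bsup>d - 2i\<^esup>\<close>, where \<open>0 \<le> i \<le> d / 2\<close>; such a \<open>\<gamma>\<close> is unique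
  if it exists, and it exists if \<open>K\<close> is a homology sphere, as then \<open>h(t) = t\<^sup>d h(1 / t)\<close>.
\<close>

definition gamma_poly :: "'v set set \<Rightarrow> real poly" where
  "gamma_poly K =
     (THE g. degree g \<le> complex_rank K div 2 \<and>
        h_poly K =
          (\<Sum>i\<le>complex_rank K div 2. monom (coeff g i) i * [:1, 1:] ^ (complex_rank K - 2 * i)))"


section \<open>The \<open>\<gamma>\<close>-polynomial of a simple polytope\<close>

text \<open>
  The polar dual is taken in the affine hull of \<open>P\<close>, with the point \<open>x\<close> of the relative interior as
  origin.  Its combinatorial type does not depend on \<open>x\<close>.
\<close>

definition polar_dual_at :: "'a::euclidean_space \<Rightarrow> 'a set \<Rightarrow> 'a set" where
  "polar_dual_at x P = {y \<in> span ((\<lambda>z. z - x) ` P). \<forall>z\<in>P. y \<bullet> (z - x) \<le> 1}"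

definition polar_dual :: "'a::euclidean_space set \<Rightarrow> 'a set" where
  "polar_dual P = polar_dual_at (SOME x. x \<in> rel_interior P) P"

text \<open>The boundary complex of a simplicial polytope, each proper face being given by its vertices.\<close>

definition boundary_complex :: "'a::euclidean_space set \<Rightarrow> 'a set set" where
  "boundary_complex Q = {{v. v extreme_point_of F} | F. F face_of Q \<and> F \<noteq> Q}"

definition polytope_gamma :: "'a::euclidean_space set \<Rightarrow> real poly" where
  "polytope_gamma P = gamma_poly (boundary_complex (polar_dual P))"

end

theory Submission
  imports Defs
begin

text \<open>
  The proper faces of the dual of \<open>P\<^sub>B\<close> are the nested sets of \<open>B\<close>, and \<open>P\<^sub>B\<close> is flag iff every
  non-singleton member of \<open>B\<close> is a disjoint union of two members; nested sets are then the cliques of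
  a graph on \<open>B - {S}\<close>.  Adding \<open>b = b\<^sub>1 \<union> b\<^sub>2\<close> to \<open>B\<close> subdivides the edge \<open>{b\<^sub>1, b\<^sub>2}\<close> of the nested set
  complex, and the link of the new vertex is the join of the complexes of \<open>B|b\<close> and \<open>B/b\<close>.  Normalised
  as \<open>\<phi>\<^sub>B = f(s) / (1 + 2s)\<^bsup>|S| - 1\<^esup>\<close>, the \<open>f\<close>-polynomials satisfy
  \<open>\<phi>\<^bsub>B \<union> {b}\<^esub> = \<phi>\<^sub>B + x \<phi>\<^bsub>B|b\<^esub> \<phi>\<^bsub>B/b\<^esub>\<close> with \<open>x = (s + s\<^sup>2) / (1 + 2s)\<^sup>2\<close>.  On the other side, the link of the last
  vertex \<open>v(b\<^sub>k)\<close> in \<open>\<Gamma>(O)\<close> is the join of \<open>\<Gamma>\<close> of a flag ordering of \<open>B|b\<^sub>k\<close> on the vertices \<open>V\<^sub>k\<close> and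
  \<open>\<Gamma>\<close> of one of \<open>B/b\<^sub>k\<close> on \<open>U\<^sub>k\<close>.  Hence both sides obey the same recursion and \<open>\<phi>\<^sub>B(s) = f(\<Gamma>(O))(x)\<close>,
  which is the defining equation of the \<open>\<gamma>\<close>-polynomial written for \<open>f\<close> instead of \<open>h\<close>.
\<close>


section \<open>Clique complexes\<close>

text \<open>The factor \<open>1 + 2s\<close> is the f-polynomial of two points, and
  \<open>(1 + 2s)^(|S| - 1)\<close> that of the cross-polytope boundary formed by the nested sets of
  a decomposition, so \<phi> starts at 1. If \<open>W\<close> is the link of the edge
  \<open>{b1, b2}\<close>, subdividing gains \<open>s (1 + 2s) f(W)\<close> and loses
  \<open>s^2 f(W)\<close>. The net factor \<open>s + s^2\<close>, with \<open>(1 + 2s) f(W)\<close>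
  belonging to the link of \<open>b\<close> and \<open>(|b| - 1) + (|S - b| - 1) = |S| - 2\<close>,
  gives \<open>x\<close>. The delicate point is to find flag orderings of \<open>B|b_k\<close> and
  \<open>B/b_k\<close>. The members of \<open>D\<close> inside \<open>b_k\<close> need not decompose
  \<open>b_k\<close>, so some \<open>b_i\<close> must be moved to the front, which changes the
  stages that define adjacency. In \<open>B/b_k\<close> sets may share a trace and only the first
  counts; an equality of traces must also be lifted back to \<open>B\<close>. Both repairs rest on
  absorption: a chosen \<open>b_i\<close> contains every older set, within a suitable range, that it
  meets.\<close>

definition cliques :: "'v set \<Rightarrow> ('v \<Rightarrow> 'v \<Rightarrow> bool) \<Rightarrow> 'v set set" where
  "cliques V R = {N. N \<subseteq> V \<and> (\<forall>x\<in>N. \<forall>y\<in>N. x \<noteq> y \<longrightarrow> R x y)}"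

text \<open>The f-polynomial of the clique complex, evaluated at a real number so that values can be
  divided by powers of \<open>1 + 2 * s\<close>.\<close>

definition clique_sum :: "real \<Rightarrow> 'v set \<Rightarrow> ('v \<Rightarrow> 'v \<Rightarrow> bool) \<Rightarrow> real" where
  "clique_sum s V R = (\<Sum>N\<in>cliques V R. s ^ card N)"

lemma finite_cliques: "finite V \<Longrightarrow> finite (cliques V R)"
  unfolding cliques_def by (rule finite_subset[of _ "Pow V"]) auto

lemma clique_sum_cong:
  assumes "\<And>x y. x \<in> V \<Longrightarrow> y \<in> V \<Longrightarrow> x \<noteq> y \<Longrightarrow> R x y = R' x y"
  shows "clique_sum s V R = clique_sum s V R'"
proof -
  have "cliques V R = cliques V R'"
    unfolding cliques_def using assms by blast
  then show ?thesis by (simp add: clique_sum_def)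
qed

lemma clique_sum_empty [simp]: "clique_sum s {} R = 1"
proof -
  have "cliques {} R = {{}}" by (auto simp: cliques_def)
  then show ?thesis by (simp add: clique_sum_def)
qed

lemma clique_sum_insert:
  assumes "finite V" "v \<notin> V" "\<And>x y. R x y \<Longrightarrow> R y x"
  shows "clique_sum s (insert v V) R = clique_sum s V R + s * clique_sum s {w\<in>V. R v w} R"
proof -
  let ?L = "cliques {w\<in>V. R v w} R"
  have eq: "cliques (insert v V) R = cliques V R \<union> insert v ` ?L"
  proof (intro equalityI subsetI)
    fix N assume N: "N \<in> cliques (insert v V) R"
    show "N \<in> cliques V R \<union> insert v ` ?L"
    proof (cases "v \<in> N")
      case True
      then have "N - {v} \<in> ?L" "N = insert v (N - {v})"
        using N assms(2) by (auto simp: cliques_def)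
      then show ?thesis by blast
    next
      case False
      then show ?thesis using N by (auto simp: cliques_def)
    qed
  next
    fix N assume "N \<in> cliques V R \<union> insert v ` ?L"
    then show "N \<in> cliques (insert v V) R"
      using assms(3) by (auto simp: cliques_def)
  qed
  have disj: "cliques V R \<inter> insert v ` ?L = {}"
    using assms(2) by (auto simp: cliques_def)
  have inj: "inj_on (insert v) ?L"
    using assms(2) by (intro inj_onI) (auto simp: cliques_def insert_ident subset_iff)
  have card: "card (insert v N) = Suc (card N)" if "N \<in> ?L" for N
    using that assms(1,2) by (subst card_insert_disjoint) (auto simp: cliques_def intro: finite_subset)
  have "clique_sum s (insert v V) R = clique_sum s V R + (\<Sum>N\<in>?L. s ^ card (insert v N))"
    unfolding clique_sum_def eq using assms(1) disj inj
    by (subst sum.union_disjoint) (auto simp: finite_cliques sum.reindex)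
  also have "(\<Sum>N\<in>?L. s ^ card (insert v N)) = s * clique_sum s {w\<in>V. R v w} R"
    by (simp add: card clique_sum_def sum_distrib_left)
  finally show ?thesis .
qed

lemma clique_sum_join:
  assumes "finite V" "finite W" "V \<inter> W = {}"
    and "\<And>x y. x \<in> V \<Longrightarrow> y \<in> W \<Longrightarrow> R x y \<and> R y x"
  shows "clique_sum s (V \<union> W) R = clique_sum s V R * clique_sum s W R"
proof -
  let ?g = "\<lambda>(M, N). M \<union> N"
  have inj: "inj_on ?g (cliques V R \<times> cliques W R)"
  proof (intro inj_onI, clarify)
    fix M N M' N' assume *: "M \<in> cliques V R" "N \<in> cliques W R" "M' \<in> cliques V R"
      "N' \<in> cliques W R" "M \<union> N = M' \<union> N'"
    then have "M = (M \<union> N) \<inter> V" "N = (M \<union> N) \<inter> W"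
      "M' = (M' \<union> N') \<inter> V" "N' = (M' \<union> N') \<inter> W"
      using assms(3) by (auto simp: cliques_def)
    with * show "M = M' \<and> N = N'" by metis
  qed
  have img: "cliques (V \<union> W) R = ?g ` (cliques V R \<times> cliques W R)"
  proof (intro equalityI subsetI)
    fix N assume "N \<in> cliques (V \<union> W) R"
    then have "N = ?g (N \<inter> V, N \<inter> W)" "N \<inter> V \<in> cliques V R" "N \<inter> W \<in> cliques W R"
      by (auto simp: cliques_def)
    then show "N \<in> ?g ` (cliques V R \<times> cliques W R)" by blast
  next
    fix N assume "N \<in> ?g ` (cliques V R \<times> cliques W R)"
    then show "N \<in> cliques (V \<union> W) R"
      using assms(4) by (auto 0 4 simp: cliques_def)
  qed
  have card: "card (M \<union> N) = card M + card N" if "M \<in> cliques V R" "N \<in> cliques W R" for M N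
    using that assms(1-3) by (intro card_Un_disjoint) (auto simp: cliques_def intro: finite_subset)
  have "clique_sum s (V \<union> W) R = (\<Sum>(M, N)\<in>cliques V R \<times> cliques W R. s ^ card (M \<union> N))"
    unfolding clique_sum_def img sum.reindex[OF inj] by (simp add: comp_def case_prod_beta)
  also have "\<dots> = (\<Sum>(M, N)\<in>cliques V R \<times> cliques W R. s ^ card M * s ^ card N)"
    by (intro sum.cong) (auto simp: card power_add)
  also have "\<dots> = clique_sum s V R * clique_sum s W R"
    by (simp add: clique_sum_def sum_product sum.cartesian_product)
  finally show ?thesis .
qed

lemma clique_sum_reindex:
  assumes inj: "inj_on g V"
    and R: "\<And>x y. x \<in> V \<Longrightarrow> y \<in> V \<Longrightarrow> x \<noteq> y \<Longrightarrow> R' (g x) (g y) = R x y"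
  shows "clique_sum s (g ` V) R' = clique_sum s V R"
proof -
  have eq: "cliques (g ` V) R' = (`) g ` cliques V R"
  proof (intro equalityI subsetI)
    fix N assume N: "N \<in> cliques (g ` V) R'"
    then obtain M where M: "M \<subseteq> V" "N = g ` M"
      unfolding cliques_def subset_image_iff by blast
    have "R x y" if "x \<in> M" "y \<in> M" "x \<noteq> y" for x y
    proof -
      have "g x \<noteq> g y" using that M(1) inj by (auto dest: inj_onD)
      then have "R' (g x) (g y)" using N M(2) that by (auto simp: cliques_def)
      then show ?thesis using R that M(1) by blast
    qed
    then have "M \<in> cliques V R" using M(1) by (auto simp: cliques_def)
    then show "N \<in> (`) g ` cliques V R" using M(2) by blast
  next
    fix N assume "N \<in> (`) g ` cliques V R"
    then obtain M where M: "M \<subseteq> V" "\<forall>x\<in>M. \<forall>y\<in>M. x \<noteq> y \<longrightarrow> R x y" "N = g ` M"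
      by (auto simp: cliques_def)
    have "R' (g x) (g y)" if "x \<in> M" "y \<in> M" "g x \<noteq> g y" for x y
    proof -
      have "x \<in> V" "y \<in> V" "x \<noteq> y" using M(1) that by auto
      then show ?thesis using R M(2) that(1,2) by simp
    qed
    then show "N \<in> cliques (g ` V) R'"
      using M by (auto simp: cliques_def)
  qed
  have inj': "inj_on ((`) g) (cliques V R)"
    by (rule inj_on_subset[OF inj_on_image_Pow[OF inj]]) (auto simp: cliques_def)
  have "card (g ` N) = card N" if "N \<in> cliques V R" for N
    using that inj by (intro card_image inj_on_subset[OF inj]) (auto simp: cliques_def)
  then show ?thesis
    by (simp add: clique_sum_def eq sum.reindex[OF inj'])
qed

text \<open>The faces gained with the edge are those containing both ends, that is, the link of the
  edge shifted by two vertices. The computation expands at \<open>u\<close>, where the edge changes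
  only the link, and then expands this link at \<open>v\<close>.\<close>

lemma clique_sum_add_edge:
  assumes fin: "finite V" and uv: "u \<in> V" "v \<in> V" "u \<noteq> v"
    and sym: "\<And>x y. R x y \<Longrightarrow> R y x" "\<And>x y. R' x y \<Longrightarrow> R' y x"
    and R: "\<And>x y. x \<in> V \<Longrightarrow> y \<in> V \<Longrightarrow> x \<noteq> y \<Longrightarrow> {x, y} \<noteq> {u, v} \<Longrightarrow> R x y = R' x y"
    and edge: "R u v" "\<not> R' u v"
  shows "clique_sum s V R = clique_sum s V R' +
    s\<^sup>2 * clique_sum s {w\<in>V - {u, v}. R u w \<and> R v w} R'"
proof -
  let ?V = "V - {u}"
  have V: "V = insert u ?V" using uv by auto
  have "clique_sum s V R = clique_sum s ?V R + s * clique_sum s {w\<in>?V. R u w} R"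
    using clique_sum_insert[of ?V u R s] fin sym(1) V by (metis Diff_iff finite_Diff insertI1)
  also have "clique_sum s ?V R = clique_sum s ?V R'"
    by (intro clique_sum_cong R) (auto simp: doubleton_eq_iff)
  also have "clique_sum s {w\<in>?V. R u w} R = clique_sum s {w\<in>?V. R u w} R'"
    by (intro clique_sum_cong R) (auto simp: doubleton_eq_iff)
  also have "{w\<in>?V. R u w} = insert v {w\<in>?V. R' u w}"
  proof -
    have "R u w = R' u w" if "w \<in> ?V" "w \<noteq> v" for w
      using R[of u w] that uv by (auto simp: doubleton_eq_iff)
    then show ?thesis using uv edge by auto
  qed
  also have "clique_sum s (insert v {w\<in>?V. R' u w}) R' =
      clique_sum s {w\<in>?V. R' u w} R' + s * clique_sum s {w\<in>{w\<in>?V. R' u w}. R' v w} R'"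
    using fin edge sym(2) by (intro clique_sum_insert) auto
  also have "{w\<in>{w\<in>?V. R' u w}. R' v w} = {w\<in>V - {u, v}. R u w \<and> R v w}"
  proof -
    have "(w \<in> {w\<in>{w\<in>?V. R' u w}. R' v w}) = (w \<in> {w\<in>V - {u, v}. R u w \<and> R v w})" for w
      using R[of u w] R[of v w] uv edge by (cases "w = v") (auto simp: doubleton_eq_iff)
    then show ?thesis by blast
  qed
  also have "clique_sum s ?V R' + s * (clique_sum s {w\<in>?V. R' u w} R' +
      s * clique_sum s {w\<in>V - {u, v}. R u w \<and> R v w} R') =
      clique_sum s V R' + s\<^sup>2 * clique_sum s {w\<in>V - {u, v}. R u w \<and> R v w} R'"
    using clique_sum_insert[of ?V u R' s] fin sym(2) V
    by (simp add: algebra_simps power2_eq_square)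
  finally show ?thesis .
qed

lemma clique_sum_suspension:
  assumes "finite V" "u \<notin> V" "v \<notin> V" "u \<noteq> v" "\<And>x y. R x y \<Longrightarrow> R y x" "\<not> R u v"
    and "\<And>w. w \<in> V \<Longrightarrow> R u w \<and> R v w"
  shows "clique_sum s (insert u (insert v V)) R = (1 + 2 * s) * clique_sum s V R"
proof -
  have "{w\<in>insert v V. R u w} = V" "{w\<in>V. R v w} = V" using assms by auto
  then show ?thesis
    using clique_sum_insert[of "insert v V" u R s] clique_sum_insert[of V v R s] assms
    by (simp add: algebra_simps)
qed

section \<open>Nested sets of a flag building set\<close>

definition splitting :: "'n set set \<Rightarrow> bool" where
  "splitting B \<longleftrightarrow> (\<forall>I\<in>B. (\<exists>i. I = {i}) \<or> (\<exists>J\<in>B. \<exists>K\<in>B. J \<inter> K = {} \<and> J \<union> K = I))"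

text \<open>Building sets on proper subsets occur only in this combinatorial form, so flagness of
  polytopes has to be translated for the whole type alone.\<close>

definition flag_bs :: "'n set \<Rightarrow> 'n set set \<Rightarrow> bool" where
  "flag_bs S B \<longleftrightarrow> building_set S B \<and> splitting B \<and> S \<in> B"

definition nested_compat :: "'n set set \<Rightarrow> 'n set \<Rightarrow> 'n set \<Rightarrow> bool" where
  "nested_compat B I J \<longleftrightarrow> I \<subseteq> J \<or> J \<subseteq> I \<or> I \<inter> J = {} \<and> I \<union> J \<notin> B"

text \<open>\<open>S\<close> is compatible with every member; keeping it would turn the complex into
  a cone.\<close>

definition nested_sum :: "real \<Rightarrow> 'n set \<Rightarrow> 'n set set \<Rightarrow> real" where
  "nested_sum s S B = clique_sum s (B - {S}) (nested_compat B)"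

definition restr :: "'n set set \<Rightarrow> 'n set \<Rightarrow> 'n set set" where
  "restr B b = {c\<in>B. c \<subseteq> b}"

definition contr :: "'n set set \<Rightarrow> 'n set \<Rightarrow> 'n set set" where
  "contr B b = (\<lambda>c. c - b) ` {c\<in>B. \<not> c \<subseteq> b}"

lemma compat_sym: "nested_compat B I J \<Longrightarrow> nested_compat B J I"
  by (auto simp: nested_compat_def Un_commute)

lemma building_setD:
  assumes "building_set S B"
  shows building_ne: "I \<in> B \<Longrightarrow> I \<noteq> {}"
    and building_sub: "I \<in> B \<Longrightarrow> I \<subseteq> S"
    and building_un: "I \<in> B \<Longrightarrow> J \<in> B \<Longrightarrow> I \<inter> J \<noteq> {} \<Longrightarrow> I \<union> J \<in> B"
    and building_single: "i \<in> S \<Longrightarrow> {i} \<in> B"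
  using assms by (auto simp: building_set_def)

lemma splittingE:
  assumes "splitting B" "I \<in> B"
  obtains i where "I = {i}" | J K where "J \<in> B" "K \<in> B" "J \<inter> K = {}" "J \<union> K = I"
  using assms unfolding splitting_def by blast

text \<open>A smallest \<open>c \<in> B\<close> with \<open>c \<union> J = U\<close> turns out to be \<open>U - J\<close>.\<close>

lemma splitting_complement:
  fixes B :: "'n::finite set set"
  assumes B: "building_set S B" "splitting B"
    and UJ: "U \<in> B" "J \<in> B" "J \<subset> U"
    and max: "\<And>K. K \<in> B \<Longrightarrow> J \<subset> K \<Longrightarrow> K \<subset> U \<Longrightarrow> False"
  shows "U - J \<in> B"
proof -
  obtain c where c: "c \<in> B" "c \<union> J = U" and
    min: "\<And>d. d \<in> B \<Longrightarrow> d \<union> J = U \<Longrightarrow> card c \<le> card d"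
    using ex_has_least_nat[of "\<lambda>c. c \<in> B \<and> c \<union> J = U" U card] UJ by (auto simp: sup.absorb1)
  show ?thesis
    using B(2) c(1)
  proof (cases rule: splittingE)
    case (1 i)
    then have "U - J = c" using c(2) UJ(3) by auto
    then show ?thesis using c(1) by simp
  next
    case (2 d1 d2)
    \<comment> \<open>If a piece \<open>d\<close> of \<open>c\<close> met \<open>J\<close>, then
      \<open>d \<union> J\<close> would differ from \<open>U\<close> by the choice of
      \<open>c\<close>, hence equal \<open>J\<close> by maximality; the other piece would then cover
      \<open>U - J\<close>, against the choice of \<open>c\<close>.\<close>
    have aux: "d \<inter> J = {}" if d: "d \<in> B" "e \<in> B" "d \<inter> e = {}" "d \<union> e = c" for d e
    proof (rule ccontr)
      assume ne: "d \<inter> J \<noteq> {}"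
      have "d \<subset> c" "e \<subset> c" using d building_ne[OF B(1)] by auto
      then have less: "card d < card c" "card e < card c" by (auto intro: psubset_card_mono)
      have dJ: "d \<union> J \<in> B" using building_un[OF B(1) d(1) UJ(2) ne] .
      have "d \<union> J \<noteq> U" using min[OF d(1)] less by auto
      then have "d \<union> J \<subset> U" using d(4) c(2) by auto
      then have "d \<subseteq> J" using max[OF dJ] by auto
      then have "e \<union> J = U" using d(4) c(2) by auto
      then show False using min[OF d(2)] less by auto
    qed
    have "c \<inter> J = {}" using aux[of d1 d2] aux[of d2 d1] 2 by auto
    then have "U - J = c" using c(2) by auto
    then show ?thesis using c(1) by simp
  qed
qed

text \<open>
  A smallest member of \<open>B\<close> inside \<open>\<Union>F\<close> that lies in no member of \<open>F\<close> is the union of two members of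
  \<open>B\<close> lying in members of \<open>F\<close>, and so the union of these two members of \<open>F\<close> is in \<open>B\<close>.
\<close>

lemma compat_family_Union:
  fixes B :: "'n::finite set set"
  assumes B: "building_set S B" "splitting B"
    and F: "F \<subseteq> B" "\<And>I J. I \<in> F \<Longrightarrow> J \<in> F \<Longrightarrow> I \<noteq> J \<Longrightarrow> nested_compat B I J"
    and U: "\<Union>F \<in> B"
  shows "\<Union>F \<in> F"
proof (rule ccontr)
  assume nF: "\<Union>F \<notin> F"
  define P where "P c \<longleftrightarrow> c \<in> B \<and> c \<subseteq> \<Union>F \<and> (\<forall>J\<in>F. \<not> c \<subseteq> J)" for c
  have "P (\<Union>F)"
    using U nF unfolding P_def by (metis Union_upper order_refl subset_antisym)
  then obtain c where "P c" and min: "\<And>d. P d \<Longrightarrow> card c \<le> card d"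
    using ex_has_least_nat[of P "\<Union>F" card] by blast
  then have cB: "c \<in> B" and c: "c \<subseteq> \<Union>F" "\<And>J. J \<in> F \<Longrightarrow> \<not> c \<subseteq> J" by (auto simp: P_def)
  show False
    using B(2) cB
  proof (cases rule: splittingE)
    case (1 i)
    then show False using c by auto
  next
    case (2 d1 d2)
    have ne: "d1 \<noteq> {}" "d2 \<noteq> {}" using 2 building_ne[OF B(1)] by auto
    then have "d1 \<subset> c" "d2 \<subset> c" using 2 by auto
    then have "card d1 < card c" "card d2 < card c" by (auto intro: psubset_card_mono)
    then have "\<not> P d1" "\<not> P d2" using min by (meson leD)+
    then obtain J K where JK: "J \<in> F" "d1 \<subseteq> J" "K \<in> F" "d2 \<subseteq> K"
      using 2 c(1) unfolding P_def by blast
    have "J \<union> c \<in> B" using building_un[OF B(1)] JK ne F(1) cB 2 by blast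
    moreover have "K \<inter> (J \<union> c) \<noteq> {}" using JK ne 2 by auto
    ultimately have "K \<union> (J \<union> c) \<in> B" using building_un[OF B(1)] JK F(1) by blast
    moreover have "K \<union> (J \<union> c) = J \<union> K" using 2 JK by auto
    ultimately have "J \<union> K \<in> B" by simp
    moreover have "\<not> J \<subseteq> K" "\<not> K \<subseteq> J" using c(2)[of J] c(2)[of K] JK 2 by auto
    ultimately show False using F(2)[of J K] JK by (auto simp: nested_compat_def)
  qed
qed

lemma compat_triple:
  fixes B :: "'n::finite set set"
  assumes "building_set S B" "splitting B"
    and "I \<in> B" "J \<in> B" "K \<in> B" "I \<inter> J = {}" "I \<inter> K = {}" "J \<inter> K = {}"
    and "I \<union> J \<notin> B" "I \<union> K \<notin> B" "J \<union> K \<notin> B"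
  shows "I \<union> J \<union> K \<notin> B"
proof
  assume U: "I \<union> J \<union> K \<in> B"
  have "\<Union>{I, J, K} \<in> {I, J, K}"
  proof (rule compat_family_Union[OF assms(1,2)])
    show "{I, J, K} \<subseteq> B" using assms by auto
    show "\<Union>{I, J, K} \<in> B" using U by (simp add: Un_assoc)
    show "nested_compat B I' J'" if "I' \<in> {I, J, K}" "J' \<in> {I, J, K}" "I' \<noteq> J'" for I' J'
      using that assms by (auto simp: nested_compat_def Un_commute Int_commute)
  qed
  moreover have "I \<noteq> {}" "J \<noteq> {}" "K \<noteq> {}" using assms building_ne[OF assms(1)] by auto
  ultimately show False using assms(6-8) by blast
qed

text \<open>A member of \<open>B\<close> inside \<open>b\<close> that met both halves would join
  them to \<open>b\<close>, forcing \<open>b \<in> B\<close>.\<close>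

lemma insert_split:
  fixes B :: "'n::finite set set"
  assumes B: "building_set S B" and B': "building_set S (insert b B)" "splitting (insert b B)"
    and b: "b \<notin> B"
  obtains b1 b2 where "b1 \<in> B" "b2 \<in> B" "b1 \<inter> b2 = {}" "b1 \<union> b2 = b"
    "\<And>c. c \<in> B \<Longrightarrow> c \<subseteq> b \<Longrightarrow> c \<subseteq> b1 \<or> c \<subseteq> b2"
proof -
  have "b \<in> insert b B" by simp
  with B'(2) show ?thesis
  proof (cases rule: splittingE)
    case (1 i)
    then show ?thesis using b building_single[OF B, of i] building_sub[OF B'(1), of b] by auto
  next
    case (2 b1 b2)
    have "b1 \<noteq> {}" "b2 \<noteq> {}" using 2 building_ne[OF B'(1)] by auto
    then have mem: "b1 \<in> B" "b2 \<in> B" using 2 by auto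
    have "c \<subseteq> b1 \<or> c \<subseteq> b2" if c: "c \<in> B" "c \<subseteq> b" for c
    proof (rule ccontr)
      assume "\<not> (c \<subseteq> b1 \<or> c \<subseteq> b2)"
      then have ne: "c \<inter> b1 \<noteq> {}" "(c \<union> b1) \<inter> b2 \<noteq> {}" using c 2 by auto
      have "c \<union> b1 \<union> b2 \<in> B"
        using building_un[OF B building_un[OF B c(1) mem(1) ne(1)] mem(2) ne(2)] .
      moreover have "c \<union> b1 \<union> b2 = b" using 2 c by auto
      ultimately show False using b by simp
    qed
    then show ?thesis using that mem 2 by blast
  qed
qed

text \<open>
  If \<open>b\<close> is the disjoint union of \<open>b1\<close> and \<open>b2\<close>, then \<open>b1\<close> and \<open>b2\<close> cease to be adjacent, and the link of
  the new vertex \<open>b\<close> is the suspension over \<open>b1\<close>, \<open>b2\<close> of the link of the old edge.  The factor \<open>1 + 2 * s\<close>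
  spares the division by the \<open>f\<close>-polynomial of \<open>{b1, b2}\<close>.
\<close>

lemma nested_sum_insert_link:
  fixes B :: "'n::finite set set"
  assumes B: "flag_bs S B" and B': "flag_bs S (insert b B)"
    and b: "b \<notin> B"
  shows "(1 + 2 * s) * nested_sum s S (insert b B) = (1 + 2 * s) * nested_sum s S B +
    (s + s\<^sup>2) * clique_sum s {J\<in>B - {S}. nested_compat (insert b B) b J} (nested_compat (insert b B))"
proof -
  let ?B = "insert b B"
  let ?V = "B - {S}" and ?R = "nested_compat B" and ?R' = "nested_compat ?B"
  have bs: "building_set S B" "building_set S ?B" and sp: "splitting B" "splitting ?B" and SB: "S \<in> B"
    using B B' by (auto simp: flag_bs_def)
  obtain b1 b2 where b12: "b1 \<in> B" "b2 \<in> B" "b1 \<inter> b2 = {}" "b1 \<union> b2 = b"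
    and below: "\<And>c. c \<in> B \<Longrightarrow> c \<subseteq> b \<Longrightarrow> c \<subseteq> b1 \<or> c \<subseteq> b2"
    using insert_split[OF bs sp(2) b] by metis
  have ne: "b1 \<noteq> {}" "b2 \<noteq> {}" using b12 building_ne[OF bs(1)] by auto
  have bS: "b \<subset> S" using building_sub[OF bs(2), of b] b SB by auto
  let ?W = "{w\<in>?V - {b1, b2}. ?R b1 w \<and> ?R b2 w}"
  have add: "clique_sum s ?V ?R = clique_sum s ?V ?R' + s\<^sup>2 * clique_sum s ?W ?R'"
  proof (rule clique_sum_add_edge)
    show "b1 \<in> ?V" "b2 \<in> ?V" "b1 \<noteq> b2" using b12 ne bS by auto
    show "?R b1 b2" "\<not> ?R' b1 b2" using b12 ne b by (auto simp: nested_compat_def)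
  next
    fix x y assume xy: "x \<in> ?V" "y \<in> ?V" "x \<noteq> y" "{x, y} \<noteq> {b1, b2}"
    \<comment> \<open>The two relations differ only at disjoint pairs with union \<open>b\<close>;
      both sets lie in halves of \<open>b\<close>, so such a pair is
      \<open>{b1, b2}\<close>.\<close>
    have "x \<union> y \<noteq> b" if "x \<inter> y = {}"
    proof
      assume "x \<union> y = b"
      then have "x \<subseteq> b1 \<or> x \<subseteq> b2" "y \<subseteq> b1 \<or> y \<subseteq> b2" "b1 \<union> b2 = x \<union> y"
        using below[of x] below[of y] xy b12 by auto
      then have "(x = b1 \<and> y = b2) \<or> (x = b2 \<and> y = b1)"
        using b12(3) ne by blast
      then show False using xy(4) by auto
    qed
    then show "?R x y = ?R' x y" by (auto simp: nested_compat_def)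
  qed (auto intro: compat_sym)
  have "?B - {S} = insert b ?V" using bS by auto
  then have ins: "clique_sum s (?B - {S}) ?R' =
      clique_sum s ?V ?R' + s * clique_sum s {w\<in>?V. ?R' b w} ?R'"
    using clique_sum_insert[of ?V b ?R' s] b by (auto intro: compat_sym)
  have link: "{w\<in>?V. ?R' b w} = insert b1 (insert b2 ?W)"
  proof -
    have "?R' b w \<longleftrightarrow> ?R b1 w \<and> ?R b2 w" if w: "w \<in> ?V" "w \<noteq> b1" "w \<noteq> b2" for w
    proof
      assume "?R' b w"
      then consider "w \<subseteq> b1" | "w \<subseteq> b2" | "b \<subseteq> w" | "b \<inter> w = {}" "b \<union> w \<notin> ?B"
        using below[of w] w by (auto simp: nested_compat_def)
      then show "?R b1 w \<and> ?R b2 w"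
      proof cases
        case 1
        then have "b2 \<union> w \<noteq> {}" "\<not> b2 \<union> w \<subseteq> b1" "\<not> b2 \<union> w \<subseteq> b2"
          using b12 ne building_ne[OF bs(1), of w] w by auto
        then have "b2 \<union> w \<notin> B" using below[of "b2 \<union> w"] 1 b12(4) by blast
        then show ?thesis using 1 b12(3) by (auto simp: nested_compat_def)
      next
        case 2
        then have "b1 \<union> w \<noteq> {}" "\<not> b1 \<union> w \<subseteq> b1" "\<not> b1 \<union> w \<subseteq> b2"
          using b12 ne building_ne[OF bs(1), of w] w by auto
        then have "b1 \<union> w \<notin> B" using below[of "b1 \<union> w"] 2 b12(4) by blast
        then show ?thesis using 2 b12(3) by (auto simp: nested_compat_def)
      next
        case 3
        then show ?thesis using b12(4) by (auto simp: nested_compat_def)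
      next
        case 4
        have "b1 \<union> w \<notin> B"
        proof
          assume "b1 \<union> w \<in> B"
          then have "b1 \<union> w \<union> b \<in> ?B" using building_un[OF bs(2), of "b1 \<union> w" b] b12 ne by auto
          moreover have "b1 \<union> w \<union> b = b \<union> w" using b12 by auto
          ultimately show False using 4 by simp
        qed
        moreover have "b2 \<union> w \<notin> B"
        proof
          assume "b2 \<union> w \<in> B"
          then have "b2 \<union> w \<union> b \<in> ?B" using building_un[OF bs(2), of "b2 \<union> w" b] b12 ne by auto
          moreover have "b2 \<union> w \<union> b = b \<union> w" using b12 by auto
          ultimately show False using 4 by simp
        qed
        ultimately show ?thesis using 4 b12(4) by (auto simp: nested_compat_def)
      qed
    next
      assume "?R b1 w \<and> ?R b2 w"
      then consider "w \<subseteq> b" | "b1 \<subseteq> w" "b2 \<subseteq> w"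
        | "b1 \<subseteq> w" "b2 \<inter> w = {}" "b2 \<union> w \<notin> B" | "b2 \<subseteq> w" "b1 \<inter> w = {}" "b1 \<union> w \<notin> B"
        | "b1 \<inter> w = {}" "b2 \<inter> w = {}" "b1 \<union> w \<notin> B" "b2 \<union> w \<notin> B"
        using b12(4) by (auto simp: nested_compat_def)
      then show "?R' b w"
      proof cases
        case 1
        then show ?thesis by (auto simp: nested_compat_def)
      next
        case 2
        then show ?thesis using b12(4) by (auto simp: nested_compat_def)
      next
        \<comment> \<open>\<open>b \<union> w\<close> is in the new building set and equals
          \<open>b2 \<union> w\<close>, which is not in \<open>B\<close>; so it is \<open>b\<close>
          itself and \<open>w = b1\<close>, which is excluded.\<close>
        case 3
        have "b \<union> w \<in> ?B" using building_un[OF bs(2), of b w] w 3 ne b12 by auto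
        moreover have "b \<union> w = b2 \<union> w" using 3 b12(4) by auto
        ultimately have "b2 \<union> w = b" using 3(3) by auto
        then have "w = b1" using 3 b12 by auto
        then show ?thesis using w by simp
      next
        case 4
        have "b \<union> w \<in> ?B" using building_un[OF bs(2), of b w] w 4 ne b12 by auto
        moreover have "b \<union> w = b1 \<union> w" using 4 b12(4) by auto
        ultimately have "b1 \<union> w = b" using 4(3) by auto
        then have "w = b2" using 4 b12 by auto
        then show ?thesis using w by simp
      next
        case 5
        have "b1 \<union> b2 \<union> w \<notin> B"
          using compat_triple[OF bs(1) sp(1), of b1 b2 w] 5 b12 b w by auto
        moreover have "b \<union> w \<noteq> b" using 5 b12(4) building_ne[OF bs(1), of w] w by blast
        ultimately show ?thesis using 5 b12(4) by (auto simp: nested_compat_def)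
      qed
    qed
    moreover have "?R' b b1" "?R' b b2" using b12(4) by (auto simp: nested_compat_def)
    moreover have "b1 \<in> ?V" "b2 \<in> ?V" using b12 bS by auto
    ultimately show ?thesis by blast
  qed
  have susp: "clique_sum s {w\<in>?V. ?R' b w} ?R' = (1 + 2 * s) * clique_sum s ?W ?R'"
    unfolding link
  proof (rule clique_sum_suspension)
    show "b1 \<noteq> b2" using b12 ne by auto
    show "\<not> ?R' b1 b2" using b12 ne by (auto simp: nested_compat_def)
    show "?R' b1 w \<and> ?R' b2 w" if "w \<in> ?W" for w
    proof -
      have w: "w \<in> B" "w \<noteq> b1" "w \<noteq> b2" "?R b1 w" "?R b2 w" using that by auto
      have "b1 \<union> w \<noteq> b" if "b1 \<inter> w = {}"
      proof
        assume "b1 \<union> w = b"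
        then have "w = b2" using that b12 by auto
        then show False using w by simp
      qed
      moreover have "b2 \<union> w \<noteq> b" if "b2 \<inter> w = {}"
      proof
        assume "b2 \<union> w = b"
        then have "w = b1" using that b12 by auto
        then show False using w by simp
      qed
      ultimately show ?thesis using w by (auto simp: nested_compat_def)
    qed
  qed (auto intro: compat_sym)
  show ?thesis
    unfolding nested_sum_def ins add using susp
    by (simp add: algebra_simps power2_eq_square)
qed

text \<open>Sets inside \<open>b\<close> are compatible with all other neighbours \<open>y\<close>
  of \<open>b\<close>, because a union \<open>x \<union> y \<in> B\<close> with \<open>y\<close>
  disjoint from \<open>b\<close> could be enlarged to \<open>b \<union> y\<close>. The other
  neighbours are matched with \<open>B/b\<close> by \<open>J - b\<close>: a trace \<open>e\<close>
  comes from \<open>e \<union> b\<close> if this is in \<open>B\<close>, and from \<open>e\<close>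
  otherwise.\<close>

lemma link_join:
  fixes B :: "'n::finite set set"
  assumes B: "flag_bs S B" and b: "b \<in> B"
  shows "clique_sum s {J\<in>B - {S, b}. nested_compat B b J} (nested_compat B) =
    nested_sum s b (restr B b) * nested_sum s (S - b) (contr B b)"
proof -
  have bs: "building_set S B" and sp: "splitting B" and SB: "S \<in> B"
    using B by (auto simp: flag_bs_def)
  note un = building_un[OF bs] and nempty = building_ne[OF bs] and sub = building_sub[OF bs]
  let ?V = "restr B b - {b}"
  let ?W = "{J\<in>B - {S}. b \<subset> J \<or> b \<inter> J = {} \<and> b \<union> J \<notin> B}"
  have VW: "{J\<in>B - {S, b}. nested_compat B b J} = ?V \<union> ?W"
    using sub[OF b] SB by (auto simp: nested_compat_def restr_def)
  have "clique_sum s (?V \<union> ?W) (nested_compat B) = clique_sum s ?V (nested_compat B) * clique_sum s ?W (nested_compat B)"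
  proof (rule clique_sum_join)
    show "?V \<inter> ?W = {}" using nempty by (auto simp: restr_def)
    fix x y assume xy: "x \<in> ?V" "y \<in> ?W"
    have "x \<union> y \<notin> B" if "b \<inter> y = {}" "b \<union> y \<notin> B"
    proof
      assume "x \<union> y \<in> B"
      then have "(x \<union> y) \<union> b \<in> B" using un[of "x \<union> y" b] b xy nempty[of x] by (auto simp: restr_def)
      moreover have "(x \<union> y) \<union> b = b \<union> y" using xy by (auto simp: restr_def)
      ultimately show False using that by simp
    qed
    then have "nested_compat B x y" using xy by (auto simp: nested_compat_def restr_def)
    then show "nested_compat B x y \<and> nested_compat B y x" by (simp add: compat_sym)
  qed auto
  moreover have "clique_sum s ?V (nested_compat B) = nested_sum s b (restr B b)"
    unfolding nested_sum_def by (rule clique_sum_cong) (auto simp: nested_compat_def restr_def)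
  moreover have "clique_sum s ?W (nested_compat B) = nested_sum s (S - b) (contr B b)"
  proof -
    let ?g = "\<lambda>J. J - b"
    have trace: "c \<union> b \<in> B" if "c \<in> B" "c \<inter> b \<noteq> {}" for c
      using un[OF that(1) b that(2)] .
    have inj: "inj_on ?g ?W"
    proof (rule inj_onI)
      fix J K assume *: "J \<in> ?W" "K \<in> ?W" "J - b = K - b"
      consider "b \<subset> J" "b \<subset> K" | "b \<inter> J = {}" "b \<inter> K = {}" | "b \<subset> J" "b \<inter> K = {}" "b \<union> K \<notin> B"
        | "b \<inter> J = {}" "b \<subset> K" "b \<union> J \<notin> B" using * by blast
      then show "J = K"
      proof cases
        case 3
        then have "b \<union> K = J" using *(3) by blast
        then show ?thesis using 3 * by simp
      next
        case 4
        then have "b \<union> J = K" using *(3) by blast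
        then show ?thesis using 4 * by simp
      qed (use * in blast)+
    qed
    have img: "contr B b - {S - b} = ?g ` ?W"
    proof (intro equalityI subsetI)
      fix e assume "e \<in> contr B b - {S - b}"
      then obtain c where c: "c \<in> B" "\<not> c \<subseteq> b" "e = c - b" "c - b \<noteq> S - b"
        by (auto simp: contr_def)
      show "e \<in> ?g ` ?W"
      proof (cases "c \<inter> b = {} \<and> c \<union> b \<notin> B")
        case True
        then have "c \<in> ?W" using c by (auto simp: Un_commute)
        then show ?thesis using c(3) by blast
      next
        case False
        then have "c \<union> b \<in> B" using trace c(1) by blast
        moreover have "c \<union> b \<noteq> S" using c(4) by auto
        ultimately have "c \<union> b \<in> ?W" using c(2) by auto
        moreover have "e = (c \<union> b) - b" using c(3) by auto
        ultimately show ?thesis by blast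
      qed
    next
      fix e assume "e \<in> ?g ` ?W"
      then obtain J where J: "J \<in> ?W" "e = J - b" by blast
      have "J \<noteq> {}" using J nempty by auto
      then have "\<not> J \<subseteq> b" using J by auto
      moreover have "J - b \<noteq> S - b"
      proof
        assume eq: "J - b = S - b"
        have "b \<subseteq> S" "J \<subseteq> S" using sub b J by auto
        then have "b \<union> J = S" using eq by blast
        then show False using J SB by auto
      qed
      ultimately show "e \<in> contr B b - {S - b}" using J by (auto simp: contr_def)
    qed
    have memc: "e \<in> contr B b \<longleftrightarrow> e \<noteq> {} \<and> e \<inter> b = {} \<and> (e \<in> B \<or> e \<union> b \<in> B)" for e
    proof
      assume "e \<in> contr B b"
      then obtain c where c: "c \<in> B" "\<not> c \<subseteq> b" "e = c - b" by (auto simp: contr_def)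
      show "e \<noteq> {} \<and> e \<inter> b = {} \<and> (e \<in> B \<or> e \<union> b \<in> B)"
      proof (cases "c \<inter> b = {}")
        case True
        then have "c - b = c" by blast
        then show ?thesis using c by auto
      next
        case False
        then have "c \<union> b \<in> B" using trace c by blast
        then show ?thesis using c by auto
      qed
    next
      assume e: "e \<noteq> {} \<and> e \<inter> b = {} \<and> (e \<in> B \<or> e \<union> b \<in> B)"
      then have "e = e - b" "e = (e \<union> b) - b" "\<not> e \<subseteq> b" "\<not> e \<union> b \<subseteq> b" by auto
      then show "e \<in> contr B b" using e unfolding contr_def by blast
    qed
    have mixed: "nested_compat (contr B b) (J - b) K = nested_compat B J K"
      if J: "b \<subset> J" "J \<in> B" and K: "b \<inter> K = {}" "b \<union> K \<notin> B" "K \<in> B" for J K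
    proof -
      have Kb: "K - b = K" using K by auto
      have "K \<noteq> {}" "J - b \<noteq> {}" "b \<noteq> {}" using nempty K J b by auto
      have 1: "\<not> J - b \<subseteq> K"
      proof
        assume s: "J - b \<subseteq> K"
        then have "J \<inter> K \<noteq> {}" using \<open>J - b \<noteq> {}\<close> by blast
        then have "J \<union> K \<in> B" using un J K by blast
        moreover have "J \<union> K = b \<union> K" using s J by blast
        ultimately show False using K by simp
      qed
      have 2: "\<not> J \<subseteq> K" using J K \<open>b \<noteq> {}\<close> by blast
      have "(J - b \<union> K \<in> contr B b) = (J \<union> K \<in> B)" if "J \<inter> K = {}"
      proof
        assume "J - b \<union> K \<in> contr B b"
        then consider "J - b \<union> K \<in> B" | "J - b \<union> K \<union> b \<in> B" using memc by blast
        then show "J \<union> K \<in> B"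
        proof cases
          case 1
          then have "(J - b \<union> K) \<union> J \<in> B" using un[of "J - b \<union> K" J] J \<open>J - b \<noteq> {}\<close> by blast
          moreover have "(J - b \<union> K) \<union> J = J \<union> K" by blast
          ultimately show ?thesis by simp
        next
          case 2
          moreover have "J - b \<union> K \<union> b = J \<union> K" using J by blast
          ultimately show ?thesis by simp
        qed
      next
        assume "J \<union> K \<in> B"
        moreover have "J - b \<union> K \<union> b = J \<union> K" using J by blast
        ultimately have "J - b \<union> K \<union> b \<in> B" by simp
        then show "J - b \<union> K \<in> contr B b" using memc K \<open>K \<noteq> {}\<close> by blast
      qed
      moreover have "J \<inter> K = {} \<longleftrightarrow> (J - b) \<inter> K = {}" "K \<subseteq> J \<longleftrightarrow> K \<subseteq> J - b"
        using K by blast+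
      ultimately show ?thesis using 1 2 unfolding nested_compat_def by blast
    qed
    have R: "nested_compat (contr B b) (J - b) (K - b) = nested_compat B J K" if JK: "J \<in> ?W" "K \<in> ?W" for J K
    proof -
      have JKB: "J \<in> B" "K \<in> B" using JK by auto
      consider "b \<subset> J" "b \<subset> K" | "b \<inter> J = {}" "b \<union> J \<notin> B" "b \<inter> K = {}" "b \<union> K \<notin> B"
        | "b \<subset> J" "b \<inter> K = {}" "b \<union> K \<notin> B" | "b \<inter> J = {}" "b \<union> J \<notin> B" "b \<subset> K"
        using JK by blast
      then show ?thesis
      proof cases
        case 1
        have J: "b \<noteq> {}" "J \<union> K \<in> B"
          using un[OF JKB] 1 nempty[OF b] by blast+
        have "(J - b) \<union> (K - b) \<union> b = J \<union> K" using 1 by blast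
        then have "(J - b) \<union> (K - b) \<in> contr B b"
          using J 1 memc[of "(J - b) \<union> (K - b)"] by auto
        then show ?thesis using 1 J unfolding nested_compat_def by blast
      next
        case 2
        have e: "J - b = J" "K - b = K" using 2 by auto
        have "(J \<union> K \<in> contr B b) = (J \<union> K \<in> B)" if "J \<inter> K = {}"
        proof
          assume "J \<union> K \<in> contr B b"
          then consider "J \<union> K \<in> B" | "J \<union> K \<union> b \<in> B" using memc by blast
          then show "J \<union> K \<in> B"
          proof cases
            \<comment> \<open>Were \<open>J \<union> K\<close> not in \<open>B\<close>, the disjoint
              sets \<open>J\<close>, \<open>K\<close>, \<open>b\<close> would be pairwise compatible
              and \<open>compat_triple\<close> would exclude their union.\<close>
            case 2
            then show ?thesis
              using compat_triple[OF bs sp, of J K b] JKB b that \<open>b \<inter> J = {}\<close> \<open>b \<inter> K = {}\<close>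
                \<open>b \<union> J \<notin> B\<close> \<open>b \<union> K \<notin> B\<close> by (auto simp: Un_commute Int_commute)
          qed
        next
          assume "J \<union> K \<in> B"
          then show "J \<union> K \<in> contr B b" using memc 2 nempty by blast
        qed
        then show ?thesis unfolding e nested_compat_def by blast
      next
        case 3
        then have "K - b = K" by auto
        then show ?thesis using mixed[of J K] 3 JKB by simp
      next
        case 4
        then have "J - b = J" by auto
        then show ?thesis using mixed[of K J] 4 JKB by (metis compat_sym)
      qed
    qed
    show ?thesis
      unfolding nested_sum_def img by (rule clique_sum_reindex[OF inj, symmetric]) (use R in blast)
  qed
  ultimately show ?thesis by (simp only: VW)
qed

lemma nested_sum_insert:
  fixes B :: "'n::finite set set"
  assumes B: "flag_bs S B" and B': "flag_bs S (insert b B)" and b: "b \<notin> B"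
  shows "(1 + 2 * s) * nested_sum s S (insert b B) = (1 + 2 * s) * nested_sum s S B +
    (s + s\<^sup>2) * (nested_sum s b (restr (insert b B) b) * nested_sum s (S - b) (contr (insert b B) b))"
proof -
  have "insert b B - {S, b} = B - {S}" using b by auto
  then show ?thesis
    using nested_sum_insert_link[OF assms, of s] link_join[OF B', of b s] by simp
qed

section \<open>Restrictions, contractions and laminar building sets\<close>

definition laminar :: "'n set set \<Rightarrow> bool" where
  "laminar D \<longleftrightarrow> (\<forall>I\<in>D. \<forall>J\<in>D. I \<inter> J \<noteq> {} \<longrightarrow> I \<subseteq> J \<or> J \<subseteq> I)"

lemma flag_bs_restr:
  assumes B: "flag_bs S B" and b: "b \<in> B"
  shows "flag_bs b (restr B b)"
proof -
  have bs: "building_set S B" and sp: "splitting B" using B by (auto simp: flag_bs_def)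
  have "building_set b (restr B b)"
    using building_ne[OF bs] building_un[OF bs] building_single[OF bs] building_sub[OF bs b]
    unfolding building_set_def restr_def by auto
  moreover have "splitting (restr B b)"
    unfolding splitting_def restr_def
  proof clarify
    fix I assume I: "I \<in> B" "I \<subseteq> b" and nex: "\<not> (\<exists>J\<in>{c\<in>B. c \<subseteq> b}. \<exists>K\<in>{c\<in>B. c \<subseteq> b}. J \<inter> K = {} \<and> J \<union> K = I)"
    show "\<exists>i. I = {i}"
      using sp I(1)
    proof (cases rule: splittingE)
      case (2 J K)
      then have "J \<subseteq> b" "K \<subseteq> b" using I(2) by auto
      then show ?thesis using 2 nex by auto
    qed auto
  qed
  ultimately show ?thesis using b by (auto simp: flag_bs_def restr_def)
qed

text \<open>For \<open>splitting\<close>, a trace is represented by a member \<open>d\<close> of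
  least size. Neither part of a split of \<open>d\<close> lies inside \<open>c\<close>, since the
  other part would be a smaller representative; so the traces of the parts split the trace of
  \<open>d\<close>.\<close>

lemma flag_bs_contr:
  fixes B :: "'n::finite set set"
  assumes B: "flag_bs S B" and c: "\<not> S \<subseteq> c"
  shows "flag_bs (S - c) (contr B c)"
proof -
  have bs: "building_set S B" and sp: "splitting B" and SB: "S \<in> B" using B by (auto simp: flag_bs_def)
  have "building_set (S - c) (contr B c)"
    unfolding building_set_def
  proof (intro conjI ballI impI)
    fix I assume "I \<in> contr B c"
    then show "I \<noteq> {}" "I \<subseteq> S - c" using building_sub[OF bs] by (auto simp: contr_def)
  next
    fix I J assume "I \<in> contr B c" "J \<in> contr B c" and ne: "I \<inter> J \<noteq> {}"
    then obtain I' J' where IJ: "I' \<in> B" "J' \<in> B" "I = I' - c" "J = J' - c"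
      by (auto simp: contr_def)
    then have "I' \<union> J' \<in> B" using building_un[OF bs, of I' J'] ne by blast
    moreover have "I \<union> J = (I' \<union> J') - c" "\<not> I' \<union> J' \<subseteq> c" using IJ ne by auto
    ultimately show "I \<union> J \<in> contr B c" unfolding contr_def by blast
  next
    fix i assume "i \<in> S - c"
    then have "{i} \<in> B" "{i} = {i} - c" "\<not> {i} \<subseteq> c" using building_single[OF bs] by auto
    then show "{i} \<in> contr B c" unfolding contr_def by blast
  qed
  moreover have "splitting (contr B c)"
    unfolding splitting_def
  proof
    fix I assume I: "I \<in> contr B c"
    define P where "P d \<longleftrightarrow> d \<in> B \<and> d - c = I" for d
    have ex: "\<exists>d. P d" using I by (auto simp: contr_def P_def)
    then obtain d where d: "P d" and min: "\<And>e. P e \<Longrightarrow> card d \<le> card e"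
      using ex_has_least_nat[of P _ card] by blast
    have dB: "d \<in> B" "d - c = I" using d by (auto simp: P_def)
    have Ine: "I \<noteq> {}" using I by (auto simp: contr_def)
    show "(\<exists>i. I = {i}) \<or> (\<exists>J\<in>contr B c. \<exists>K\<in>contr B c. J \<inter> K = {} \<and> J \<union> K = I)"
      using sp dB(1)
    proof (cases rule: splittingE)
      case (1 i)
      then show ?thesis using dB Ine by auto
    next
      case (2 J K)
      have "J \<noteq> {}" "K \<noteq> {}" using 2 building_ne[OF bs] by auto
      then have "J \<subset> d" "K \<subset> d" using 2 by auto
      then have "\<not> P J" "\<not> P K" using min by (meson leD psubset_card_mono finite)+
      then have "\<not> K \<subseteq> c" "\<not> J \<subseteq> c" using 2 dB by (auto simp: P_def)
      then have "J - c \<in> contr B c" "K - c \<in> contr B c" using 2 by (auto simp: contr_def)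
      moreover have "(J - c) \<inter> (K - c) = {}" "(J - c) \<union> (K - c) = I" using 2 dB by auto
      ultimately show ?thesis by blast
    qed
  qed
  moreover have "S - c \<in> contr B c" using SB c by (auto simp: contr_def)
  ultimately show ?thesis by (simp add: flag_bs_def)
qed

text \<open>A laminar connected flag building set is a binary tree, and its nested sets form the
  boundary of a cross-polytope: siblings are the antipodal pairs, one for each of the
  \<open>card S - 1\<close> inner vertices. The induction suspends the join of the two subtrees over
  the children of the root.\<close>

lemma nested_sum_laminar:
  fixes D :: "'n::finite set set"
  assumes "flag_bs S D" "laminar D"
  shows "nested_sum s S D = (1 + 2 * s) ^ (card S - 1)"
  using assms
proof (induction "card S" arbitrary: S D rule: less_induct)
  case less
  have bs: "building_set S D" and sp: "splitting D" and SD: "S \<in> D" and lam: "laminar D"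
    using less.prems by (auto simp: flag_bs_def)
  show ?case
    using sp SD
  proof (cases rule: splittingE)
    case (1 i)
    then have "D - {S} = {}" using building_ne[OF bs] building_sub[OF bs] by blast
    then show ?thesis using 1 by (simp only: nested_sum_def) simp
  next
    case (2 b1 b2)
    have ne: "b1 \<noteq> {}" "b2 \<noteq> {}" using 2 building_ne[OF bs] by auto
    then have "b1 \<subset> S" "b2 \<subset> S" using 2 by auto
    then have less_card: "card b1 < card S" "card b2 < card S" by (auto intro: psubset_card_mono)
    let ?V = "\<lambda>b. restr D b - {b}"
    have nested: "clique_sum s (?V b) (nested_compat D) = (1 + 2 * s) ^ (card b - 1)"
      if "b \<in> D" "card b < card S" for b
    proof -
      have "laminar (restr D b)" using lam by (auto simp: laminar_def restr_def)
      then have "nested_sum s b (restr D b) = (1 + 2 * s) ^ (card b - 1)"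
        using less.hyps[OF that(2)] flag_bs_restr[OF less.prems(1) that(1)] by blast
      moreover have "clique_sum s (?V b) (nested_compat D) = nested_sum s b (restr D b)"
        unfolding nested_sum_def by (rule clique_sum_cong) (auto simp: nested_compat_def restr_def)
      ultimately show ?thesis by simp
    qed
    have below: "c \<subseteq> b1 \<or> c \<subseteq> b2" if c: "c \<in> D" "c \<noteq> S" for c
    proof (rule ccontr)
      assume n: "\<not> (c \<subseteq> b1 \<or> c \<subseteq> b2)"
      have "c \<subseteq> S" using building_sub[OF bs c(1)] .
      then have "c \<inter> b1 \<noteq> {}" "c \<inter> b2 \<noteq> {}" using n 2 by auto
      then have "b1 \<subseteq> c" "b2 \<subseteq> c" using n lam 2 c(1) unfolding laminar_def by blast+
      then show False using c \<open>c \<subseteq> S\<close> 2 by auto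
    qed
    have across: "x \<union> y \<notin> D" if "x \<subset> b1 \<and> y \<subseteq> b2 \<or> x \<subseteq> b1 \<and> y \<subset> b2" "x \<noteq> {}" "y \<noteq> {}" for x y
    proof
      assume xy: "x \<union> y \<in> D"
      have "x \<union> y \<noteq> S" using that 2 by blast
      then have "x \<union> y \<subseteq> b1 \<or> x \<union> y \<subseteq> b2" using below xy by blast
      then show False using that 2(3) by blast
    qed
    have "D - {S} = insert b1 (insert b2 (?V b1 \<union> ?V b2))"
    proof (intro equalityI subsetI)
      fix c assume "c \<in> D - {S}"
      then show "c \<in> insert b1 (insert b2 (?V b1 \<union> ?V b2))" using below[of c] by (auto simp: restr_def)
    next
      fix c assume "c \<in> insert b1 (insert b2 (?V b1 \<union> ?V b2))"
      then show "c \<in> D - {S}" using 2 \<open>b1 \<subset> S\<close> \<open>b2 \<subset> S\<close> by (auto simp: restr_def)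
    qed
    moreover have "clique_sum s (insert b1 (insert b2 (?V b1 \<union> ?V b2))) (nested_compat D) =
        (1 + 2 * s) * clique_sum s (?V b1 \<union> ?V b2) (nested_compat D)"
    proof (rule clique_sum_suspension)
      show "b1 \<notin> ?V b1 \<union> ?V b2" "b2 \<notin> ?V b1 \<union> ?V b2" "b1 \<noteq> b2"
        using 2(3) ne by (auto simp: restr_def)
      show "\<not> nested_compat D b1 b2" using 2 ne SD by (auto simp: nested_compat_def)
      fix w assume w: "w \<in> ?V b1 \<union> ?V b2"
      then have "w \<noteq> {}" using building_ne[OF bs] by (auto simp: restr_def)
      then show "nested_compat D b1 w \<and> nested_compat D b2 w"
        using w across[of b1 w] across[of w b2] ne 2(3) by (auto simp: restr_def nested_compat_def Un_commute)
    qed (auto intro: compat_sym)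
    moreover have "clique_sum s (?V b1 \<union> ?V b2) (nested_compat D) =
        clique_sum s (?V b1) (nested_compat D) * clique_sum s (?V b2) (nested_compat D)"
    proof (rule clique_sum_join)
      show "?V b1 \<inter> ?V b2 = {}"
      proof (rule ccontr)
        assume "?V b1 \<inter> ?V b2 \<noteq> {}"
        then obtain x where "x \<in> D" "x \<subseteq> b1" "x \<subseteq> b2" by (auto simp: restr_def)
        then show False using 2(3) building_ne[OF bs, of x] by blast
      qed
      fix x y assume xy: "x \<in> ?V b1" "y \<in> ?V b2"
      then have "x \<noteq> {}" "y \<noteq> {}" using building_ne[OF bs] by (auto simp: restr_def)
      then have "nested_compat D x y"
        using xy across[of x y] 2(3) by (auto simp: restr_def nested_compat_def)
      then show "nested_compat D x y \<and> nested_compat D y x" by (simp add: compat_sym)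
    qed auto
    ultimately have "nested_sum s S D =
        (1 + 2 * s) * ((1 + 2 * s) ^ (card b1 - 1) * (1 + 2 * s) ^ (card b2 - 1))"
      using nested[of b1] nested[of b2] 2 less_card by (simp add: nested_sum_def)
    also have "\<dots> = (1 + 2 * s) ^ (Suc ((card b1 - 1) + (card b2 - 1)))"
      by (simp add: power_add)
    also have "Suc ((card b1 - 1) + (card b2 - 1)) = card S - 1"
    proof -
      have "card S = card b1 + card b2" using 2 card_Un_disjoint[of b1 b2] by auto
      moreover have "card b1 > 0" "card b2 > 0" using ne by (auto simp: card_gt_0_iff)
      ultimately show ?thesis by simp
    qed
    finally show ?thesis .
  qed
qed


section \<open>Flag orderings\<close>

text \<open>
  Flag orderings are indexed here by a finite set \<open>X\<close> of numbers instead of \<open>{1..k}\<close>, so that the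
  orderings induced on \<open>B|b\<^sub>k\<close> and \<open>B/b\<^sub>k\<close> can keep the indices of the original one.
\<close>

definition stage :: "'n set set \<Rightarrow> nat set \<Rightarrow> (nat \<Rightarrow> 'n set) \<Rightarrow> nat \<Rightarrow> 'n set set" where
  "stage D X b j = D \<union> b ` {i\<in>X. i < j}"

definition flag_ord :: "'n set \<Rightarrow> 'n set set \<Rightarrow> nat set \<Rightarrow> (nat \<Rightarrow> 'n set) \<Rightarrow> bool" where
  "flag_ord S D X b \<longleftrightarrow> finite X \<and> laminar D \<and> flag_bs S D \<and>
     (\<forall>j\<in>X. b j \<notin> stage D X b j \<and> flag_bs S (insert (b j) (stage D X b j)))"

definition U_rel :: "'n set set \<Rightarrow> nat set \<Rightarrow> (nat \<Rightarrow> 'n set) \<Rightarrow> nat \<Rightarrow> nat \<Rightarrow> bool" where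
  "U_rel D X b i j \<longleftrightarrow> \<not> b i \<subseteq> b j \<and> \<not> (\<exists>e\<in>stage D X b i. e - b j = b i - b j)"

definition V_rel :: "'n set set \<Rightarrow> nat set \<Rightarrow> (nat \<Rightarrow> 'n set) \<Rightarrow> nat \<Rightarrow> nat \<Rightarrow> bool" where
  "V_rel D X b i j \<longleftrightarrow> b i \<subseteq> b j \<and> (\<exists>e\<in>stage D X b i. b i \<subset> e \<and> e \<subset> b j)"

definition Gamma_adj :: "'n set set \<Rightarrow> nat set \<Rightarrow> (nat \<Rightarrow> 'n set) \<Rightarrow> nat \<Rightarrow> nat \<Rightarrow> bool" where
  "Gamma_adj D X b i j \<longleftrightarrow>
     (i < j \<and> (U_rel D X b i j \<or> V_rel D X b i j)) \<or> (j < i \<and> (U_rel D X b j i \<or> V_rel D X b j i))"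

lemma Gamma_adj_sym: "Gamma_adj D X b i j \<Longrightarrow> Gamma_adj D X b j i"
  by (auto simp: Gamma_adj_def)

lemma stage_mono: "i \<le> j \<Longrightarrow> stage D X b i \<subseteq> stage D X b j"
  by (auto simp: stage_def)

lemma stage_Suc: "j \<in> X \<Longrightarrow> stage D X b (Suc j) = insert (b j) (stage D X b j)"
  by (auto simp: stage_def less_Suc_eq)

lemma stage_0: "stage D X b 0 = D"
  by (simp add: stage_def)

lemma mem_stage: "i \<in> X \<Longrightarrow> i < j \<Longrightarrow> b i \<in> stage D X b j"
  by (auto simp: stage_def)

lemma flag_bs_stage:
  assumes "flag_ord S D X b"
  shows "flag_bs S (stage D X b j)"
proof (induction j)
  case 0
  then show ?case using assms by (simp add: stage_0 flag_ord_def)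
next
  case (Suc j)
  show ?case
  proof (cases "j \<in> X")
    case True
    then show ?thesis using assms by (simp add: stage_Suc flag_ord_def)
  next
    case False
    then have "stage D X b (Suc j) = stage D X b j" by (auto simp: stage_def less_Suc_eq)
    then show ?thesis using Suc by simp
  qed
qed

section \<open>The last set of a flag ordering\<close>

locale flag_ord_last =
  fixes S :: "'n::finite set" and D X b k
  assumes ord: "flag_ord S D X b" and kX: "k \<in> X" and kmax: "\<And>i. i \<in> X \<Longrightarrow> i \<le> k"
begin

abbreviation "st \<equiv> stage D X b"
abbreviation "c \<equiv> b k"

lemma mem_st: "i \<in> X \<Longrightarrow> i < j \<Longrightarrow> b i \<in> st j"
  by (rule mem_stage)

lemma st_mono: "i \<le> j \<Longrightarrow> st i \<subseteq> st j"
  by (rule stage_mono)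

lemma bs: "building_set S (st j)" and sp: "splitting (st j)" and S_st: "S \<in> st j"
  using flag_bs_stage[OF ord] by (auto simp: flag_bs_def)

lemma not_mem: "j \<in> X \<Longrightarrow> i \<le> j \<Longrightarrow> b j \<notin> st i"
  using ord st_mono[of i j] by (auto simp: flag_ord_def)

lemma b_inj: "i \<in> X \<Longrightarrow> j \<in> X \<Longrightarrow> b i = b j \<Longrightarrow> i = j"
  using not_mem mem_st by (metis le_refl linorder_neqE_nat)

lemma c_psub: "c \<subset> S"
  using not_mem[OF kX, of k] S_st[of k] building_sub[OF bs, of c "Suc k"] mem_st[OF kX, of "Suc k"]
  by auto

lemma b_ne: "i \<in> X \<Longrightarrow> b i \<noteq> {}"
  using building_ne[OF bs, of "b i" "Suc i"] mem_st[of i "Suc i"] by auto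

lemma un_cases:
  assumes "i \<in> X" "d \<in> st i" "d \<inter> b i \<noteq> {}"
  obtains "d \<subseteq> b i" | "d \<union> b i \<in> st i"
proof -
  have "d \<union> b i \<in> st (Suc i)"
    using building_un[OF bs, of d "Suc i" "b i"] assms stage_Suc[of i X D b] by auto
  then consider "d \<union> b i = b i" | "d \<union> b i \<in> st i" using stage_Suc[of i X D b] assms(1) by auto
  then show ?thesis using that by cases auto
qed

section \<open>Restriction to the last set\<close>

definition V_last :: "nat set" where
  "V_last = {i\<in>X. i < k \<and> V_rel D X b i k}"

definition U_last :: "nat set" where
  "U_last = {i\<in>X. i < k \<and> U_rel D X b i k}"

text \<open>
  The \<open>b i\<close> with \<open>i \<in> T\<close> are the sets inside \<open>c\<close> which are maximal in \<open>c\<close> at the time they are added;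
  with the members of \<open>D\<close> inside \<open>c\<close> they make up the decomposition of \<open>c\<close>.
\<close>

definition T :: "nat set" where
  "T = {i\<in>X. b i \<subseteq> c \<and> \<not> (\<exists>e\<in>st i. b i \<subset> e \<and> e \<subset> c)}"

definition E :: "'n set set" where
  "E = restr D c \<union> b ` T"

lemma k_T: "k \<in> T" using kX by (auto simp: T_def)

lemma V_last_or_T: "i \<in> X \<Longrightarrow> b i \<subseteq> c \<Longrightarrow> i \<in> T \<or> i \<in> V_last"
  using kmax[of i] by (cases "i = k") (auto simp: V_last_def T_def V_rel_def)

lemma V_last_not_T: "i \<in> V_last \<Longrightarrow> i \<notin> T"
  by (auto simp: V_last_def T_def V_rel_def)

text \<open>Otherwise \<open>d \<union> b i\<close> would be an older set strictly between
  \<open>b i\<close> and \<open>c\<close>, contrary to the maximality of \<open>b i\<close>; it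
  differs from \<open>c\<close> because \<open>c\<close> comes last.\<close>

lemma T_absorbs:
  assumes i: "i \<in> T" and d: "d \<in> st i" "d \<subseteq> c" "d \<inter> b i \<noteq> {}"
  shows "d \<subseteq> b i"
proof (cases "i = k")
  case True
  then show ?thesis using d by simp
next
  case False
  have iX: "i \<in> X" using i by (simp add: T_def)
  show ?thesis
    using iX d(1,3)
  proof (cases rule: un_cases)
    case 2
    have "c \<notin> st i" using not_mem[OF kX] kmax[OF iX] by blast
    then have "d \<union> b i \<noteq> c" using 2 by auto
    then show ?thesis using i 2 d(2) by (auto simp: T_def)
  qed
qed

text \<open>The induced ordering starts with all sets of \<open>T\<close>, including those with
  index at least \<open>j\<close>. These premature sets are the only deviation from the restricted
  stages.\<close>

lemma stage_restr_eq:
  assumes "j \<le> Suc k"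
  shows "stage E V_last b j = restr (st j) c \<union> b ` T"
proof (intro equalityI subsetI)
  fix d assume "d \<in> stage E V_last b j"
  then consider "d \<in> restr D c" | "d \<in> b ` T" | i where "i \<in> V_last" "i < j" "d = b i"
    by (auto simp: stage_def E_def)
  then show "d \<in> restr (st j) c \<union> b ` T"
    by cases (auto simp: stage_def restr_def V_last_def V_rel_def)
next
  fix d assume "d \<in> restr (st j) c \<union> b ` T"
  then consider "d \<in> restr D c" | "d \<in> b ` T" | i where "i \<in> X" "i < j" "d = b i" "b i \<subseteq> c"
    by (auto simp: stage_def restr_def)
  then show "d \<in> stage E V_last b j"
  proof cases
    case 3
    then show ?thesis using V_last_or_T[of i] by (auto simp: stage_def E_def)
  qed (auto simp: stage_def E_def)
qed

text \<open>A half of \<open>b i\<close> is again maximal in \<open>c\<close>: an older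
  \<open>f\<close> strictly between it and \<open>c\<close> meets \<open>b i\<close>, hence lies in
  \<open>b i\<close> by \<open>T_absorbs\<close> and then in one of the halves. So the half is in
  \<open>D\<close> or is a \<open>b l\<close> with \<open>l \<in> T\<close>.\<close>

lemma T_split:
  assumes i: "i \<in> T"
  shows "(\<exists>J\<in>E. \<exists>K\<in>E. J \<inter> K = {} \<and> J \<union> K = b i)"
proof -
  have iX: "i \<in> X" using i by (simp add: T_def)
  have nm: "b i \<notin> st i" using not_mem[OF iX] by simp
  have B': "building_set S (insert (b i) (st i))" "splitting (insert (b i) (st i))"
    using ord iX by (auto simp: flag_ord_def flag_bs_def)
  obtain b1 b2 where b12: "b1 \<in> st i" "b2 \<in> st i" "b1 \<inter> b2 = {}" "b1 \<union> b2 = b i"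
    and below: "\<And>d. d \<in> st i \<Longrightarrow> d \<subseteq> b i \<Longrightarrow> d \<subseteq> b1 \<or> d \<subseteq> b2"
    using insert_split[OF bs B' nm] by metis
  have mem: "d \<in> E" if d: "d \<in> st i" "d \<subseteq> b i" "d \<inter> e = {}" "\<And>d'. d' \<in> st i \<Longrightarrow> d' \<subseteq> b i \<Longrightarrow> d' \<subseteq> d \<or> d' \<subseteq> e"
    for d e
  proof -
    have dne: "d \<noteq> {}" using building_ne[OF bs d(1)] .
    have dc: "d \<subseteq> c" using d(2) i by (auto simp: T_def)
    have max: "\<not> (d \<subset> f \<and> f \<subset> c)" if f: "f \<in> st i" for f
    proof
      assume df: "d \<subset> f \<and> f \<subset> c"
      then have "f \<inter> b i \<noteq> {}" using d(2) dne by auto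
      then have "f \<subseteq> b i" using T_absorbs[OF i f] df by auto
      then show False using d(3,4) f df dne by blast
    qed
    show ?thesis
    proof (cases "d \<in> D")
      case False
      then obtain l where l: "l \<in> X" "l < i" "d = b l" using d(1) by (auto simp: stage_def)
      have "\<not> (b l \<subset> f \<and> f \<subset> c)" if "f \<in> st l" for f
        using max[of f] that l st_mono[of l i] by auto
      then have "l \<in> T" using dc l unfolding T_def by blast
      then show ?thesis using l by (simp add: E_def)
    qed (auto simp: E_def restr_def dc)
  qed
  have sub: "b1 \<subseteq> b i" "b2 \<subseteq> b i" "b2 \<inter> b1 = {}" using b12 by auto
  have "b1 \<in> E" using mem[OF b12(1) sub(1) b12(3) below] .
  moreover have "b2 \<in> E" using mem[OF b12(2) sub(2,3)] below by blast
  ultimately show ?thesis using b12 by blast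
qed

text \<open>Sets of \<open>T\<close> not yet reached at stage \<open>j\<close> absorb all earlier
  sets inside \<open>c\<close> that they meet, so adding them early creates no new unions.
  \<open>j = 0\<close> gives the decomposition of \<open>c\<close>, larger \<open>j\<close> the
  stages of the induced ordering.\<close>

lemma flag_bs_restr_stage: "flag_bs c (restr (st j) c \<union> b ` T)"
proof -
  let ?F = "restr (st j) c \<union> b ` T"
  have TF: "I \<union> b i \<in> ?F" if I: "I \<in> restr (st j) c" "i \<in> T" "I \<inter> b i \<noteq> {}" for I i
  proof (cases "i < j")
    case True
    have "b i \<in> st j" "b i \<subseteq> c" "I \<in> st j" "I \<subseteq> c"
      using I(1,2) mem_st[OF _ True] by (auto simp: T_def restr_def)
    then have "I \<union> b i \<in> st j" "I \<union> b i \<subseteq> c" using building_un[OF bs _ _ I(3)] by auto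
    then show ?thesis by (simp add: restr_def)
  next
    case False
    then have "I \<in> st i" using I(1) st_mono[of j i] by (auto simp: restr_def)
    then have "I \<subseteq> b i" using T_absorbs[OF I(2)] I by (auto simp: restr_def)
    then show ?thesis using I(2) by (simp add: sup.absorb2)
  qed
  have TT: "b i \<union> b l \<in> ?F" if "i \<in> T" "l \<in> T" "b i \<inter> b l \<noteq> {}" for i l
  proof -
    have *: "b i \<union> b l = b l" if "i \<in> T" "l \<in> T" "b i \<inter> b l \<noteq> {}" "i \<le> l" for i l
    proof (cases "i = l")
      case False
      then have "i < l" "i \<in> X" "b i \<subseteq> c" using that by (auto simp: T_def)
      then have "b i \<subseteq> b l" using T_absorbs[OF that(2) mem_st _ that(3)] by blast
      then show ?thesis by (rule sup.absorb2)
    qed simp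
    show ?thesis using *[of i l] *[of l i] that by (metis Int_commute Un_commute UnI2 imageI nat_le_linear)
  qed
  have "building_set c ?F"
    unfolding building_set_def
  proof (intro conjI ballI impI)
    fix I assume "I \<in> ?F"
    then show "I \<noteq> {}" "I \<subseteq> c" using building_ne[OF bs] b_ne by (auto simp: restr_def T_def)
  next
    fix I J assume IJ: "I \<in> ?F" "J \<in> ?F" "I \<inter> J \<noteq> {}"
    then consider "I \<in> restr (st j) c" "J \<in> restr (st j) c" | i where "I \<in> restr (st j) c" "J = b i" "i \<in> T"
      | i where "J \<in> restr (st j) c" "I = b i" "i \<in> T" | i l where "I = b i" "i \<in> T" "J = b l" "l \<in> T"
      by blast
    then show "I \<union> J \<in> ?F"
    proof cases
      case 1
      then show ?thesis using building_un[OF bs, of I j J] IJ(3) by (auto simp: restr_def)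
    next
      case 2
      then show ?thesis using TF IJ(3) by blast
    next
      case 3
      then show ?thesis using TF[of J] IJ(3) by (metis Int_commute Un_commute)
    next
      case 4
      then show ?thesis using TT IJ(3) by blast
    qed
  next
    fix i assume "i \<in> c"
    then show "{i} \<in> ?F" using building_single[OF bs] c_psub by (auto simp: restr_def)
  qed
  moreover have "splitting ?F"
    unfolding splitting_def
  proof
    fix I assume "I \<in> ?F"
    then consider "I \<in> st j" "I \<subseteq> c" | i where "i \<in> T" "I = b i" by (auto simp: restr_def)
    then show "(\<exists>i. I = {i}) \<or> (\<exists>J\<in>?F. \<exists>K\<in>?F. J \<inter> K = {} \<and> J \<union> K = I)"
    proof cases
      case 1
      show ?thesis
        using sp 1(1)
      proof (cases rule: splittingE)
        case (2 J K)
        then have "J \<in> ?F" "K \<in> ?F" using 1 by (auto simp: restr_def)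
        then show ?thesis using 2 by blast
      qed auto
    next
      case 2
      have "restr D c \<subseteq> restr (st j) c" by (auto simp: restr_def stage_def)
      then have EF: "E \<subseteq> ?F" unfolding E_def by (rule Un_mono) (rule order_refl)
      have "\<exists>J\<in>E. \<exists>K\<in>E. J \<inter> K = {} \<and> J \<union> K = I"
        unfolding 2(2) by (rule T_split[OF 2(1)])
      then obtain J K where JK: "J \<in> E" "K \<in> E" "J \<inter> K = {}" "J \<union> K = I" by blast
      show ?thesis
        by (intro disjI2, rule bexI[OF _ subsetD[OF EF JK(1)]], rule bexI[OF _ subsetD[OF EF JK(2)]])
          (intro conjI JK)
    qed
  qed
  moreover have "c \<in> ?F" by (intro UnI2 imageI k_T)
  ultimately show ?thesis by (simp add: flag_bs_def)
qed

lemma flag_ord_restr: "flag_ord c E V_last b"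
  unfolding flag_ord_def
proof (intro conjI ballI)
  show "finite V_last" using ord by (auto simp: V_last_def flag_ord_def)
  have D0: "E = restr (st 0) c \<union> b ` T" by (simp add: E_def stage_0)
  then show "flag_bs c E" using flag_bs_restr_stage by metis
  show "laminar E"
    unfolding laminar_def
  proof (intro ballI impI)
    fix I J assume IJ: "I \<in> E" "J \<in> E" "I \<inter> J \<noteq> {}"
    have *: "d \<subseteq> b i" if "d \<in> restr D c" "i \<in> T" "d \<inter> b i \<noteq> {}" for d i
      using T_absorbs[OF that(2), of d] that by (auto simp: restr_def stage_def)
    have **: "b l \<subseteq> b i" if "l \<in> T" "i \<in> T" "b l \<inter> b i \<noteq> {}" "l \<le> i" for l i
    proof (cases "l = i")
      case False
      then show ?thesis using T_absorbs[OF that(2), of "b l"] that mem_st by (auto simp: T_def)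
    qed simp
    have "I \<in> restr D c \<or> (\<exists>i\<in>T. I = b i)" "J \<in> restr D c \<or> (\<exists>i\<in>T. J = b i)"
      using IJ(1,2) unfolding E_def by blast+
    moreover have "restr D c \<subseteq> D" by (auto simp: restr_def)
    ultimately consider "I \<in> D" "J \<in> D" | i where "I \<in> restr D c" "J = b i" "i \<in> T"
      | i where "J \<in> restr D c" "I = b i" "i \<in> T" | i l where "I = b i" "i \<in> T" "J = b l" "l \<in> T"
      by blast
    then show "I \<subseteq> J \<or> J \<subseteq> I"
    proof cases
      case 1
      then show ?thesis using ord IJ(3) unfolding flag_ord_def laminar_def by blast
    next
      case 2
      then show ?thesis using * IJ(3) by blast
    next
      case 3
      then show ?thesis using * IJ(3) by blast
    next
      case 4
      then show ?thesis using **[of i l] **[of l i] IJ(3) by (metis Int_commute nat_le_linear)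
    qed
  qed
  fix j assume j: "j \<in> V_last"
  then have jX: "j \<in> X" "j < k" "b j \<subseteq> c" by (auto simp: V_last_def V_rel_def)
  have eq: "stage E V_last b j = restr (st j) c \<union> b ` T"
    using stage_restr_eq[of j] jX by simp
  show "b j \<notin> stage E V_last b j"
    using not_mem[OF jX(1), of j] V_last_not_T[OF j] b_inj[OF jX(1)] unfolding eq
    by (auto simp: restr_def T_def)
  have "insert (b j) (stage E V_last b j) = restr (st (Suc j)) c \<union> b ` T"
    unfolding eq using jX stage_Suc[of j X D b] by (auto simp: restr_def)
  then show "flag_bs c (insert (b j) (stage E V_last b j))"
    using flag_bs_restr_stage by metis
qed

lemma restr_total: "restr (D \<union> b ` X) c = E \<union> b ` V_last"
proof (intro equalityI subsetI)
  fix d assume "d \<in> restr (D \<union> b ` X) c"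
  then consider "d \<in> restr D c" | i where "i \<in> X" "b i \<subseteq> c" "d = b i" by (auto simp: restr_def)
  then show "d \<in> E \<union> b ` V_last"
    by cases (use V_last_or_T in \<open>auto simp: E_def\<close>)
qed (auto simp: restr_def E_def T_def V_last_def V_rel_def)

text \<open>Only a premature \<open>b l\<close>, with \<open>l \<in> T\<close> and
  \<open>i < l\<close>, could act as an additional witness. But \<open>i \<in> V_last\<close>
  provides an older \<open>e'\<close> strictly between \<open>b i\<close> and \<open>c\<close>, and
  every such \<open>b l\<close> that meets \<open>b i\<close> contains \<open>e'\<close>; then
  \<open>e'\<close> is a witness in its place.\<close>

lemma Gamma_adj_restr:
  assumes ij: "i \<in> V_last" "j \<in> V_last"
  shows "Gamma_adj E V_last b i j = Gamma_adj D X b i j"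
proof -
  have "U_rel E V_last b i j = U_rel D X b i j \<and> V_rel E V_last b i j = V_rel D X b i j"
    if ij: "i \<in> V_last" "j \<in> V_last" "i < j" for i j
  proof -
    have X: "i \<in> X" "j \<in> X" "i < k" "j < k" "b i \<subseteq> c" "b j \<subseteq> c"
      using ij by (auto simp: V_last_def V_rel_def)
    have st: "stage E V_last b i = restr (st i) c \<union> b ` T"
      using stage_restr_eq[of i] X by simp
    obtain e' where e': "e' \<in> st i" "b i \<subset> e'" "e' \<subset> c"
      using ij(1) by (auto simp: V_last_def V_rel_def)
    have big: "e' \<subseteq> b l" if "l \<in> T" "i < l" "b i \<inter> b l \<noteq> {}" for l
      using T_absorbs[OF that(1), of e'] e' st_mono[of i l] that by fastforce
    have U: "(\<exists>e\<in>stage E V_last b i. e - b j = b i - b j) = (\<exists>e\<in>st i. e - b j = b i - b j)"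
      if "\<not> b i \<subseteq> b j"
    proof
      assume "\<exists>e\<in>stage E V_last b i. e - b j = b i - b j"
      then consider e where "e \<in> st i" "e - b j = b i - b j" | l where "l \<in> T" "b l - b j = b i - b j"
        unfolding st by (auto simp: restr_def)
      then show "\<exists>e\<in>st i. e - b j = b i - b j"
      proof cases
        case 1
        then show ?thesis by blast
      next
        case 2
        have "l \<noteq> i" using 2(1) V_last_not_T[OF ij(1)] by auto
        then consider "l < i" | "i < l" by linarith
        then show ?thesis
        proof cases
          case 1
          then have "b l \<in> st i" using 2(1) mem_st by (auto simp: T_def)
          with 2(2-) show ?thesis by (auto intro!: bexI[of _ "b l"])
        next
          case l: 2
          have "e' \<subseteq> b l" using big[OF 2(1) l] 2(2) that by blast
          then have "e' - b j = b i - b j" using e'(2) 2(2) by blast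
          with e'(1) show ?thesis by (auto intro!: bexI[of _ e'])
        qed
      qed
    next
      assume "\<exists>e\<in>st i. e - b j = b i - b j"
      then obtain e where "e \<in> st i" "e - b j = b i - b j" by blast
      moreover then have "e \<subseteq> c" using X by blast
      ultimately show "\<exists>e\<in>stage E V_last b i. e - b j = b i - b j"
        unfolding st by (auto simp: restr_def)
    qed
    have V: "(\<exists>e\<in>stage E V_last b i. b i \<subset> e \<and> e \<subset> b j) = (\<exists>e\<in>st i. b i \<subset> e \<and> e \<subset> b j)"
    proof
      assume "\<exists>e\<in>stage E V_last b i. b i \<subset> e \<and> e \<subset> b j"
      then consider e where "e \<in> st i" "b i \<subset> e" "e \<subset> b j" | l where "l \<in> T" "b i \<subset> b l" "b l \<subset> b j"
        unfolding st by (auto simp: restr_def)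
      then show "\<exists>e\<in>st i. b i \<subset> e \<and> e \<subset> b j"
      proof cases
        case 1
        then show ?thesis by blast
      next
        case 2
        have bi: "b i \<noteq> {}" using b_ne X by blast
        have "l \<noteq> i" using 2(1) V_last_not_T[OF ij(1)] by auto
        then consider "l < i" | "i < l" by linarith
        then show ?thesis
        proof cases
          case 1
          then have "b l \<in> st i" using 2(1) mem_st by (auto simp: T_def)
          with 2(2-) show ?thesis by (auto intro!: bexI[of _ "b l"])
        next
          case l: 2
          have "e' \<subseteq> b l" using big[OF 2(1) l] 2(2) bi by blast
          then show ?thesis using e' 2(3) by blast
        qed
      qed
    next
      assume "\<exists>e\<in>st i. b i \<subset> e \<and> e \<subset> b j"
      then obtain e where e: "e \<in> st i" "b i \<subset> e" "e \<subset> b j" by blast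
      then have "e \<in> restr (st i) c" using X(6) by (auto simp: restr_def)
      then have "e \<in> stage E V_last b i" unfolding st by (rule UnI1)
      then show "\<exists>e\<in>stage E V_last b i. b i \<subset> e \<and> e \<subset> b j" using e(2,3) by blast
    qed
    show ?thesis
      by (cases "b i \<subseteq> b j") (simp_all only: U_rel_def V_rel_def U V simp_thms)
  qed
  from this[of i j] this[of j i] show ?thesis using ij unfolding Gamma_adj_def by blast
qed

text \<open>\<open>d \<union> b j\<close> has the same trace outside \<open>c\<close> as \<open>b j\<close>.\<close>

lemma U_last_absorbs:
  assumes j: "j \<in> U_last" and d: "d \<in> st j" "d \<inter> b j \<noteq> {}" "d \<subseteq> c \<union> b j"
  shows "d \<subseteq> b j"
proof -
  have jX: "j \<in> X" using j by (simp add: U_last_def)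
  show ?thesis
    using jX d(1,2)
  proof (cases rule: un_cases)
    case 2
    moreover have "d \<union> b j - c = b j - c" using d(3) by blast
    ultimately show ?thesis using j by (auto simp: U_last_def U_rel_def)
  qed
qed

section \<open>Contraction of the last set\<close>

abbreviation "b' \<equiv> \<lambda>i. b i - c"

text \<open>Outside \<open>U_last\<close>, a set not inside \<open>c\<close> repeats the trace of an
  older set. Following such repetitions backwards ends in \<open>D\<close> or in
  \<open>U_last\<close>, so every trace is recorded where it first occurs.\<close>

lemma trace_mem:
  assumes "i \<in> X" "i < k" "\<not> b i \<subseteq> c"
  shows "b' i \<in> contr D c \<union> b' ` {l\<in>U_last. l \<le> i}"
  using assms
proof (induction i rule: less_induct)
  case (less i)
  show ?case
  proof (cases "i \<in> U_last")
    case False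
    then obtain e where e: "e \<in> st i" "e - c = b i - c"
      using less.prems by (auto simp: U_last_def U_rel_def)
    show ?thesis
    proof (cases "e \<in> D")
      case True
      then show ?thesis using e less.prems(3) unfolding contr_def by blast
    next
      case False
      then obtain l where l: "l \<in> X" "l < i" "e = b l" using e(1) by (auto simp: stage_def)
      have "b' l \<in> contr D c \<union> b' ` {l'\<in>U_last. l' \<le> l}"
        using less.IH[of l] l e less.prems by auto
      moreover have "b' ` {l'\<in>U_last. l' \<le> l} \<subseteq> b' ` {l'\<in>U_last. l' \<le> i}" using l(2) by auto
      moreover have "b' i = b' l" using e l by simp
      ultimately show ?thesis by auto
    qed
  qed auto
qed

lemma stage_contr_eq:
  assumes "j \<le> k"
  shows "stage (contr D c) U_last b' j = contr (st j) c"
proof (intro equalityI subsetI)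
  fix d assume "d \<in> stage (contr D c) U_last b' j"
  then show "d \<in> contr (st j) c"
    by (auto simp: stage_def contr_def U_last_def U_rel_def)
next
  fix d assume "d \<in> contr (st j) c"
  then consider "d \<in> contr D c" | i where "i \<in> X" "i < j" "\<not> b i \<subseteq> c" "d = b' i"
    by (auto simp: stage_def contr_def)
  then show "d \<in> stage (contr D c) U_last b' j"
  proof cases
    case 2
    then have "b' i \<in> contr D c \<union> b' ` {l\<in>U_last. l \<le> i}" using trace_mem assms by auto
    then show ?thesis using 2 by (auto simp: stage_def)
  qed (auto simp: stage_def)
qed

lemma flag_ord_contr: "flag_ord (S - c) (contr D c) U_last b'"
  unfolding flag_ord_def
proof (intro conjI ballI)
  have nS: "\<not> S \<subseteq> c" using c_psub by auto
  show "finite U_last" using ord by (auto simp: U_last_def flag_ord_def)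
  show "laminar (contr D c)"
    using ord unfolding flag_ord_def laminar_def contr_def by blast
  show "flag_bs (S - c) (contr D c)"
    using flag_bs_contr[OF _ nS] ord by (auto simp: flag_ord_def)
  fix j assume j: "j \<in> U_last"
  then have jX: "j \<in> X" "j < k" "\<not> b j \<subseteq> c" by (auto simp: U_last_def U_rel_def)
  have eq: "stage (contr D c) U_last b' j = contr (st j) c"
    using stage_contr_eq[of j] jX by simp
  show "b' j \<notin> stage (contr D c) U_last b' j"
    unfolding eq using j by (auto simp: U_last_def U_rel_def contr_def)
  have "insert (b' j) (stage (contr D c) U_last b' j) = contr (st (Suc j)) c"
    unfolding eq stage_Suc[OF jX(1)] using jX(3) by (auto simp: contr_def)
  then show "flag_bs (S - c) (insert (b' j) (stage (contr D c) U_last b' j))"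
    using flag_bs_contr[OF flag_bs_stage[OF ord] nS] by metis
qed

lemma contr_total: "contr (D \<union> b ` X) c = contr D c \<union> b' ` U_last"
proof (intro equalityI subsetI)
  fix d assume "d \<in> contr (D \<union> b ` X) c"
  then consider "d \<in> contr D c" | i where "i \<in> X" "\<not> b i \<subseteq> c" "d = b' i"
    by (auto simp: contr_def)
  then show "d \<in> contr D c \<union> b' ` U_last"
  proof cases
    case 2
    then have "i < k" using kmax[of i] by (cases "i = k") auto
    then show ?thesis using trace_mem[of i] 2 by auto
  qed auto
qed (auto simp: contr_def U_last_def U_rel_def)

text \<open>
  A smallest \<open>f \<in> st i\<close> that properly contains \<open>b i\<close> and agrees with it outside \<open>b j \<union> c\<close> has
  \<open>f - b i \<in> st i\<close> by \<open>splitting_complement\<close>.  This set is contained in \<open>b j\<close> or disjoint from it, so \<open>f\<close>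
  has the trace of \<open>b i\<close> outside \<open>b j\<close> or outside \<open>c\<close>.
\<close>

lemma U_rel_contr:
  assumes ij: "i \<in> U_last" "j \<in> U_last" "i < j" and nsub: "\<not> b i \<subseteq> b j \<union> c"
    and e: "e \<in> st i" "e - b j - c = b i - b j - c"
  shows "\<not> U_rel D X b i j"
proof
  assume U: "U_rel D X b i j"
  have iX: "i \<in> X" and jX: "j \<in> X" using ij by (auto simp: U_last_def)
  have ne: "b i - b j - c \<noteq> {}" using nsub by auto
  have noU: "f - c \<noteq> b i - c" "f - b j \<noteq> b i - b j" if "f \<in> st i" for f
    using that ij(1) U by (auto simp: U_last_def U_rel_def)
  \<comment> \<open>\<open>b i\<close> splits into \<open>f\<close>, which contains
    \<open>d\<close>, and \<open>g \<subseteq> c \<union> b j\<close>. If \<open>g\<close> misses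
    \<open>b j\<close>, then \<open>f\<close> has the trace of \<open>b i\<close> outside
    \<open>c\<close>; otherwise \<open>U_last_absorbs\<close> puts \<open>g\<close> inside
    \<open>b j\<close> and \<open>f\<close> has the trace of \<open>b i\<close> outside
    \<open>b j\<close>. Both are excluded by \<open>noU\<close>; hence \<open>e\<close> cannot lie
    inside \<open>b i\<close>.\<close>
  have inner: "d = {}" if d: "d \<in> st i" "d \<subseteq> b i" "b i - b j - c \<subseteq> d" for d
  proof -
    have B': "building_set S (insert (b i) (st i))" "splitting (insert (b i) (st i))"
      using ord iX by (auto simp: flag_ord_def flag_bs_def)
    obtain d1 d2 where d12: "d1 \<in> st i" "d2 \<in> st i" "d1 \<inter> d2 = {}" "d1 \<union> d2 = b i"
      and below: "\<And>d. d \<in> st i \<Longrightarrow> d \<subseteq> b i \<Longrightarrow> d \<subseteq> d1 \<or> d \<subseteq> d2"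
      using insert_split[OF bs B' not_mem[OF iX order_refl]] by metis
    have False if f: "f \<in> st i" "g \<in> st i" "f \<inter> g = {}" "f \<union> g = b i" "d \<subseteq> f" for f g
    proof -
      have g: "g \<subseteq> c \<union> b j" using f d(3) by blast
      have "g \<inter> b j \<noteq> {}"
      proof
        assume "g \<inter> b j = {}"
        then have "f - c = b i - c" using g f(4) by blast
        then show False using noU(1)[OF f(1)] by simp
      qed
      moreover have "g \<in> st j" using f(2) st_mono[of i j] ij(3) by auto
      ultimately have "g \<subseteq> b j" using U_last_absorbs[OF ij(2)] g by blast
      then have "f - b j = b i - b j" using f(4) by blast
      then show False using noU(2)[OF f(1)] by simp
    qed
    from this[of d1 d2] this[of d2 d1] show ?thesis using below[OF d(1,2)] d12 by auto
  qed
  define P where "P f \<longleftrightarrow> f \<in> st i \<and> b i \<subset> f \<and> f - b j - c = b i - b j - c" for f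
  have "e \<inter> b i \<noteq> {}" using e(2) ne by blast
  with iX e(1) have "\<exists>f. P f"
  proof (cases rule: un_cases)
    case 1
    then have "e = {}" using inner[OF e(1)] e(2) by blast
    then show ?thesis using e(2) ne by auto
  next
    case 2
    have "e \<union> b i \<noteq> b i" using 2 not_mem[OF iX order_refl] by auto
    then have "P (e \<union> b i)" using 2 e(2) unfolding P_def by blast
    then show ?thesis by blast
  qed
  then obtain f where "P f" and min: "\<And>g. P g \<Longrightarrow> card f \<le> card g"
    using ex_has_least_nat[of P _ card] by blast
  then have f: "f \<in> st i" "b i \<subset> f" "f - b j - c = b i - b j - c" by (auto simp: P_def)
  have "f - b i \<in> st (Suc i)"
  proof (rule splitting_complement[OF bs sp])
    show "f \<in> st (Suc i)" "b i \<in> st (Suc i)" using f(1) iX by (auto simp: stage_Suc)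
    fix K assume K: "K \<in> st (Suc i)" "b i \<subset> K" "K \<subset> f"
    then have "P K" using f(3) iX unfolding P_def by (auto simp: stage_Suc)
    then show False using min[of K] psubset_card_mono[OF _ K(3)] by simp
  qed (use f in auto)
  then have mem: "f - b i \<in> st i" using iX f b_ne[OF iX] by (auto simp: stage_Suc)
  have sub: "f - b i \<subseteq> c \<union> b j" using f(3) by blast
  show False
  proof (cases "(f - b i) \<inter> b j = {}")
    case True
    then have "f - c = b i - c" using f(2) sub by blast
    then show False using noU(1)[OF f(1)] by simp
  next
    case False
    moreover have "f - b i \<in> st j" using mem st_mono[of i j] ij(3) by auto
    ultimately have "f - b i \<subseteq> b j" using U_last_absorbs[OF ij(2)] sub by blast
    then have "f - b j = b i - b j" using f(2) by blast
    then show False using noU(2)[OF f(1)] by simp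
  qed
qed

text \<open>For \<open>i < j\<close>: if \<open>b i\<close> is not inside
  \<open>b j \<union> c\<close>, only the \<open>U\<close> relations can hold, and
  \<open>U_rel_contr\<close> makes them agree. Otherwise \<open>U_last_absorbs\<close> yields
  \<open>b i \<subseteq> b j\<close>, only the \<open>V\<close> relations can hold, and a witness
  \<open>e\<close> for the traces is turned into the witness \<open>e \<union> b i\<close>.\<close>

lemma Gamma_adj_contr:
  assumes ij: "i \<in> U_last" "j \<in> U_last"
  shows "Gamma_adj (contr D c) U_last b' i j = Gamma_adj D X b i j"
proof -
  have "(U_rel (contr D c) U_last b' i j \<or> V_rel (contr D c) U_last b' i j) =
      (U_rel D X b i j \<or> V_rel D X b i j)"
    if ij: "i \<in> U_last" "j \<in> U_last" "i < j" for i j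
  proof -
    have X: "i \<in> X" "j \<in> X" "i < k" "j < k" "\<not> b i \<subseteq> c" "\<not> b j \<subseteq> c"
      using ij by (auto simp: U_last_def U_rel_def)
    have st: "stage (contr D c) U_last b' i = contr (st i) c"
      using stage_contr_eq[of i] X by simp
    have stij: "st i \<subseteq> st j" using st_mono[of i j] ij(3) by auto
    have noi: "f - c \<noteq> b i - c" if "f \<in> st i" for f
      using that ij(1) by (auto simp: U_last_def U_rel_def)
    have noj: "f - c \<noteq> b j - c" if "f \<in> st j" for f
      using that ij(2) by (auto simp: U_last_def U_rel_def)
    show ?thesis
    proof (cases "b i \<subseteq> b j \<union> c")
      case False
      then have nsub: "\<not> b i \<subseteq> b j" "\<not> b' i \<subseteq> b' j" by auto
      have "(\<exists>e\<in>contr (st i) c. e - b' j = b' i - b' j) \<longleftrightarrow> (\<exists>e\<in>st i. e - b j - c = b i - b j - c)"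
      proof
        assume "\<exists>e\<in>contr (st i) c. e - b' j = b' i - b' j"
        then obtain e where "e \<in> st i" "(e - c) - b' j = b' i - b' j" by (auto simp: contr_def)
        moreover then have "e - b j - c = b i - b j - c" by blast
        ultimately show "\<exists>e\<in>st i. e - b j - c = b i - b j - c" by blast
      next
        assume "\<exists>e\<in>st i. e - b j - c = b i - b j - c"
        then obtain e where e: "e \<in> st i" "e - b j - c = b i - b j - c" by blast
        then have "\<not> e \<subseteq> c" "(e - c) - b' j = b' i - b' j" using False by blast+
        then show "\<exists>e\<in>contr (st i) c. e - b' j = b' i - b' j" using e(1) unfolding contr_def by blast
      qed
      also have "\<dots> \<longleftrightarrow> (\<exists>e\<in>st i. e - b j = b i - b j)"
      proof
        assume "\<exists>e\<in>st i. e - b j - c = b i - b j - c"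
        then have "\<not> U_rel D X b i j" using U_rel_contr[OF ij False] by blast
        then show "\<exists>e\<in>st i. e - b j = b i - b j" using nsub by (auto simp: U_rel_def)
      next
        assume "\<exists>e\<in>st i. e - b j = b i - b j"
        then show "\<exists>e\<in>st i. e - b j - c = b i - b j - c" by metis
      qed
      finally have "U_rel (contr D c) U_last b' i j = U_rel D X b i j"
        using nsub by (simp add: U_rel_def st)
      moreover have "\<not> V_rel (contr D c) U_last b' i j" "\<not> V_rel D X b i j"
        using nsub unfolding V_rel_def by blast+
      ultimately show ?thesis by blast
    next
      case True
      have bi: "b i \<in> st j" using mem_st X ij(3) by blast
      have "b i \<inter> b j \<noteq> {}" using True X(5) by blast
      then have sub: "b i \<subseteq> b j" using U_last_absorbs[OF ij(2) bi] True by blast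
      then have sub': "b' i \<subseteq> b' j" by blast
      have "(\<exists>e\<in>contr (st i) c. b' i \<subset> e \<and> e \<subset> b' j) \<longleftrightarrow> (\<exists>e\<in>st i. b i \<subset> e \<and> e \<subset> b j)"
      proof
        assume "\<exists>e\<in>contr (st i) c. b' i \<subset> e \<and> e \<subset> b' j"
        then obtain e where e: "e \<in> st i" "b i - c \<subset> e - c" "e - c \<subset> b j - c"
          by (auto simp: contr_def)
        have "e \<inter> b i \<noteq> {}" using e(2) X(5) by blast
        with X(1) e(1) have un: "e \<union> b i \<in> st i"
          by (cases rule: un_cases) (use e(2) in blast)+
        have un': "e \<union> b i \<in> st j" using un stij by blast
        have "(e \<union> b i) \<inter> b j \<noteq> {}" "e \<union> b i \<subseteq> c \<union> b j"
          using e sub b_ne[OF X(1)] by blast+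
        then have "e \<union> b i \<subseteq> b j" using U_last_absorbs[OF ij(2) un'] by blast
        moreover have "e \<union> b i \<noteq> b j" using e sub by blast
        moreover have "b i \<noteq> e \<union> b i" using e by blast
        ultimately show "\<exists>e\<in>st i. b i \<subset> e \<and> e \<subset> b j" using un by blast
      next
        assume "\<exists>e\<in>st i. b i \<subset> e \<and> e \<subset> b j"
        then obtain e where e: "e \<in> st i" "b i \<subset> e" "e \<subset> b j" by blast
        \<comment> \<open>Strict inclusions stay strict for traces because neither
          \<open>b i\<close> nor \<open>b j\<close> repeats the trace of an older set.\<close>
        have "e - c \<noteq> b i - c" "e - c \<noteq> b j - c" using noi e(1) noj stij by blast+
        then have "b' i \<subset> e - c" "e - c \<subset> b' j" using e by blast+
        moreover have "\<not> e \<subseteq> c" using e X(5) by blast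
        ultimately show "\<exists>e\<in>contr (st i) c. b' i \<subset> e \<and> e \<subset> b' j"
          using e(1) unfolding contr_def by blast
      qed
      then show ?thesis using sub sub' by (simp add: U_rel_def V_rel_def st)
    qed
  qed
  then show ?thesis using ij unfolding Gamma_adj_def by blast
qed

text \<open>If \<open>i < j\<close> and \<open>b i\<close> meets \<open>b j\<close>, the set between
  \<open>b i\<close> and \<open>c\<close> is absorbed by \<open>b j\<close> and is a witness for
  \<open>V\<close>. If they are disjoint, an older set agreeing with \<open>b i\<close> outside
  \<open>b j\<close> would be absorbed by \<open>b j\<close> or equal \<open>b i\<close>, so
  \<open>U\<close> holds. If \<open>j < i\<close>, agreement outside \<open>b i\<close> implies
  agreement outside the larger set \<open>c\<close>, which \<open>j \<in> U_last\<close> rules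
  out.\<close>

lemma Gamma_adj_across:
  assumes i: "i \<in> V_last" and j: "j \<in> U_last"
  shows "Gamma_adj D X b i j"
proof -
  have X: "i \<in> X" "j \<in> X" "b i \<subseteq> c" "\<not> b j \<subseteq> c"
    using i j by (auto simp: V_last_def V_rel_def U_last_def U_rel_def)
  obtain e where e: "e \<in> st i" "b i \<subset> e" "e \<subset> c"
    using i by (auto simp: V_last_def V_rel_def)
  have "i \<noteq> j" using X by auto
  then consider "i < j" | "j < i" by linarith
  then show ?thesis
  proof cases
    case 1
    have st: "st i \<subseteq> st j" using st_mono[of i j] 1 by auto
    show ?thesis
    proof (cases "b i \<inter> b j = {}")
      case True
      have "U_rel D X b i j"
        unfolding U_rel_def
      proof (intro conjI notI)
        assume "b i \<subseteq> b j"
        then show False using True b_ne X(1) by blast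
      next
        assume "\<exists>f\<in>st i. f - b j = b i - b j"
        then obtain f where f: "f \<in> st i" "f - b j = b i - b j" by blast
        show False
        proof (cases "f \<inter> b j = {}")
          case t: True
          then have "f = b i" using f(2) True by blast
          then show False using f(1) not_mem X(1) by blast
        next
          case False
          have "f \<subseteq> c \<union> b j" using f(2) X(3) by blast
          then have "f \<subseteq> b j" using U_last_absorbs[OF j] f(1) st False by blast
          then show False using f(2) True b_ne X(1) by blast
        qed
      qed
      then show ?thesis using 1 by (simp add: Gamma_adj_def)
    next
      case False
      have "e \<subseteq> b j" using U_last_absorbs[OF j, of e] e st False by blast
      moreover have "e \<noteq> b j" using e X(4) by blast
      ultimately have "V_rel D X b i j" using e unfolding V_rel_def by blast
      then show ?thesis using 1 by (simp add: Gamma_adj_def)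
    qed
  next
    case 2
    have "U_rel D X b j i"
      unfolding U_rel_def
    proof (intro conjI notI)
      assume "b j \<subseteq> b i"
      then show False using X by blast
    next
      assume "\<exists>f\<in>st j. f - b i = b j - b i"
      then obtain f where f: "f \<in> st j" "f - b i = b j - b i" by blast
      then have "f - c = b j - c" using X(3) by blast
      then show False using f(1) j by (auto simp: U_last_def U_rel_def)
    qed
    then show ?thesis using 2 by (simp add: Gamma_adj_def)
  qed
qed

section \<open>The recursion for both sides\<close>

lemma stage_diff:
  assumes "j \<le> k"
  shows "stage D (X - {k}) b j = st j"
proof -
  have "{i\<in>X - {k}. i < j} = {i\<in>X. i < j}" using assms by auto
  then show ?thesis by (simp only: stage_def)
qed

lemma clique_sum_Gamma:
  "clique_sum x X (Gamma_adj D X b) = clique_sum x (X - {k}) (Gamma_adj D (X - {k}) b) +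
    x * (clique_sum x V_last (Gamma_adj E V_last b) * clique_sum x U_last (Gamma_adj (contr D c) U_last b'))"
proof -
  let ?R = "Gamma_adj D X b"
  have fin: "finite X" using ord by (simp add: flag_ord_def)
  have "clique_sum x (insert k (X - {k})) ?R =
      clique_sum x (X - {k}) ?R + x * clique_sum x {i\<in>X - {k}. ?R k i} ?R"
    using fin by (intro clique_sum_insert) (auto intro: Gamma_adj_sym)
  also have "insert k (X - {k}) = X" using kX by auto
  also have "{i\<in>X - {k}. ?R k i} = V_last \<union> U_last"
    using kmax by (fastforce simp: Gamma_adj_def V_last_def U_last_def)
  also have "clique_sum x (V_last \<union> U_last) ?R = clique_sum x V_last ?R * clique_sum x U_last ?R"
  proof (rule clique_sum_join)
    show "finite V_last" "finite U_last" using fin by (auto simp: V_last_def U_last_def)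
    show "V_last \<inter> U_last = {}" by (auto simp: V_last_def U_last_def U_rel_def V_rel_def)
  qed (auto intro: Gamma_adj_sym Gamma_adj_across)
  also have "clique_sum x V_last ?R = clique_sum x V_last (Gamma_adj E V_last b)"
    by (rule clique_sum_cong) (simp add: Gamma_adj_restr)
  also have "clique_sum x U_last ?R = clique_sum x U_last (Gamma_adj (contr D c) U_last b')"
    by (rule clique_sum_cong) (simp add: Gamma_adj_contr)
  also have "clique_sum x (X - {k}) ?R = clique_sum x (X - {k}) (Gamma_adj D (X - {k}) b)"
  proof (rule clique_sum_cong)
    fix i j assume "i \<in> X - {k}" "j \<in> X - {k}"
    then have "i \<le> k" "j \<le> k" using kmax by auto
    then have "stage D X b i = stage D (X - {k}) b i" "stage D X b j = stage D (X - {k}) b j"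
      by (simp_all add: stage_diff)
    then show "?R i j = Gamma_adj D (X - {k}) b i j"
      by (simp add: Gamma_adj_def U_rel_def V_rel_def)
  qed
  finally show ?thesis .
qed

lemma flag_ord_init: "flag_ord S D (X - {k}) b"
  unfolding flag_ord_def
proof (intro conjI ballI)
  show "finite (X - {k})" "laminar D" "flag_bs S D" using ord by (auto simp: flag_ord_def)
  fix j assume "j \<in> X - {k}"
  then have j: "j \<in> X" "j \<le> k" using kmax by auto
  show "b j \<notin> stage D (X - {k}) b j" "flag_bs S (insert (b j) (stage D (X - {k}) b j))"
    unfolding stage_diff[OF j(2)] using ord j(1) by (auto simp: flag_ord_def)
qed

lemma nested_sum_last:
  "(1 + 2 * s) * nested_sum s S (D \<union> b ` X) = (1 + 2 * s) * nested_sum s S (D \<union> b ` (X - {k})) +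
    (s + s\<^sup>2) * (nested_sum s c (E \<union> b ` V_last) * nested_sum s (S - c) (contr D c \<union> b' ` U_last))"
proof -
  have "{i\<in>X. i < k} = X - {k}" using kmax by (auto intro: le_neq_implies_less)
  then have st: "st k = D \<union> b ` (X - {k})" by (simp only: stage_def)
  have ins: "insert c (st k) = D \<union> b ` X" using kX st by auto
  have "flag_bs S (insert c (st k))" using ord kX by (simp add: flag_ord_def)
  from nested_sum_insert[OF flag_bs_stage[OF ord] this not_mem[OF kX order_refl], of s]
  show ?thesis unfolding ins unfolding st restr_total contr_total .
qed

end

theorem nested_sum_eq_clique_sum:
  fixes S :: "'n::finite set"
  assumes "flag_ord S D X b" and s: "s > 0"
  shows "nested_sum s S (D \<union> b ` X) =
    (1 + 2 * s) ^ (card S - 1) * clique_sum ((s + s\<^sup>2) / (1 + 2 * s)\<^sup>2) X (Gamma_adj D X b)"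
  using assms(1)
proof (induction "card X" arbitrary: S D X b rule: less_induct)
  case less
  let ?w = "1 + 2 * s" and ?x = "(s + s\<^sup>2) / (1 + 2 * s)\<^sup>2"
  have fin: "finite X" using less.prems by (simp add: flag_ord_def)
  show ?case
  proof (cases "X = {}")
    case True
    then show ?thesis using nested_sum_laminar[of S D s] less.prems by (simp add: flag_ord_def)
  next
    case False
    define k where "k = Max X"
    have k: "k \<in> X" "\<And>i. i \<in> X \<Longrightarrow> i \<le> k" using fin False by (auto simp: k_def)
    interpret flag_ord_last S D X b k
      by unfold_locales (fact less.prems, fact k(1), fact k(2))
    have "X - {k} \<subset> X" "V_last \<subset> X" "U_last \<subset> X"
      using k(1) by (auto simp: V_last_def U_last_def)
    then have cards: "card (X - {k}) < card X" "card V_last < card X" "card U_last < card X"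
      using psubset_card_mono[OF fin] by blast+
    let ?G = "clique_sum ?x (X - {k}) (Gamma_adj D (X - {k}) b)"
      and ?G1 = "clique_sum ?x V_last (Gamma_adj E V_last b)"
      and ?G2 = "clique_sum ?x U_last (Gamma_adj (contr D c) U_last b')"
    note IH = less.hyps[OF cards(1) flag_ord_init] less.hyps[OF cards(2) flag_ord_restr]
      less.hyps[OF cards(3) flag_ord_contr]
    have w: "?w > 0" using s by simp
    have "card c > 0" "card (S - c) > 0" "card S = card c + card (S - c)"
      using b_ne[OF k(1)] c_psub card_Un_disjoint[of c "S - c"]
      by (auto simp: card_gt_0_iff Un_absorb1)
    then obtain p q where pq: "card c = Suc p" "card (S - c) = Suc q" "card S = Suc p + Suc q"
      by (metis gr0_implies_Suc)
    have x: "s + s\<^sup>2 = ?x * ?w\<^sup>2" using w by simp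
    \<comment> \<open>The factors for \<open>c\<close> and \<open>S - c\<close> contribute
      \<open>?w ^ (p + q)\<close>; with the \<open>?w\<^sup>2\<close> that accompanies
      \<open>?x\<close> this is \<open>?w * ?w ^ (card S - 1)\<close>, as
      \<open>card S = p + q + 2\<close>.\<close>
    have "?w * nested_sum s S (D \<union> b ` X) =
        ?w * (?w ^ (card S - 1) * ?G) + (?x * ?w\<^sup>2) * ((?w ^ p * ?G1) * (?w ^ q * ?G2))"
      using nested_sum_last[of s] IH pq x by simp
    also have "\<dots> = ?w * (?w ^ (card S - 1) * (?G + ?x * (?G1 * ?G2)))"
      using pq(3) by (simp only: power2_eq_square diff_Suc_1 add_Suc power_Suc power_add add_Suc_right algebra_simps)
    also have "\<dots> = ?w * (?w ^ (card S - 1) * clique_sum ?x X (Gamma_adj D X b))"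
      by (simp only: clique_sum_Gamma)
    finally show ?thesis using w by simp
  qed
qed

section \<open>The boundary complex of the polar dual\<close>

text \<open>
  A polytope \<open>P\<close> given by irredundant inequalities \<open>a i \<bullet> (z - x) \<le> 1\<close> in its affine hull, where \<open>x\<close>
  satisfies all of them strictly.
\<close>

locale inequality_polytope =
  fixes x :: "'a::euclidean_space" and A :: "'i set" and a :: "'i \<Rightarrow> 'a" and P :: "'a set" and E :: "'a set"
  assumes E: "E = span ((\<lambda>z. z - x) ` P)"
    and finA: "finite A"
    and aE: "\<And>i. i \<in> A \<Longrightarrow> a i \<in> E"
    and P: "P = {z. z - x \<in> E \<and> (\<forall>i\<in>A. a i \<bullet> (z - x) \<le> 1)}"
    and bounded_P: "bounded P"
    and single: "\<And>i. i \<in> A \<Longrightarrow> \<exists>z\<in>P. {j\<in>A. a j \<bullet> (z - x) = 1} = {i}"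
begin

definition tight :: "'a \<Rightarrow> 'i set" where
  "tight z = {i\<in>A. a i \<bullet> (z - x) = 1}"

abbreviation "Q \<equiv> polar_dual_at x P"

lemma Q_def: "Q = {y\<in>E. \<forall>z\<in>P. y \<bullet> (z - x) \<le> 1}"
  by (simp add: polar_dual_at_def E)

lemma mem_P: "z \<in> P \<longleftrightarrow> z - x \<in> E \<and> (\<forall>i\<in>A. a i \<bullet> (z - x) \<le> 1)"
  by (subst P) simp

lemma sub_E: "subspace E"
  by (simp add: E)

lemma project_E:
  obtains u where "u \<in> E" "\<And>y. y \<in> E \<Longrightarrow> v \<bullet> y = u \<bullet> y"
proof -
  obtain u w where "u \<in> span E" "\<And>y. y \<in> span E \<Longrightarrow> orthogonal w y" "v = u + w"
    using orthogonal_subspace_decomp_exists[of E v] by metis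
  then have "u \<in> E" "\<And>y. y \<in> E \<Longrightarrow> w \<bullet> y = 0" "v = u + w"
    using sub_E by (auto simp: span_eq_iff[THEN iffD2] orthogonal_def)
  then show ?thesis using that by (simp add: inner_add_left)
qed

text \<open>Separating \<open>y\<close> from the hull gives a functional whose component in
  \<open>E\<close>, divided by \<open>\<beta>\<close>, is \<open>z - x\<close> for a point
  \<open>z\<close> of \<open>P\<close> with \<open>y \<bullet> (z - x) > 1\<close>. The point
  \<open>0\<close> makes \<open>\<beta>\<close> negative and covers the case of empty
  \<open>A\<close>; no face cut out by \<open>(z - x) \<bullet> y = 1\<close> contains it.\<close>

lemma Q_hull: "Q = convex hull (insert 0 (a ` A))" (is "_ = ?H")
proof
  show "?H \<subseteq> Q"
  proof (rule hull_minimal)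
    show "convex Q"
      unfolding Q_def by (auto simp: convex_def inner_add_left subspace_add subspace_scale sub_E
          intro!: convex_bound_le)
    show "insert 0 (a ` A) \<subseteq> Q"
      using aE mem_P by (auto simp: Q_def subspace_0[OF sub_E])
  qed
  show "Q \<subseteq> ?H"
  proof
    fix y assume y: "y \<in> Q"
    show "y \<in> ?H"
    proof (rule ccontr)
      assume "y \<notin> ?H"
      moreover have "closed ?H" using finA by (simp add: finite_imp_compact_convex_hull compact_imp_closed)
      ultimately obtain v \<beta> where v: "v \<bullet> y < \<beta>" "\<And>h. h \<in> ?H \<Longrightarrow> v \<bullet> h > \<beta>"
        using separating_hyperplane_closed_point[of ?H y] by auto
      obtain u where u: "u \<in> E" "\<And>y. y \<in> E \<Longrightarrow> v \<bullet> y = u \<bullet> y" using project_E[of v] by metis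
      have b: "\<beta> < 0" using v(2)[of 0] by (simp add: hull_inc)
      define z where "z = x + (1 / \<beta>) *\<^sub>R u"
      have "a i \<bullet> (z - x) \<le> 1" if "i \<in> A" for i
      proof -
        have "u \<bullet> a i > \<beta>" using v(2)[of "a i"] u(2)[OF aE[OF that]] that by (simp add: hull_inc)
        then show ?thesis using b by (simp add: z_def inner_commute divide_simps)
      qed
      then have "z \<in> P" using u(1) by (simp add: mem_P z_def subspace_scale[OF sub_E])
      then have "y \<bullet> (z - x) \<le> 1" "y \<in> E" using y by (auto simp: Q_def)
      then have "u \<bullet> y \<ge> \<beta>" using b by (simp add: z_def inner_commute divide_simps)
      then show False using v(1) u(2) \<open>y \<in> E\<close> by simp
    qed
  qed
qed

lemma convex_Q: "convex Q" and compact_Q: "compact Q" and polytope_Q: "polytope Q"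
  using finA unfolding Q_hull by (simp_all add: finite_imp_compact_convex_hull polytope_convex_hull)

lemma zero_Q: "0 \<in> Q"
  unfolding Q_hull by (simp add: hull_inc)

lemma exposed: "z \<in> P \<Longrightarrow> (Q \<inter> {y. (z - x) \<bullet> y = 1}) face_of Q"
  using convex_Q by (rule face_of_Int_supporting_hyperplane_le) (auto simp: Q_def inner_commute)

lemma extreme_sub: "z \<in> P \<Longrightarrow> {v. v extreme_point_of (Q \<inter> {y. (z - x) \<bullet> y = 1})} \<subseteq> a ` tight z"
proof
  fix v assume z: "z \<in> P" and "v \<in> {v. v extreme_point_of (Q \<inter> {y. (z - x) \<bullet> y = 1})}"
  then have v: "v extreme_point_of Q" "(z - x) \<bullet> v = 1"
    using extreme_point_of_face[OF exposed[OF z]] by auto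
  then have "v \<in> insert 0 (a ` A)" unfolding Q_hull by (intro extreme_point_of_convex_hull)
  then show "v \<in> a ` tight z" using v(2) by (auto simp: tight_def inner_commute)
qed

text \<open>At a point where only \<open>i\<close> is tight, the exposed face is compact, convex and
  nonempty, so it has an extreme point, for which \<open>a i\<close> is the only candidate.\<close>

lemma vertex:
  assumes i: "i \<in> A"
  shows "a i extreme_point_of Q"
proof -
  obtain z where z: "z \<in> P" "tight z = {i}" using single[OF i] by (auto simp: tight_def)
  let ?F = "Q \<inter> {y. (z - x) \<bullet> y = 1}"
  have "a i \<in> Q" using i unfolding Q_hull by (simp add: hull_inc)
  moreover have "i \<in> tight z" using z by simp
  ultimately have "?F \<noteq> {}" by (auto simp: tight_def inner_commute)
  moreover have "compact ?F" "convex ?F"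
    using compact_Q convex_Q by (auto intro!: compact_Int_closed convex_Int closed_hyperplane convex_hyperplane)
  ultimately obtain v where v: "v extreme_point_of ?F" using extreme_point_exists_convex by blast
  then have "v \<in> a ` tight z" using extreme_sub[OF z(1)] by auto
  then have "v = a i" using z(2) by auto
  then show ?thesis using v extreme_point_of_face[OF exposed[OF z(1)]] by auto
qed

lemma extreme_exposed:
  assumes "z \<in> P"
  shows "{v. v extreme_point_of (Q \<inter> {y. (z - x) \<bullet> y = 1})} = a ` tight z"
proof
  have "a i \<in> Q" if "i \<in> A" for i using that unfolding Q_hull by (simp add: hull_inc)
  then show "a ` tight z \<subseteq> {v. v extreme_point_of (Q \<inter> {y. (z - x) \<bullet> y = 1})}"
    using extreme_point_of_face[OF exposed[OF assms]] vertex by (auto simp: tight_def inner_commute)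
qed (rule extreme_sub[OF assms])

lemma inj_a: "inj_on a A"
proof (rule inj_onI)
  fix i j assume ij: "i \<in> A" "j \<in> A" "a i = a j"
  obtain z where z: "tight z = {i}" using single[OF ij(1)] by (auto simp: tight_def)
  have "j \<in> tight z \<longleftrightarrow> i \<in> tight z" unfolding tight_def mem_Collect_eq by (simp only: ij)
  then show "i = j" by (simp add: z)
qed

lemma zero_interior:
  obtains e where "e > 0" "\<And>y. y \<in> E \<Longrightarrow> norm y \<le> e \<Longrightarrow> y \<in> Q"
proof -
  obtain M where M: "\<And>z. z \<in> P \<Longrightarrow> norm z \<le> M" "M > 0" using bounded_P bounded_pos by metis
  let ?e = "1 / (M + norm x)"
  have pos: "M + norm x > 0" using M(2) by (simp add: add_pos_nonneg)
  have "y \<in> Q" if y: "y \<in> E" "norm y \<le> ?e" for y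
  proof -
    have "y \<bullet> (z - x) \<le> 1" if z: "z \<in> P" for z
    proof -
      have "norm (z - x) \<le> M + norm x" using M(1)[OF z] norm_triangle_ineq4[of z x] by linarith
      then have "norm y * norm (z - x) \<le> ?e * (M + norm x)" using y pos by (intro mult_mono) auto
      also have "\<dots> = 1" using pos by simp
      finally show ?thesis using norm_cauchy_schwarz[of y "z - x"] by linarith
    qed
    then show ?thesis using y by (simp add: Q_def)
  qed
  moreover have "?e > 0" using pos by simp
  ultimately show ?thesis using that by blast
qed

text \<open>A supporting hyperplane of a nonempty proper face does not pass through
  \<open>0\<close>, which is interior relative to \<open>E\<close> since \<open>P\<close> is
  bounded. So its level is positive and can be scaled to 1; the normal vector is then
  \<open>z - x\<close> with \<open>z \<in> P\<close>. The empty face belongs to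
  \<open>z = x\<close>.\<close>

lemma proper_face:
  assumes F: "F face_of Q" "F \<noteq> Q"
  obtains z where "z \<in> P" "F = Q \<inter> {y. (z - x) \<bullet> y = 1}"
proof (cases "F = {}")
  case True
  have "x \<in> P" by (simp add: mem_P subspace_0[OF sub_E])
  moreover have "Q \<inter> {y. (x - x) \<bullet> y = 1} = {}" by auto
  ultimately show ?thesis using True that by metis
next
  case False
  have "F exposed_face_of Q"
    using exposed_face_of_polyhedron[OF polytope_imp_polyhedron[OF polytope_Q]] F by blast
  then obtain v \<beta> where v: "Q \<subseteq> {y. v \<bullet> y \<le> \<beta>}" "F = Q \<inter> {y. v \<bullet> y = \<beta>}"
    unfolding exposed_face_of_def by auto
  obtain u where u: "u \<in> E" "\<And>y. y \<in> E \<Longrightarrow> v \<bullet> y = u \<bullet> y" using project_E[of v] by metis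
  have QE: "Q \<subseteq> E" by (auto simp: Q_def)
  have b0: "\<beta> \<ge> 0" using v(1) zero_Q by force
  have "\<beta> \<noteq> 0"
  proof
    assume b: "\<beta> = 0"
    obtain e where e: "e > 0" "\<And>y. y \<in> E \<Longrightarrow> norm y \<le> e \<Longrightarrow> y \<in> Q" using zero_interior by metis
    have "u = 0"
    proof (rule ccontr)
      assume "u \<noteq> 0"
      then have "(e / norm u) *\<^sub>R u \<in> Q" using e u by (intro e(2)) (auto simp: subspace_scale[OF sub_E])
      then have "v \<bullet> ((e / norm u) *\<^sub>R u) \<le> 0" using v(1) b by blast
      then have "(e / norm u) * (u \<bullet> u) \<le> 0" using u by simp
      moreover have "(e / norm u) * (u \<bullet> u) > 0" using e(1) \<open>u \<noteq> 0\<close> by simp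
      ultimately show False by simp
    qed
    then have "F = Q" unfolding v(2) using u(2) QE b by auto
    then show False using F by simp
  qed
  then have b: "\<beta> > 0" using b0 by simp
  define z where "z = x + (1 / \<beta>) *\<^sub>R u"
  have "a i \<bullet> (z - x) \<le> 1" if "i \<in> A" for i
  proof -
    have "a i \<in> Q" using that unfolding Q_hull by (simp add: hull_inc)
    then have "u \<bullet> a i \<le> \<beta>" using v(1) u(2)[OF aE[OF that]] by auto
    then show ?thesis using b by (simp add: z_def inner_commute divide_simps)
  qed
  then have "z \<in> P" using u(1) by (simp add: mem_P z_def subspace_scale[OF sub_E])
  moreover have "F = Q \<inter> {y. (z - x) \<bullet> y = 1}"
    unfolding v(2) z_def using b u(2) QE by (auto simp: divide_simps)
  ultimately show ?thesis using that by blast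
qed

lemma boundary_complex_Q: "boundary_complex Q = (\<lambda>z. a ` tight z) ` P"
proof (intro equalityI subsetI)
  fix N assume "N \<in> boundary_complex Q"
  then obtain F where F: "F face_of Q" "F \<noteq> Q" "N = {v. v extreme_point_of F}"
    by (auto simp: boundary_complex_def)
  obtain z where "z \<in> P" "F = Q \<inter> {y. (z - x) \<bullet> y = 1}" using proper_face[OF F(1,2)] .
  then show "N \<in> (\<lambda>z. a ` tight z) ` P" using extreme_exposed F(3) by auto
next
  fix N assume "N \<in> (\<lambda>z. a ` tight z) ` P"
  then obtain z where z: "z \<in> P" "N = a ` tight z" by blast
  let ?F = "Q \<inter> {y. (z - x) \<bullet> y = 1}"
  have "0 \<notin> ?F" by simp
  then have "?F \<noteq> Q" using zero_Q by metis
  then show "N \<in> boundary_complex Q"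
    unfolding boundary_complex_def z(2) extreme_exposed[OF z(1), symmetric]
    using exposed[OF z(1)] by blast
qed

lemma sum_boundary_complex:
  "(\<Sum>\<sigma>\<in>boundary_complex Q. g (card \<sigma>)) = (\<Sum>N\<in>tight ` P. g (card N))"
proof -
  have sub: "tight z \<subseteq> A" for z by (auto simp: tight_def)
  have eq: "boundary_complex Q = (`) a ` (tight ` P)" by (simp add: boundary_complex_Q image_image)
  have inj: "inj_on ((`) a) (tight ` P)"
    by (rule inj_on_subset[OF inj_on_image_Pow[OF inj_a]]) (use sub in auto)
  have "card (a ` tight z) = card (tight z)" for z
    by (intro card_image inj_on_subset[OF inj_a] sub)
  then show ?thesis unfolding eq sum.reindex[OF inj] comp_def by (intro sum.cong) auto
qed

end

section \<open>Nestohedra\<close>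

definition vsum :: "real ^ 'n \<Rightarrow> 'n set \<Rightarrow> real" where
  "vsum z I = (\<Sum>i\<in>I. z $ i)"

text \<open>The minimum over the nestohedron of the coordinate sum over \<open>G\<close>: the
  summand for \<open>K\<close> contributes 1 if \<open>K \<subseteq> G\<close> and 0
  otherwise.\<close>

definition count_in :: "'n set set \<Rightarrow> 'n set \<Rightarrow> real" where
  "count_in B G = real (card {K\<in>B. K \<subseteq> G})"

lemma vsum_add: "vsum (y + z) I = vsum y I + vsum z I"
  and vsum_diff: "vsum (y - z) I = vsum y I - vsum z I"
  and vsum_scale: "vsum (c *\<^sub>R z) I = c * vsum z I"
  by (simp_all add: vsum_def sum.distrib sum_subtractf sum_distrib_left)

lemma vsum_sum: "vsum (\<Sum>k\<in>A. y k) I = (\<Sum>k\<in>A. vsum (y k) I)"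
  unfolding vsum_def sum_component by (rule sum.swap)

lemma vsum_Un_Int:
  fixes z :: "real ^ 'n::finite"
  shows "vsum z (G \<union> H) + vsum z (G \<inter> H) = vsum z G + vsum z H"
  unfolding vsum_def by (rule sum.union_inter) auto

lemma mem_coord_simplex:
  fixes y :: "real ^ 'n::finite"
  shows "y \<in> coord_simplex I \<longleftrightarrow> (\<forall>i. y $ i \<ge> 0) \<and> (\<forall>i. i \<notin> I \<longrightarrow> y $ i = 0) \<and> vsum y I = 1"
    (is "_ \<longleftrightarrow> ?R y")
proof
  assume y: "y \<in> coord_simplex I"
  have "coord_simplex I \<subseteq> {y. ?R y}"
    unfolding coord_simplex_def
  proof (rule hull_minimal)
    show "(\<lambda>i. axis i 1) ` I \<subseteq> {y. ?R y}"
      by (auto simp: vsum_def axis_def)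
    show "convex {y. ?R y}"
      by (auto simp: convex_def vsum_add vsum_scale)
  qed
  with y show "?R y" by blast
next
  assume R: "?R y"
  have "(\<Sum>i\<in>I. (y $ i) *\<^sub>R (axis i 1 :: real ^ 'n)) \<in> coord_simplex I"
    unfolding coord_simplex_def
    using R by (intro convex_sum) (auto simp: vsum_def intro: hull_inc)
  moreover have "(\<Sum>i\<in>I. (y $ i) *\<^sub>R (axis i 1 :: real ^ 'n)) = y"
    using R by (auto simp: vec_eq_iff axis_def if_distrib cong: if_cong)
  ultimately show "y \<in> coord_simplex I" by simp
qed

lemma coord_simplex_vsum:
  fixes y :: "real ^ 'n::finite"
  assumes "y \<in> coord_simplex I"
  shows "vsum y G \<ge> of_bool (I \<subseteq> G)"
proof -
  have y: "\<And>i. y $ i \<ge> 0" "vsum y I = 1" using assms by (auto simp: mem_coord_simplex)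
  have "vsum y G \<ge> 0" unfolding vsum_def using y(1) by (rule sum_nonneg)
  moreover have "vsum y G \<ge> vsum y I" if "I \<subseteq> G"
    unfolding vsum_def using that y(1) by (intro sum_mono2) auto
  ultimately show ?thesis using y(2) by auto
qed

section \<open>The inequalities of a nestohedron\<close>

lemma mem_nestohedron:
  "z \<in> nestohedron B \<longleftrightarrow> (\<exists>y. (\<forall>I\<in>B. y I \<in> coord_simplex I) \<and> z = (\<Sum>I\<in>B. y I))"
  unfolding nestohedron_def by (subst set_sum_alt) auto

lemma compact_nestohedron: "compact (nestohedron B)"
proof -
  have "compact (\<Sum>I\<in>C. coord_simplex I)" for C :: "'a set set"
  proof (induction C rule: infinite_finite_induct)
    case (insert I C)
    have "compact (coord_simplex I)"
      unfolding coord_simplex_def by (simp add: finite_imp_compact_convex_hull)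
    from compact_sums[OF this insert.IH]
    have "compact (coord_simplex I + (\<Sum>I\<in>C. coord_simplex I))"
      by (rule back_subst[of compact]) (auto simp: set_plus_def)
    then show ?case using insert.hyps by simp
  qed (simp_all add: set_zero)
  then show ?thesis unfolding nestohedron_def .
qed

lemma convex_nestohedron: "convex (nestohedron B)"
  unfolding nestohedron_def coord_simplex_def by (intro convex_set_sum) simp

lemma count_in_eq: "count_in B G = (\<Sum>I\<in>B. of_bool (I \<subseteq> G))" for B :: "'n::finite set set"
  by (simp add: count_in_def sum.If_cases of_bool_def Int_def)

lemma nestohedron_vsum:
  assumes "z \<in> nestohedron B"
  shows "vsum z G \<ge> count_in B G"
proof -
  obtain y where y: "\<forall>I\<in>B. y I \<in> coord_simplex I" "z = (\<Sum>I\<in>B. y I)"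
    using assms by (auto simp: mem_nestohedron)
  show ?thesis
    unfolding y(2) vsum_sum count_in_eq using y(1) by (intro sum_mono coord_simplex_vsum) blast
qed

lemma building_set_Union:
  fixes F :: "'n::finite set set"
  assumes B: "building_set S B" and I: "I \<in> B" and F: "F \<subseteq> B" "\<And>J. J \<in> F \<Longrightarrow> J \<inter> I \<noteq> {}"
  shows "I \<union> \<Union>F \<in> B"
proof -
  have "finite F" by simp
  then show ?thesis
    using F
  proof (induction F)
    case (insert J F)
    then have "I \<union> \<Union>F \<in> B" "J \<in> B" "J \<inter> (I \<union> \<Union>F) \<noteq> {}" by auto
    then have "J \<union> (I \<union> \<Union>F) \<in> B" using building_un[OF B] by blast
    moreover have "J \<union> (I \<union> \<Union>F) = I \<union> \<Union>(insert J F)" by auto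
    ultimately show ?case by simp
  qed (simp add: I)
qed

text \<open>The right-hand side is the minimum of the functional \<open>w\<close> over the
  nestohedron. A nonnegative \<open>w\<close> is a nonnegative combination of indicators of its
  superlevel sets, and the inequalities for these sets add up; the induction peels off the lowest
  positive level.\<close>

lemma count_in_layer:
  fixes B :: "'n::finite set set" and w :: "'n \<Rightarrow> real"
  assumes ne: "\<And>I. I \<in> B \<Longrightarrow> I \<noteq> {}" and z: "\<And>G. vsum z G \<ge> count_in B G" and w: "\<And>i. w i \<ge> 0"
  shows "(\<Sum>i\<in>UNIV. w i * z $ i) \<ge> (\<Sum>I\<in>B. Min (w ` I))"
  using w
proof (induction "card {i. w i > 0}" arbitrary: w rule: less_induct)
  case less
  let ?G = "{i. w i > 0}"
  show ?case
  proof (cases "?G = {}")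
    case True
    then have "w i = 0" for i using less.prems[of i] by (metis (mono_tags) empty_iff less_eq_real_def mem_Collect_eq)
    then have w0: "w = (\<lambda>i. 0)" by auto
    have "Min (w ` I) = 0" if "I \<in> B" for I
      using ne[OF that] by (simp add: w0 image_constant_conv)
    then show ?thesis by (simp add: w0)
  next
    case False
    define m where "m = Min (w ` ?G)"
    have m: "m > 0" "\<And>i. i \<in> ?G \<Longrightarrow> m \<le> w i" "m \<in> w ` ?G"
      using False by (auto simp: m_def)
    define v where "v i = (if i \<in> ?G then w i - m else 0)" for i
    have v: "v i \<ge> 0" for i using m by (auto simp: v_def)
    obtain i where "i \<in> ?G" "v i = 0" using m(3) by (auto simp: v_def)
    then have "i \<in> ?G - {i. v i > 0}" by simp
    moreover have "{i. v i > 0} \<subseteq> ?G" by (auto simp: v_def split: if_splits)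
    ultimately have "{i. v i > 0} \<subset> ?G" by blast
    then have "card {i. v i > 0} < card ?G" by (simp add: psubset_card_mono)
    then have IH: "(\<Sum>I\<in>B. Min (v ` I)) \<le> (\<Sum>i\<in>UNIV. v i * z $ i)"
      using less.hyps v by blast
    have Min: "Min (w ` I) = Min (v ` I) + m * of_bool (I \<subseteq> ?G)" if I: "I \<in> B" for I
    proof (cases "I \<subseteq> ?G")
      case True
      then have "w ` I = (\<lambda>i. v i + m) ` I" by (intro image_cong) (auto simp: v_def)
      then show ?thesis using True ne[OF I] by (simp add: Min_add_commute)
    next
      case False
      then obtain i where i: "i \<in> I" "\<not> w i > 0" by auto
      then have "w i = 0" using less.prems[of i] by simp
      then have "Min (w ` I) = 0" using i(1) less.prems by (intro Min_eqI) (auto intro: rev_image_eqI)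
      moreover have "v i = 0" using i(2) by (simp add: v_def)
      then have "Min (v ` I) = 0" using i(1) v by (intro Min_eqI) (auto intro: rev_image_eqI)
      ultimately show ?thesis using False by simp
    qed
    have "(\<Sum>I\<in>B. Min (w ` I)) = (\<Sum>I\<in>B. Min (v ` I)) + m * count_in B ?G"
      unfolding count_in_eq sum_distrib_left sum.distrib[symmetric] using Min by (intro sum.cong) auto
    also have "\<dots> \<le> (\<Sum>i\<in>UNIV. v i * z $ i) + m * vsum z ?G"
      using IH z m(1) by (intro add_mono mult_left_mono) auto
    also have "m * vsum z ?G = (\<Sum>i\<in>UNIV. if i \<in> ?G then m * z $ i else 0)"
      by (simp add: vsum_def sum_distrib_left sum.If_cases)
    also have "(\<Sum>i\<in>UNIV. v i * z $ i) + \<dots> = (\<Sum>i\<in>UNIV. w i * z $ i)"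
      unfolding sum.distrib[symmetric]
    proof (rule sum.cong)
      fix i
      show "v i * z $ i + (if i \<in> ?G then m * z $ i else 0) = w i * z $ i"
        using less.prems[of i] by (auto simp: v_def algebra_simps)
    qed simp
    finally show ?thesis .
  qed
qed

locale connected_building_set =
  fixes B :: "'n::finite set set"
  assumes bs: "building_set UNIV B" and top: "UNIV \<in> B"
begin

abbreviation "P \<equiv> nestohedron B"
abbreviation "A \<equiv> B - {UNIV}"
abbreviation "cnt \<equiv> count_in B"

text \<open>The maximal members of \<open>B\<close> inside \<open>G\<close> are disjoint, and every
  member inside \<open>G\<close> lies in one of them; so both sides are additive over these
  components, which are removed one at a time.\<close>

lemma vsum_ge_count_in:
  assumes "\<And>I. I \<in> B \<Longrightarrow> vsum z I \<ge> cnt I"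
  shows "vsum z G \<ge> cnt G"
proof (induction "card G" arbitrary: G rule: less_induct)
  case less
  show ?case
  proof (cases "G = {}")
    case True
    then have "{K\<in>B. K \<subseteq> G} = {}" using building_ne[OF bs] by auto
    then show ?thesis by (simp add: count_in_def vsum_def True)
  next
    case False
    then obtain i where i: "i \<in> G" by blast
    define C where "C = {K\<in>B. i \<in> K \<and> K \<subseteq> G}"
    have "{i} \<in> C" using i building_single[OF bs] by (simp add: C_def)
    then obtain I where I: "I \<in> C" and max: "\<And>K. K \<in> C \<Longrightarrow> I \<subseteq> K \<Longrightarrow> I = K"
      using finite_has_maximal2[of C "{i}"] by auto
    have IB: "I \<in> B" "i \<in> I" "I \<subseteq> G" using I by (auto simp: C_def)
    have "{K\<in>B. K \<subseteq> G} = {K\<in>B. K \<subseteq> I} \<union> {K\<in>B. K \<subseteq> G - I}"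
    proof (intro equalityI subsetI)
      fix K assume "K \<in> {K\<in>B. K \<subseteq> G}"
      then have K: "K \<in> B" "K \<subseteq> G" by auto
      show "K \<in> {K\<in>B. K \<subseteq> I} \<union> {K\<in>B. K \<subseteq> G - I}"
      proof (cases "K \<inter> I = {}")
        case False
        then have "K \<union> I \<in> C" using building_un[OF bs K(1) IB(1)] K(2) IB by (auto simp: C_def)
        then have "I = K \<union> I" using max by blast
        then show ?thesis using K by auto
      qed (use K in auto)
    qed (use IB in auto)
    moreover have "{K\<in>B. K \<subseteq> I} \<inter> {K\<in>B. K \<subseteq> G - I} = {}"
      using building_ne[OF bs] by auto
    ultimately have "cnt G = cnt I + cnt (G - I)"
      by (simp add: count_in_def card_Un_disjoint)
    moreover have "vsum z G = vsum z I + vsum z (G - I)"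
      using vsum_Un_Int[of z I "G - I"] IB by (simp add: Un_absorb1 vsum_def)
    moreover have "card (G - I) < card G"
      using i IB by (intro psubset_card_mono) auto
    ultimately show ?thesis using less.hyps[of "G - I"] assms[OF IB(1)] by simp
  qed
qed

lemma mem_P: "z \<in> P \<longleftrightarrow> vsum z UNIV = cnt UNIV \<and> (\<forall>I\<in>A. vsum z I \<ge> cnt I)"
proof
  assume z: "z \<in> P"
  obtain y where y: "\<forall>I\<in>B. y I \<in> coord_simplex I" "z = (\<Sum>I\<in>B. y I)"
    using z by (auto simp: mem_nestohedron)
  have "vsum (y I) UNIV = 1" if "I \<in> B" for I
  proof -
    have "y I \<in> coord_simplex I" using y(1) that by blast
    then have "vsum (y I) I = 1" "\<And>i. i \<notin> I \<Longrightarrow> y I $ i = 0" by (auto simp: mem_coord_simplex)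
    moreover have "vsum (y I) UNIV = vsum (y I) I"
      unfolding vsum_def using calculation(2) by (intro sum.mono_neutral_right) auto
    ultimately show ?thesis by simp
  qed
  then have "vsum z UNIV = cnt UNIV" by (simp add: y(2) vsum_sum count_in_eq)
  then show "vsum z UNIV = cnt UNIV \<and> (\<forall>I\<in>A. vsum z I \<ge> cnt I)"
    using nestohedron_vsum[OF z] by blast
next
  assume z: "vsum z UNIV = cnt UNIV \<and> (\<forall>I\<in>A. vsum z I \<ge> cnt I)"
  show "z \<in> P"
  proof (rule ccontr)
    assume "z \<notin> P"
    then obtain v \<beta> where v: "v \<bullet> z < \<beta>" "\<And>p. p \<in> P \<Longrightarrow> v \<bullet> p > \<beta>"
      using separating_hyperplane_closed_point[OF convex_nestohedron compact_imp_closed[OF compact_nestohedron]]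
      by metis
    \<comment> \<open>Shifting \<open>v\<close> by a constant makes it nonnegative and costs the
      same amount, \<open>c * cnt UNIV\<close>, at \<open>z\<close> and at \<open>p\<close>. The
      point \<open>p\<close> takes a vertex minimising \<open>w\<close> in each simplex, so
      \<open>count_in_layer\<close> contradicts the separation.\<close>
    define c where "c = Min (range (($) v))"
    define w where "w i = v $ i - c" for i
    have w: "w i \<ge> 0" for i by (simp add: w_def c_def)
    have "\<forall>I\<in>B. \<exists>i\<in>I. Min (w ` I) = w i"
    proof
      fix I assume "I \<in> B"
      then have "Min (w ` I) \<in> w ` I" using building_ne[OF bs] by (intro Min_in) auto
      then show "\<exists>i\<in>I. Min (w ` I) = w i" by auto
    qed
    then obtain m where m: "\<And>I. I \<in> B \<Longrightarrow> m I \<in> I" "\<And>I. I \<in> B \<Longrightarrow> Min (w ` I) = w (m I)"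
      by metis
    define p where "p = (\<Sum>I\<in>B. axis (m I) 1 :: real ^ 'n)"
    have "axis (m I) 1 \<in> coord_simplex I" if "I \<in> B" for I
      using m(1)[OF that] unfolding coord_simplex_def by (intro hull_inc) auto
    then have "p \<in> P" unfolding mem_nestohedron p_def by (intro exI[of _ "\<lambda>I. axis (m I) 1"]) auto
    have vp: "v \<bullet> p = (\<Sum>I\<in>B. v $ m I)" by (simp add: p_def inner_sum_right inner_axis)
    have "vsum z G \<ge> cnt G" for G
      by (rule vsum_ge_count_in) (use z in force)
    then have "(\<Sum>i\<in>UNIV. w i * z $ i) \<ge> (\<Sum>I\<in>B. w (m I))"
      using count_in_layer[of B z w] building_ne[OF bs] w m(2) by simp
    moreover have "(\<Sum>I\<in>B. w (m I)) = v \<bullet> p - c * cnt UNIV"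
      by (simp add: w_def sum_subtractf vp count_in_eq)
    moreover have "(\<Sum>i\<in>UNIV. w i * z $ i) = v \<bullet> z - c * vsum z UNIV"
      by (simp add: w_def inner_vec_def vsum_def sum_distrib_left left_diff_distrib sum_subtractf)
    ultimately have "v \<bullet> z \<ge> v \<bullet> p" using z by simp
    then show False using v \<open>p \<in> P\<close> by force
  qed
qed

section \<open>Nested sets as sets of tight inequalities\<close>

definition tight :: "real ^ 'n \<Rightarrow> 'n set set" where
  "tight z = {I\<in>A. vsum z I = cnt I}"

text \<open>Applied to two sets it says that they are comparable or disjoint, applied to a disjoint
  family of at least two that its union is not in \<open>B\<close>; this is the usual notion,
  without assuming flagness.\<close>

definition nested :: "'n set set \<Rightarrow> bool" where
  "nested N \<longleftrightarrow> N \<subseteq> A \<and> (\<forall>F\<subseteq>N. \<Union>F \<in> B \<longrightarrow> \<Union>F \<in> F)"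

lemma nested_mono: "nested N \<Longrightarrow> M \<subseteq> N \<Longrightarrow> nested M"
  unfolding nested_def by blast

lemma nested_empty: "nested {}"
  using building_ne[OF bs] by (auto simp: nested_def)

text \<open>
  Equality in the supermodularity of \<open>cnt\<close> says that no member of \<open>B\<close> inside \<open>G \<union> H\<close> crosses from
  \<open>G\<close> to \<open>H\<close>.
\<close>

lemma tight_Un:
  assumes z: "z \<in> P" and G: "vsum z G = cnt G" and H: "vsum z H = cnt H"
  shows "vsum z (G \<union> H) = cnt (G \<union> H)"
    and "\<And>K. K \<in> B \<Longrightarrow> K \<subseteq> G \<union> H \<Longrightarrow> K \<subseteq> G \<or> K \<subseteq> H"
proof -
  let ?b = "\<lambda>G. {K\<in>B. K \<subseteq> G}"
  have "card (?b G \<union> ?b H) + card (?b G \<inter> ?b H) = card (?b G) + card (?b H)"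
    by (rule card_Un_Int[symmetric]) auto
  moreover have "?b G \<inter> ?b H = ?b (G \<inter> H)" by auto
  ultimately have cards: "real (card (?b G \<union> ?b H)) + cnt (G \<inter> H) = cnt G + cnt H"
    unfolding count_in_def of_nat_add[symmetric] by (simp only:)
  have sub: "?b G \<union> ?b H \<subseteq> ?b (G \<union> H)" by auto
  have le: "real (card (?b G \<union> ?b H)) \<le> cnt (G \<union> H)"
    unfolding count_in_def using card_mono[OF _ sub] by simp
  have ge: "vsum z (G \<union> H) \<ge> cnt (G \<union> H)" "vsum z (G \<inter> H) \<ge> cnt (G \<inter> H)"
    using nestohedron_vsum[OF z] by auto
  have eq: "vsum z (G \<union> H) + vsum z (G \<inter> H) = cnt G + cnt H" using vsum_Un_Int G H by metis
  show "vsum z (G \<union> H) = cnt (G \<union> H)" using cards le ge eq by linarith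
  have "real (card (?b G \<union> ?b H)) = cnt (G \<union> H)" using cards le ge eq by linarith
  then have "card (?b G \<union> ?b H) = card (?b (G \<union> H))" by (simp add: count_in_def)
  then have "?b G \<union> ?b H = ?b (G \<union> H)" using sub by (intro card_subset_eq) auto
  then show "\<And>K. K \<in> B \<Longrightarrow> K \<subseteq> G \<union> H \<Longrightarrow> K \<subseteq> G \<or> K \<subseteq> H" by blast
qed

text \<open>By induction with \<open>tight_Un\<close>, a member of \<open>B\<close> inside a union
  of tight sets lies in one of them; for the union itself this means that it is one of them.\<close>

lemma nested_tight:
  assumes z: "z \<in> P"
  shows "nested (tight z)"
proof -
  have *: "vsum z (\<Union>F) = cnt (\<Union>F) \<and> (\<forall>K\<in>B. K \<subseteq> \<Union>F \<longrightarrow> (\<exists>I\<in>F. K \<subseteq> I))" if "F \<subseteq> tight z" for F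
  proof -
    have "finite F" by simp
    then show ?thesis
      using that
    proof (induction F)
      case empty
      have "{K\<in>B. K \<subseteq> {}} = {}" using building_ne[OF bs] by auto
      then show ?case using building_ne[OF bs] by (auto simp: vsum_def count_in_def)
    next
      case (insert I F)
      then have "vsum z I = cnt I" "vsum z (\<Union>F) = cnt (\<Union>F)" "\<forall>K\<in>B. K \<subseteq> \<Union>F \<longrightarrow> (\<exists>I\<in>F. K \<subseteq> I)"
        by (auto simp: tight_def)
      with tight_Un[OF z this(1,2)] show ?case by (metis Union_insert insert_iff)
    qed
  qed
  have "\<Union>F \<in> F" if F: "F \<subseteq> tight z" "\<Union>F \<in> B" for F
  proof -
    obtain I where "I \<in> F" "\<Union>F \<subseteq> I" using *[OF F(1)] F(2) by blast
    then have "\<Union>F = I" by blast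
    then show ?thesis using \<open>I \<in> F\<close> by simp
  qed
  then show ?thesis by (auto simp: nested_def tight_def)
qed

text \<open>
  The witness is the sum over \<open>I \<in> B\<close> of the barycentres of \<open>conv {e\<^sub>i | i \<in> T I}\<close>, where \<open>T I\<close> avoids
  all members of the nested set except those that contain \<open>I\<close>.
\<close>

lemma nested_witness:
  assumes N: "nested N"
  shows "\<exists>z\<in>P. tight z = N"
proof -
  define T where "T I = I - \<Union>{J\<in>N. \<not> I \<subseteq> J}" for I
  have NA: "N \<subseteq> A" and NU: "\<And>F. F \<subseteq> N \<Longrightarrow> \<Union>F \<in> B \<Longrightarrow> \<Union>F \<in> F" using N by (auto simp: nested_def)
  have T_ne: "T I \<noteq> {}" if I: "I \<in> B" for I
  proof
    assume empty: "T I = {}"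
    \<comment> \<open>The members of \<open>N\<close> that meet \<open>I\<close> without containing
      it would cover \<open>I\<close>. Their union is then in \<open>B\<close>, hence one of them,
      and yet contains \<open>I\<close>.\<close>
    define F where "F = {J\<in>N. \<not> I \<subseteq> J \<and> J \<inter> I \<noteq> {}}"
    have sub: "I \<subseteq> \<Union>F"
    proof
      fix i assume i: "i \<in> I"
      then obtain J where "J \<in> N" "\<not> I \<subseteq> J" "i \<in> J" using empty by (auto simp: T_def)
      then show "i \<in> \<Union>F" using i unfolding F_def by blast
    qed
    have "F \<subseteq> N" by (auto simp: F_def)
    then have "F \<subseteq> B" using NA by blast
    then have "I \<union> \<Union>F \<in> B" by (rule building_set_Union[OF bs I]) (simp add: F_def)
    then have "\<Union>F \<in> B" using sub by (simp add: Un_absorb1)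
    then have "\<Union>F \<in> F" using NU \<open>F \<subseteq> N\<close> by blast
    then show False using sub by (auto simp: F_def)
  qed
  define y :: "'n set \<Rightarrow> real ^ 'n" where
    "y I = (\<chi> i. if i \<in> T I then 1 / real (card (T I)) else 0)" for I
  have T_sub: "T I \<subseteq> I" for I by (auto simp: T_def)
  have vy: "vsum (y I) G = real (card (T I \<inter> G)) / real (card (T I))" for I G
    by (simp add: vsum_def y_def sum.If_cases Int_commute)
  have yI: "y I \<in> coord_simplex I" if "I \<in> B" for I
  proof -
    have "T I \<inter> I = T I" using T_sub by blast
    then have "vsum (y I) I = 1" using T_ne[OF that] by (simp add: vy)
    then show ?thesis using T_sub by (auto simp: mem_coord_simplex y_def)
  qed
  define z where "z = (\<Sum>I\<in>B. y I)"
  have zP: "z \<in> P" using yI by (auto simp: mem_nestohedron z_def)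
  have crit: "vsum z J = cnt J \<longleftrightarrow> (\<forall>I\<in>B. \<not> I \<subseteq> J \<longrightarrow> T I \<inter> J = {})" for J
  proof -
    have "vsum z J - cnt J = (\<Sum>I\<in>B. vsum (y I) J - of_bool (I \<subseteq> J))"
      by (simp add: z_def vsum_sum count_in_eq sum_subtractf)
    then have "vsum z J = cnt J \<longleftrightarrow> (\<Sum>I\<in>B. vsum (y I) J - of_bool (I \<subseteq> J)) = 0" by linarith
    also have "\<dots> \<longleftrightarrow> (\<forall>I\<in>B. vsum (y I) J - of_bool (I \<subseteq> J) = 0)"
      using coord_simplex_vsum[OF yI] by (intro sum_nonneg_eq_0_iff) auto
    also have "\<dots> \<longleftrightarrow> (\<forall>I\<in>B. \<not> I \<subseteq> J \<longrightarrow> T I \<inter> J = {})"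
    proof (rule ball_cong[OF refl])
      fix I assume I: "I \<in> B"
      have "T I \<inter> J = T I" if "I \<subseteq> J" using that T_sub by blast
      then show "vsum (y I) J - of_bool (I \<subseteq> J) = 0 \<longleftrightarrow> (\<not> I \<subseteq> J \<longrightarrow> T I \<inter> J = {})"
        using T_ne[OF I] by (auto simp: vy)
    qed
    finally show ?thesis .
  qed
  have "J \<in> tight z \<longleftrightarrow> J \<in> N" if J: "J \<in> A" for J
  proof
    assume "J \<in> N"
    then show "J \<in> tight z" using J crit by (auto simp: tight_def T_def)
  next
    assume "J \<in> tight z"
    then have J0: "\<And>I. I \<in> B \<Longrightarrow> \<not> I \<subseteq> J \<Longrightarrow> T I \<inter> J = {}" using crit by (auto simp: tight_def)
    show "J \<in> N"
    proof (rule ccontr)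
      assume nN: "J \<notin> N"
      \<comment> \<open>Let \<open>M\<close> be a smallest set of \<open>insert UNIV N\<close> above
        \<open>J\<close>. A member of \<open>N\<close> that meets \<open>T J\<close> contains
        \<open>J\<close>, hence is comparable to \<open>M\<close> and, by minimality, contains
        \<open>M\<close>. So \<open>T J \<subseteq> T M\<close>, while tightness of \<open>J\<close>
        requires \<open>T M\<close> to miss \<open>J\<close>.\<close>
      define Q where "Q K \<longleftrightarrow> K \<in> insert UNIV N \<and> J \<subseteq> K" for K
      have "Q UNIV" by (simp add: Q_def)
      then obtain M where M: "Q M" and min: "\<And>K. Q K \<Longrightarrow> card M \<le> card K"
        using ex_has_least_nat[of Q UNIV card] by blast
      have MB: "M \<in> B" "J \<subseteq> M" "M \<noteq> J" using M J nN NA top by (auto simp: Q_def)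
      have "T J \<subseteq> T M"
      proof
        fix i assume i: "i \<in> T J"
        have "i \<notin> K" if K: "K \<in> N" "\<not> M \<subseteq> K" for K
        proof
          assume iK: "i \<in> K"
          then have JK: "J \<subseteq> K" using i K(1) by (auto simp: T_def)
          then have le: "card M \<le> card K" using min K(1) by (auto simp: Q_def)
          show False
          proof (cases "M = UNIV")
            case True
            then have "K = UNIV" using le by (simp add: card_eq_UNIV_imp_eq_UNIV card_mono le_antisym)
            then show False using K(2) by simp
          next
            case False
            then have "M \<in> N" using M by (auto simp: Q_def)
            moreover have "K \<union> M \<in> B"
              using building_un[OF bs, of K M] K(1) NA MB JK building_ne[OF bs, of J] J by auto
            ultimately have "K \<union> M \<in> {K, M}" using NU[of "{K, M}"] K(1) by auto
            then have "K \<subseteq> M" using K(2) by auto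
            then have "K = M" using le by (simp add: card_seteq)
            then show False using K(2) by simp
          qed
        qed
        then show "i \<in> T M" using i MB(2) by (auto simp: T_def)
      qed
      moreover have "T M \<inter> J = {}" using J0[OF MB(1)] MB(2,3) by blast
      moreover have "T J \<noteq> {}" "T J \<subseteq> J" using T_ne J T_sub by auto
      ultimately show False by blast
    qed
  qed
  then have "tight z = N" using NA by (auto simp: tight_def)
  then show ?thesis using zP by blast
qed

lemma tight_image: "tight ` P = {N. nested N}"
  using nested_tight nested_witness by blast

section \<open>Facets of a nestohedron\<close>

lemma perturb:
  assumes "\<And>J. J \<in> C \<Longrightarrow> vsum z J > cnt J"
  obtains e where "e > 0" "\<And>J. J \<in> C \<Longrightarrow> vsum (z + e *\<^sub>R v) J > cnt J"
proof -
  have "\<forall>J\<in>C. \<forall>\<^sub>F e in at_right 0. vsum (z + e *\<^sub>R v) J > cnt J"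
  proof
    fix J assume J: "J \<in> C"
    have "((\<lambda>e. vsum z J + e * vsum v J) \<longlongrightarrow> vsum z J + 0 * vsum v J) (at_right 0)"
      by (intro tendsto_intros)
    then show "\<forall>\<^sub>F e in at_right 0. vsum (z + e *\<^sub>R v) J > cnt J"
      unfolding vsum_add vsum_scale using assms[OF J] by (intro order_tendstoD(1)) auto
  qed
  then have "\<forall>\<^sub>F e in at_right 0. \<forall>J\<in>C. vsum (z + e *\<^sub>R v) J > cnt J"
    by (intro eventually_ball_finite) auto
  then have "\<forall>\<^sub>F e in at_right 0. e > (0::real) \<and> (\<forall>J\<in>C. vsum (z + e *\<^sub>R v) J > cnt J)"
    using eventually_at_right_less by (intro eventually_conj) auto
  then show ?thesis using eventually_happens'[OF trivial_limit_at_right_real] that by blast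
qed

lemma strict_point:
  obtains x where "x \<in> P" "\<And>I. I \<in> A \<Longrightarrow> vsum x I > cnt I"
proof -
  obtain x where "x \<in> P" "tight x = {}" using nested_witness[OF nested_empty] by blast
  moreover then have "\<And>I. I \<in> A \<Longrightarrow> vsum x I > cnt I"
    using nestohedron_vsum[of x B] unfolding tight_def by (force simp: less_le)
  ultimately show ?thesis using that by blast
qed

lemma facet_point:
  assumes "I \<in> A"
  obtains z where "z \<in> P" "tight z = {I}"
proof -
  have "nested {I}"
    using assms building_ne[OF bs] by (auto simp: nested_def subset_singleton_iff)
  then show ?thesis using nested_witness that by blast
qed

lemma tight_less: "z \<in> P \<Longrightarrow> I \<in> A \<Longrightarrow> I \<notin> tight z \<Longrightarrow> vsum z I > cnt I"
  using nestohedron_vsum[of z B I] by (auto simp: tight_def)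

abbreviation "face I \<equiv> {z\<in>P. vsum z I = cnt I}"

text \<open>Moving from a point where only \<open>I\<close> is tight a little further away from a
  strictly feasible \<open>x\<close> violates the inequality of \<open>I\<close> and no other. This
  is the irredundancy behind the list of facets.\<close>

lemma outside_point:
  assumes I: "I \<in> A"
  obtains p where "p \<in> affine hull P" "vsum p I < cnt I" "\<And>J. J \<in> A - {I} \<Longrightarrow> vsum p J > cnt J"
proof -
  obtain z where z: "z \<in> P" "tight z = {I}" using facet_point[OF I] .
  obtain x where x: "x \<in> P" "\<And>I. I \<in> A \<Longrightarrow> vsum x I > cnt I" using strict_point by metis
  have "vsum z J > cnt J" if "J \<in> A - {I}" for J using tight_less[OF z(1)] z(2) that by auto
  then obtain e where e: "e > 0" "\<And>J. J \<in> A - {I} \<Longrightarrow> vsum (z + e *\<^sub>R (z - x)) J > cnt J"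
    using perturb[of "A - {I}" z "z - x"] by metis
  have "z + e *\<^sub>R (z - x) = (1 + e) *\<^sub>R z + (- e) *\<^sub>R x" by (simp add: algebra_simps)
  then have "z + e *\<^sub>R (z - x) \<in> affine hull P"
    using z(1) x(1) by (simp only:) (intro mem_affine affine_affine_hull hull_inc, auto)
  moreover have "vsum z I = cnt I" using z(2) by (auto simp: tight_def)
  then have "vsum (z + e *\<^sub>R (z - x)) I < cnt I"
    using e(1) x(2)[OF I] by (simp add: vsum_add vsum_scale vsum_diff mult_pos_neg)
  ultimately show ?thesis using that e(2) by blast
qed

lemma facet_iff: "F facet_of P \<longleftrightarrow> (\<exists>I\<in>A. F = face I)"
proof -
  define ind :: "'n set \<Rightarrow> real ^ 'n" where "ind I = (\<chi> i. of_bool (i \<in> I))" for I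
  have ind: "ind I \<bullet> z = vsum z I" for I z
  proof -
    have "ind I \<bullet> z = (\<Sum>i\<in>UNIV. if i \<in> I then z $ i else 0)"
      unfolding ind_def inner_vec_def by (rule sum.cong) auto
    then show ?thesis by (simp add: vsum_def sum.If_cases)
  qed
  define H where "H I = {z. - ind I \<bullet> z \<le> - cnt I}" for I
  have H: "z \<in> H I \<longleftrightarrow> vsum z I \<ge> cnt I" for z I by (simp add: H_def ind)
  have inj: "inj_on H A"
  proof (rule inj_onI)
    fix I J assume IJ: "I \<in> A" "J \<in> A" "H I = H J"
    obtain p where p: "vsum p I < cnt I" "\<And>J. J \<in> A - {I} \<Longrightarrow> vsum p J > cnt J"
      using outside_point[OF IJ(1)] by metis
    show "I = J"
    proof (rule ccontr)
      assume "I \<noteq> J"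
      then have "p \<in> H J" using p(2)[of J] IJ(2) H by simp
      moreover have "p \<notin> H I" using p(1) H by simp
      ultimately show False using IJ(3) by simp
    qed
  qed
  define g where "g = inv_into A H"
  have g: "g (H I) = I" if "I \<in> A" for I using inv_into_f_f[OF inj that] by (simp add: g_def)
  have aff: "affine hull P \<subseteq> {z. vsum z UNIV = cnt UNIV}"
    by (rule hull_minimal) (auto simp: mem_P affine_def vsum_add vsum_scale simp flip: distrib_right)
  have "F facet_of P \<longleftrightarrow> (\<exists>h. h \<in> H ` A \<and> F = P \<inter> {x. - ind (g h) \<bullet> x = - cnt (g h)})"
  proof (rule facet_of_polyhedron_explicit)
    show "P = affine hull P \<inter> \<Inter> (H ` A)"
    proof
      show "P \<subseteq> affine hull P \<inter> \<Inter> (H ` A)"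
        using hull_subset[of P affine] by (force simp: mem_P H)
      show "affine hull P \<inter> \<Inter> (H ` A) \<subseteq> P"
      proof
        fix z assume z: "z \<in> affine hull P \<inter> \<Inter> (H ` A)"
        then have "vsum z I \<ge> cnt I" if "I \<in> A" for I using that H[of z I] by blast
        then show "z \<in> P" using aff z by (auto simp: mem_P)
      qed
    qed
    show "- ind (g h) \<noteq> 0 \<and> h = {x. - ind (g h) \<bullet> x \<le> - cnt (g h)}" if h: "h \<in> H ` A" for h
    proof -
      obtain I where I: "I \<in> A" "h = H I" using h by blast
      obtain i where "i \<in> I" using building_ne[OF bs] I(1) by blast
      then have "ind I $ i \<noteq> 0" by (simp add: ind_def)
      then have "ind I \<noteq> 0" by auto
      then show ?thesis using g[OF I(1)] I(2) by (simp add: H_def)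
    qed
    show "P \<subset> affine hull P \<inter> \<Inter> F'" if F': "F' \<subset> H ` A" for F'
    proof -
      obtain I where I: "I \<in> A" "H I \<notin> F'" using F' by blast
      obtain p where p: "p \<in> affine hull P" "vsum p I < cnt I" "\<And>J. J \<in> A - {I} \<Longrightarrow> vsum p J > cnt J"
        using outside_point[OF I(1)] by metis
      have "p \<in> h" if h: "h \<in> F'" for h
      proof -
        obtain J where "J \<in> A" "h = H J" using h F' by blast
        then show ?thesis using p(3)[of J] I(2) h H by (cases "J = I") auto
      qed
      then have "p \<in> affine hull P \<inter> \<Inter> F'" using p(1) by blast
      moreover have "p \<notin> P" using p(2) I(1) unfolding mem_P by (metis not_le)
      moreover have "P \<subseteq> H J" if "J \<in> A" for J using that by (auto simp: H nestohedron_vsum)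
      then have "P \<subseteq> affine hull P \<inter> \<Inter> F'" using hull_subset[of P affine] F' by blast
      ultimately show ?thesis by blast
    qed
  qed simp
  also have "\<dots> \<longleftrightarrow> (\<exists>I\<in>A. F = face I)"
  proof -
    have "P \<inter> {x. - ind (g (H I)) \<bullet> x = - cnt (g (H I))} = face I" if "I \<in> A" for I
      using g[OF that] by (auto simp: ind)
    then show ?thesis by auto
  qed
  finally show ?thesis .
qed

section \<open>Flagness of a nestohedron\<close>

lemma flag_polytope_iff_nested:
  "flag_polytope P \<longleftrightarrow> (\<forall>N\<subseteq>A. (\<forall>I\<in>N. \<forall>J\<in>N. nested {I, J}) \<longrightarrow> nested N)"
proof
  assume flag: "flag_polytope P"
  show "\<forall>N\<subseteq>A. (\<forall>I\<in>N. \<forall>J\<in>N. nested {I, J}) \<longrightarrow> nested N"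
  proof (intro allI impI)
    fix N assume N: "N \<subseteq> A" "\<forall>I\<in>N. \<forall>J\<in>N. nested {I, J}"
    have "face I facet_of P" if "I \<in> N" for I using facet_iff that N(1) by blast
    moreover have "face I \<inter> face J \<noteq> {}" if IJ: "I \<in> N" "J \<in> N" for I J
    proof -
      have "nested {I, J}" using N(2) IJ by blast
      then obtain z where "z \<in> P" "tight z = {I, J}" using nested_witness by blast
      then have "z \<in> face I \<inter> face J" unfolding tight_def by blast
      then show ?thesis by blast
    qed
    ultimately have "\<Inter>(face ` N) \<noteq> {}"
      using flag unfolding flag_polytope_def by (elim allE[of _ "face ` N"]) blast
    then obtain z where z: "z \<in> \<Inter>(face ` N)" by blast
    show "nested N"
    proof (cases "N = {}")
      case False
      then have "z \<in> P" "N \<subseteq> tight z" using z N(1) by (auto simp: tight_def)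
      then show ?thesis using nested_mono[OF nested_tight] by blast
    qed (simp add: nested_empty)
  qed
next
  assume nested: "\<forall>N\<subseteq>A. (\<forall>I\<in>N. \<forall>J\<in>N. nested {I, J}) \<longrightarrow> nested N"
  show "flag_polytope P"
    unfolding flag_polytope_def
  proof (intro allI impI)
    fix \<F> assume F: "(\<forall>F\<in>\<F>. F facet_of P) \<and> (\<forall>F\<in>\<F>. \<forall>G\<in>\<F>. F \<inter> G \<noteq> {})"
    define N where "N = {I\<in>A. face I \<in> \<F>}"
    have "nested {I, J}" if "I \<in> N" "J \<in> N" for I J
    proof -
      have "face I \<inter> face J \<noteq> {}" using F that unfolding N_def by blast
      then obtain z where "z \<in> P" "vsum z I = cnt I" "vsum z J = cnt J" by blast
      then have "z \<in> P" "{I, J} \<subseteq> tight z" using that by (auto simp: N_def tight_def)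
      then show ?thesis using nested_mono[OF nested_tight] by blast
    qed
    moreover have "N \<subseteq> A" by (auto simp: N_def)
    ultimately have "nested N" using nested by blast
    then obtain z where z: "z \<in> P" "tight z = N" using nested_witness by blast
    have "z \<in> F" if FF: "F \<in> \<F>" for F
    proof -
      have "F facet_of P" using F FF by blast
      then obtain I where I: "I \<in> A" "F = face I" using facet_iff by blast
      then have "I \<in> N" using FF by (simp add: N_def)
      then have "I \<in> tight z" using z by simp
      then show ?thesis using z(1) I by (simp add: tight_def)
    qed
    then show "\<Inter>\<F> \<noteq> {}" by blast
  qed
qed

lemma nested_pair:
  assumes "I \<in> A" "J \<in> A" "nested_compat B I J"
  shows "nested {I, J}"
  unfolding nested_def
proof (intro conjI allI impI)
  show "{I, J} \<subseteq> A" using assms by simp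
  fix F assume F: "F \<subseteq> {I, J}" "\<Union>F \<in> B"
  then consider "F = {}" | "F = {I}" | "F = {J}" | "F = {I, J}" by blast
  then show "\<Union>F \<in> F"
  proof cases
    case 1
    then show ?thesis using F(2) building_ne[OF bs] by auto
  next
    case 4
    then show ?thesis using F(2) assms(3) by (auto simp: nested_compat_def Un_absorb1 Un_absorb2)
  qed auto
qed

lemma compat_of_nested:
  assumes "nested N" "I \<in> N" "J \<in> N"
  shows "nested_compat B I J"
proof -
  have IJ: "I \<in> B" "J \<in> B" and "\<forall>F\<subseteq>N. \<Union>F \<in> B \<longrightarrow> \<Union>F \<in> F"
    using assms by (auto simp: nested_def)
  from this(3)[rule_format, of "{I, J}"] have "I \<union> J \<in> B \<Longrightarrow> I \<union> J \<in> {I, J}"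
    using assms(2,3) by simp
  then show ?thesis using building_un[OF bs IJ] unfolding nested_compat_def by blast
qed

lemma nested_iff_clique:
  assumes "splitting B"
  shows "nested N \<longleftrightarrow> N \<in> cliques A (nested_compat B)"
proof
  assume "nested N"
  then show "N \<in> cliques A (nested_compat B)"
    using compat_of_nested unfolding cliques_def nested_def by blast
next
  assume N: "N \<in> cliques A (nested_compat B)"
  show "nested N"
    unfolding nested_def
  proof (intro conjI allI impI)
    show "N \<subseteq> A" using N by (simp add: cliques_def)
    fix F assume F: "F \<subseteq> N" "\<Union>F \<in> B"
    show "\<Union>F \<in> F"
    proof (rule compat_family_Union[OF bs assms _ _ F(2)])
      show "F \<subseteq> B" using F(1) N by (auto simp: cliques_def)
      show "nested_compat B I J" if "I \<in> F" "J \<in> F" "I \<noteq> J" for I J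
      proof -
        have "I \<in> N" "J \<in> N" using F(1) that by auto
        then show ?thesis using N that(3) by (simp add: cliques_def)
      qed
    qed
  qed
qed

text \<open>To get a split from flagness, suppose that a non-singleton \<open>U\<close> has none.
  Take \<open>J\<close> maximal among the members properly inside \<open>U\<close>, together with
  the maximal members inside \<open>U - J\<close>. No two distinct sets of this family have their
  union in \<open>B\<close>, so a flag polytope would make the family nested, although its union is
  \<open>U\<close> and \<open>U\<close> does not belong to it.\<close>

lemma flag_polytope_iff_splitting: "flag_polytope P \<longleftrightarrow> splitting B"
proof
  assume "splitting B"
  then show "flag_polytope P"
    unfolding flag_polytope_iff_nested
    using compat_of_nested by (auto simp: nested_iff_clique cliques_def)
next
  assume flag: "flag_polytope P"
  show "splitting B"
    unfolding splitting_def
  proof (intro ballI disjCI)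
    fix U assume U: "U \<in> B" and nosplit: "\<not> (\<exists>J\<in>B. \<exists>K\<in>B. J \<inter> K = {} \<and> J \<union> K = U)"
    show "\<exists>i. U = {i}"
    proof (rule ccontr)
      assume nsing: "\<not> (\<exists>i. U = {i})"
      obtain i where "i \<in> U" using building_ne[OF bs U] by blast
      then have "{i} \<in> {J\<in>B. J \<subset> U}" using nsing building_single[OF bs] by auto
      from finite_has_maximal2[OF finite this]
      obtain J where "J \<in> {J\<in>B. J \<subset> U}" "\<forall>K\<in>{J\<in>B. J \<subset> U}. J \<subseteq> K \<longrightarrow> J = K"
        by blast
      then have J: "J \<in> B" "J \<subset> U" and Jmax: "\<And>K. K \<in> B \<Longrightarrow> K \<subset> U \<Longrightarrow> J \<subseteq> K \<Longrightarrow> J = K"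
        by blast+
      have UJ: "U - J \<notin> B"
      proof
        assume UJ: "U - J \<in> B"
        have "J \<inter> (U - J) = {} \<and> J \<union> (U - J) = U" using J(2) by auto
        then show False using nosplit UJ J(1) by metis
      qed
      define \<K> where "\<K> = {K\<in>B. K \<subseteq> U - J \<and> (\<forall>L\<in>B. L \<subseteq> U - J \<longrightarrow> K \<subseteq> L \<longrightarrow> K = L)}"
      have cover: "\<exists>K\<in>\<K>. j \<in> K" if "j \<in> U - J" for j
      proof -
        have "{j} \<in> {K\<in>B. K \<subseteq> U - J}" using that building_single[OF bs] by auto
        from finite_has_maximal2[OF finite this]
        obtain K where K: "K \<in> {K\<in>B. K \<subseteq> U - J}" "{j} \<subseteq> K"
          "\<forall>L\<in>{K\<in>B. K \<subseteq> U - J}. K \<subseteq> L \<longrightarrow> K = L" by blast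
        then have "K \<in> \<K>" by (simp add: \<K>_def)
        then show ?thesis using K(2) by blast
      qed
      have KA: "\<And>K. K \<in> \<K> \<Longrightarrow> K \<in> A" using building_ne[OF bs J(1)] by (auto simp: \<K>_def)
      have JA: "J \<in> A" using J by auto
      have JK: "nested_compat B J K" if "K \<in> \<K>" for K
      proof -
        have K: "K \<in> B" "K \<subseteq> U - J" using that by (auto simp: \<K>_def)
        have "J \<union> K \<notin> B"
        proof
          assume JK: "J \<union> K \<in> B"
          have "J \<union> K \<noteq> U" 
          proof
            assume "J \<union> K = U"
            then have "U - J = K" using K by blast
            then show False using K UJ by simp
          qed
          then have "J = J \<union> K" using Jmax[OF JK] K J(2) by blast
          then show False using K building_ne[OF bs K(1)] by blast
        qed
        then show ?thesis using K by (auto simp: nested_compat_def)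
      qed
      have Kmax: "K = L" if "K \<in> \<K>" "L \<in> B" "L \<subseteq> U - J" "K \<subseteq> L" for K L
        using that by (simp add: \<K>_def)
      have KL: "nested_compat B K L" if k: "K \<in> \<K>" and l: "L \<in> \<K>" for K L
      proof -
        have K: "K \<in> B" "K \<subseteq> U - J" "L \<in> B" "L \<subseteq> U - J" using k l by (auto simp: \<K>_def)
        have "K = L" if un: "K \<union> L \<in> B"
        proof -
          have "K = K \<union> L" using Kmax[OF k un] K by blast
          moreover have "L = K \<union> L" using Kmax[OF l un] K by blast
          ultimately show ?thesis by simp
        qed
        then show ?thesis using building_un[OF bs K(1,3)] unfolding nested_compat_def by blast
      qed
      have "nested {I, I'}" if I: "I \<in> insert J \<K>" "I' \<in> insert J \<K>" for I I'
      proof (rule nested_pair)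
        show "I \<in> A" "I' \<in> A" using I KA JA by auto
        have "nested_compat B J J" by (simp add: nested_compat_def)
        then show "nested_compat B I I'" using I JK KL compat_sym[OF JK] by auto
      qed
      then have pairs: "\<forall>I\<in>insert J \<K>. \<forall>I'\<in>insert J \<K>. nested {I, I'}" by (intro ballI)
      have "insert J \<K> \<subseteq> A" using KA JA by auto
      then have "nested (insert J \<K>)"
        using flag[unfolded flag_polytope_iff_nested] pairs by (elim allE[of _ "insert J \<K>"] impE)
      moreover have "\<Union>(insert J \<K>) = U"
      proof
        show "\<Union>(insert J \<K>) \<subseteq> U" using J by (auto simp: \<K>_def)
        show "U \<subseteq> \<Union>(insert J \<K>)" using cover by blast
      qed
      ultimately have "U \<in> insert J \<K>" using U unfolding nested_def by (metis order_refl)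
      moreover have "U \<notin> \<K>" "U \<noteq> J" using J building_ne[OF bs J(1)] unfolding \<K>_def by blast+
      ultimately show False by simp
    qed
  qed
qed

end

section \<open>The polar dual of a nestohedron\<close>

lemma (in inequality_polytope) finite_boundary_complex: "finite (boundary_complex Q)"
proof -
  have "boundary_complex Q \<subseteq> Pow (a ` A)" by (auto simp: boundary_complex_Q tight_def)
  then show ?thesis using finA by (simp add: finite_subset)
qed

context connected_building_set
begin

text \<open>\<open>a I\<close> is the indicator vector of \<open>I\<close>, projected onto the
  hyperplane of coordinate sum 0 and divided by minus the slack at \<open>x\<close>, so that
  \<open>vsum z I \<ge> cnt I\<close> becomes \<open>a I \<bullet> (z - x) \<le> 1\<close>.\<close>

lemma polar_dual_nestohedron:
  "\<exists>x a E. polar_dual P = polar_dual_at x P \<and> inequality_polytope x A a P E \<and>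
    (\<forall>z\<in>P. {I\<in>A. a I \<bullet> (z - x) = 1} = tight z)"
proof -
  define x where "x = (SOME x. x \<in> rel_interior P)"
  obtain x0 where x0: "x0 \<in> P" "\<And>I. I \<in> A \<Longrightarrow> vsum x0 I > cnt I" using strict_point by metis
  have "rel_interior P \<noteq> {}" using x0(1) convex_nestohedron rel_interior_eq_empty by blast
  then have x_rel: "x \<in> rel_interior P" unfolding x_def by (rule some_in_eq[THEN iffD2])
  then have xP: "x \<in> P" using rel_interior_subset by blast
  \<comment> \<open>If \<open>I\<close> were tight at the relative interior point \<open>x\<close>,
    prolonging the segment from \<open>x0\<close> a little beyond \<open>x\<close> would stay in
    \<open>P\<close> and violate the inequality of \<open>I\<close>.\<close>
  have strict: "vsum x I > cnt I" if I: "I \<in> A" for I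
  proof (rule ccontr)
    assume "\<not> vsum x I > cnt I"
    then have eq: "vsum x I = cnt I" using nestohedron_vsum[OF xP, of I] by simp
    obtain e where e: "e > 1" "(1 - e) *\<^sub>R x0 + e *\<^sub>R x \<in> P"
      using x_rel x0(1) convex_rel_interior_iff[OF convex_nestohedron, of B x] by blast
    have "(1 - e) * vsum x0 I + e * cnt I \<ge> cnt I"
      using nestohedron_vsum[OF e(2), of I] eq by (simp add: vsum_add vsum_scale)
    then have "(1 - e) * (vsum x0 I - cnt I) \<ge> 0" by (simp add: algebra_simps)
    moreover have "(1 - e) * (vsum x0 I - cnt I) < 0" using e(1) x0(2)[OF I] by (simp add: mult_neg_pos)
    ultimately show False by simp
  qed
  define E where "E = {v :: real ^ 'n. vsum v UNIV = 0}"
  have E: "E = span ((\<lambda>z. z - x) ` P)"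
  proof
    show "span ((\<lambda>z. z - x) ` P) \<subseteq> E"
      using xP by (intro span_minimal)
        (auto simp: E_def mem_P subspace_def vsum_add vsum_diff vsum_scale, simp add: vsum_def)
    show "E \<subseteq> span ((\<lambda>z. z - x) ` P)"
    proof
      fix v assume v: "v \<in> E"
      obtain e where e: "e > 0" "\<And>J. J \<in> A \<Longrightarrow> vsum (x + e *\<^sub>R v) J > cnt J"
        using perturb[of A x v] strict by metis
      then have "x + e *\<^sub>R v \<in> P"
        using v xP by (auto simp: mem_P E_def vsum_add vsum_scale intro: less_imp_le)
      then have "(x + e *\<^sub>R v) - x \<in> (\<lambda>z. z - x) ` P" by (rule imageI)
      then have "(1 / e) *\<^sub>R (e *\<^sub>R v) \<in> span ((\<lambda>z. z - x) ` P)"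
        by (intro span_scale span_base) simp
      then show "v \<in> span ((\<lambda>z. z - x) ` P)" using e(1) by simp
    qed
  qed
  define sl where "sl I = vsum x I - cnt I" for I
  have sl: "sl I > 0" if "I \<in> A" for I using strict[OF that] by (simp add: sl_def)
  define p :: "'n set \<Rightarrow> real ^ 'n" where "p I = (\<chi> i. of_bool (i \<in> I) - real (card I) / real CARD('n))" for I
  define a where "a I = (- 1 / sl I) *\<^sub>R p I" for I
  have pv: "p I \<bullet> v = vsum v I" if "v \<in> E" for I v
  proof -
    have "p I \<bullet> v = (\<Sum>i\<in>UNIV. (if i \<in> I then v $ i else 0) - real (card I) / real CARD('n) * v $ i)"
      unfolding p_def inner_vec_def by (rule sum.cong) (auto simp: algebra_simps)
    also have "\<dots> = vsum v I - real (card I) / real CARD('n) * vsum v UNIV"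
      by (simp add: sum_subtractf sum.If_cases vsum_def sum_distrib_left)
    finally show ?thesis using that by (simp add: E_def)
  qed
  have av: "a I \<bullet> (z - x) = 1 - (vsum z I - cnt I) / sl I" if "I \<in> A" "z - x \<in> E" for I z
    using sl[OF that(1)] pv[OF that(2), of I]
    by (simp add: a_def vsum_diff) (simp add: sl_def field_simps)
  have zE: "z - x \<in> E \<longleftrightarrow> vsum z UNIV = cnt UNIV" for z
    using xP by (auto simp: E_def mem_P vsum_diff)
  have tight: "{I\<in>A. a I \<bullet> (z - x) = 1} = tight z" if z: "z \<in> P" for z
  proof -
    have "a I \<bullet> (z - x) = 1 \<longleftrightarrow> vsum z I = cnt I" if I: "I \<in> A" for I
    proof -
      have "z - x \<in> E" using z by (simp add: zE mem_P)
      then show ?thesis using sl[OF I] by (simp add: av[OF I])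
    qed
    then show ?thesis unfolding tight_def by (intro Collect_cong conj_cong) auto
  qed
  have "inequality_polytope x A a P E"
  proof
    show "E = span ((\<lambda>z. z - x) ` P)" by (rule E)
    show "finite A" by simp
    show "a I \<in> E" if "I \<in> A" for I
    proof -
      have "vsum (p I) UNIV = 0"
        by (simp add: vsum_def p_def sum_subtractf)
      then show ?thesis unfolding E_def a_def mem_Collect_eq vsum_scale by simp
    qed
    show "P = {z. z - x \<in> E \<and> (\<forall>I\<in>A. a I \<bullet> (z - x) \<le> 1)}"
    proof (intro set_eqI)
      fix z
      have "a I \<bullet> (z - x) \<le> 1 \<longleftrightarrow> vsum z I \<ge> cnt I" if "I \<in> A" "z - x \<in> E" for I
        using sl[OF that(1)] by (simp add: av[OF that] zero_le_divide_iff)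
      then show "z \<in> P \<longleftrightarrow> z \<in> {z. z - x \<in> E \<and> (\<forall>I\<in>A. a I \<bullet> (z - x) \<le> 1)}"
        unfolding mem_P zE[symmetric] mem_Collect_eq by (intro conj_cong ball_cong) auto
    qed
    show "bounded P" using compact_nestohedron compact_imp_bounded by blast
    show "\<exists>z\<in>P. {J\<in>A. a J \<bullet> (z - x) = 1} = {I}" if I: "I \<in> A" for I
    proof -
      obtain z where z: "z \<in> P" "tight z = {I}" using facet_point[OF I] by metis
      show ?thesis by (rule bexI[OF _ z(1)]) (simp only: tight[OF z(1)] z(2))
    qed
  qed
  moreover have "polar_dual P = polar_dual_at x P" by (simp add: polar_dual_def x_def)
  ultimately show ?thesis using tight by blast
qed

lemma finite_boundary_complex: "finite (boundary_complex (polar_dual P))"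
  and sum_boundary_complex:
    "(\<Sum>\<sigma>\<in>boundary_complex (polar_dual P). g (card \<sigma>)) = (\<Sum>N | nested N. g (card N))"
proof -
  obtain x a E where dual: "polar_dual P = polar_dual_at x P" and ip: "inequality_polytope x A a P E"
    and tight: "\<forall>z\<in>P. {I\<in>A. a I \<bullet> (z - x) = 1} = tight z"
    using polar_dual_nestohedron by (elim exE conjE) (rule that)
  interpret ip: inequality_polytope x A a P E by (rule ip)
  have "ip.tight ` P = tight ` P" by (rule image_cong) (simp_all only: ip.tight_def tight)
  then show "(\<Sum>\<sigma>\<in>boundary_complex (polar_dual P). g (card \<sigma>)) = (\<Sum>N | nested N. g (card N))"
    using ip.sum_boundary_complex[of g] by (simp add: dual tight_image)
  show "finite (boundary_complex (polar_dual P))"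
    using ip.finite_boundary_complex by (simp add: dual)
qed

end


section \<open>Polytopal and combinatorial flagness\<close>

text \<open>Splitting \<open>S\<close> and recursing into both halves yields a binary tree inside
  \<open>B\<close>. Hence a minimal flag building set equals such a tree, which is how
  decompositions enter the induction.\<close>

lemma ex_laminar_flag_bs:
  fixes B :: "'n::finite set set"
  assumes "flag_bs S B"
  shows "\<exists>D\<subseteq>B. flag_bs S D \<and> laminar D"
  using assms
proof (induction "card S" arbitrary: S B rule: less_induct)
  case less
  have bs: "building_set S B" and sp: "splitting B" and SB: "S \<in> B"
    using less.prems by (auto simp: flag_bs_def)
  show ?case
    using sp SB
  proof (cases rule: splittingE)
    case (1 i)
    then have "flag_bs S {S}" "laminar {S}"
      by (auto simp: flag_bs_def building_set_def splitting_def laminar_def)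
    then show ?thesis using SB by blast
  next
    case (2 J K)
    have ne: "J \<noteq> {}" "K \<noteq> {}" using 2 building_ne[OF bs] by auto
    then have "J \<subset> S" "K \<subset> S" using 2 by auto
    then have less_card: "card J < card S" "card K < card S" by (auto intro: psubset_card_mono)
    obtain C where C: "C \<subseteq> restr B J" "flag_bs J C" "laminar C"
      using less.hyps[OF less_card(1) flag_bs_restr[OF less.prems 2(1)]] by blast
    obtain D where D: "D \<subseteq> restr B K" "flag_bs K D" "laminar D"
      using less.hyps[OF less_card(2) flag_bs_restr[OF less.prems 2(2)]] by blast
    have CJ: "building_set J C" "splitting C" "J \<in> C" and DK: "building_set K D" "splitting D" "K \<in> D"
      using C D by (auto simp: flag_bs_def)
    let ?E = "insert S (C \<union> D)"
    have sub: "I \<subseteq> J" "I \<noteq> {}" if "I \<in> C" for I using building_sub[OF CJ(1)] building_ne[OF CJ(1)] that by auto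
    have sub': "I \<subseteq> K" "I \<noteq> {}" if "I \<in> D" for I using building_sub[OF DK(1)] building_ne[OF DK(1)] that by auto
    have subS: "I \<subseteq> S" if "I \<in> ?E" for I using that sub sub' 2(4) by blast
    have lam: "I \<subseteq> I' \<or> I' \<subseteq> I" if I: "I \<in> ?E" "I' \<in> ?E" "I \<inter> I' \<noteq> {}" for I I'
    proof -
      consider "I = S" | "I' = S" | "I \<in> C" "I' \<in> C" | "I \<in> D" "I' \<in> D" | "I \<subseteq> J" "I' \<subseteq> K" | "I \<subseteq> K" "I' \<subseteq> J"
        using I(1,2) sub sub' by blast
      then show ?thesis
      proof cases
        case 1 then show ?thesis using subS[OF I(2)] by simp
      next
        case 2 then show ?thesis using subS[OF I(1)] by simp
      next
        case 3 then show ?thesis using C(3) I(3) unfolding laminar_def by blast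
      next
        case 4 then show ?thesis using D(3) I(3) unfolding laminar_def by blast
      next
        case 5 then show ?thesis using 2(3) I(3) by blast
      next
        case 6 then show ?thesis using 2(3) I(3) by blast
      qed
    qed
    have "building_set S ?E"
      unfolding building_set_def
    proof (intro conjI ballI impI)
      fix I assume I: "I \<in> ?E"
      show "I \<noteq> {}" using I sub(2) sub'(2) building_ne[OF bs SB] by blast
      show "I \<subseteq> S" by (rule subS[OF I])
    next
      fix I I' assume I: "I \<in> ?E" "I' \<in> ?E" "I \<inter> I' \<noteq> {}"
      from lam[OF this] have "I \<union> I' = I \<or> I \<union> I' = I'" by blast
      then show "I \<union> I' \<in> ?E" using I(1,2) by metis
    next
      fix i assume "i \<in> S"
      then have "i \<in> J \<or> i \<in> K" using 2(4) by blast
      then show "{i} \<in> ?E" using building_single[OF CJ(1)] building_single[OF DK(1)] by blast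
    qed
    moreover have "splitting ?E"
      unfolding splitting_def
    proof
      fix I assume "I \<in> ?E"
      then consider "I = S" | "I \<in> C" | "I \<in> D" by blast
      then show "(\<exists>i. I = {i}) \<or> (\<exists>J\<in>?E. \<exists>K\<in>?E. J \<inter> K = {} \<and> J \<union> K = I)"
      proof cases
        case 1
        then show ?thesis using 2(3,4) CJ(3) DK(3) by blast
      next
        case 2
        then show ?thesis using CJ(2) unfolding splitting_def by blast
      next
        case 3
        then show ?thesis using DK(2) unfolding splitting_def by blast
      qed
    qed
    ultimately have "flag_bs S ?E" by (simp add: flag_bs_def)
    moreover have "laminar ?E" using lam unfolding laminar_def by blast
    moreover have "?E \<subseteq> B" using C(1) D(1) SB by (auto simp: restr_def)
    ultimately show ?thesis by blast
  qed
qed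

lemma flag_building_set_UNIV:
  fixes B :: "'n::finite set set"
  assumes "UNIV \<in> B"
  shows "flag_building_set UNIV B \<longleftrightarrow> flag_bs UNIV B"
proof (cases "building_set UNIV B")
  case True
  then interpret connected_building_set B using assms by unfold_locales
  show ?thesis using True assms by (simp add: flag_building_set_def flag_bs_def flag_polytope_iff_splitting)
qed (simp add: flag_building_set_def flag_bs_def)

lemma connected_flag_building_set_UNIV:
  "connected_flag_building_set UNIV B \<longleftrightarrow> flag_bs UNIV B"
  using flag_building_set_UNIV by (auto simp: connected_flag_building_set_def flag_bs_def)

lemma minimal_flag_building_set_UNIV:
  assumes "minimal_flag_building_set UNIV D"
  shows "flag_bs UNIV D" "laminar D"
proof -
  show D: "flag_bs UNIV D"
    using assms by (simp add: minimal_flag_building_set_def connected_flag_building_set_UNIV)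
  obtain C where C: "C \<subseteq> D" "flag_bs UNIV C" "laminar C" using ex_laminar_flag_bs[OF D] by blast
  have "\<not> C \<subset> D"
    using assms C(2) by (auto simp: minimal_flag_building_set_def connected_flag_building_set_UNIV)
  then have "C = D" using C(1) by blast
  then show "laminar D" using C(3) by simp
qed

lemma flag_ordering_UNIV:
  fixes D :: "'n::finite set set"
  assumes "flag_ordering UNIV B D k b"
  shows "flag_ord UNIV D {1..k} b" "B = D \<union> b ` {1..k}"
proof -
  have D: "D \<subseteq> B" "minimal_flag_building_set UNIV D" and bij: "bij_betw b {1..k} (B - D)"
    and flag: "\<And>j. j \<le> k \<Longrightarrow> flag_building_set UNIV (partial_set D b j)"
    using assms by (auto simp: flag_ordering_def decomposition_def)
  have img: "b ` {1..k} = B - D" and inj: "inj_on b {1..k}" using bij by (auto simp: bij_betw_def)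
  show "B = D \<union> b ` {1..k}" using img D(1) by blast
  show "flag_ord UNIV D {1..k} b"
    unfolding flag_ord_def
  proof (intro conjI ballI)
    show "laminar D" "flag_bs UNIV D" using minimal_flag_building_set_UNIV[OF D(2)] by auto
    fix j assume j: "j \<in> {1..k}"
    have "b j \<noteq> b i" if "i \<in> {1..k}" "i < j" for i
      using inj_onD[OF inj, of i j] that j by auto
    moreover have "b j \<notin> D" using img j by blast
    ultimately show "b j \<notin> stage D {1..k} b j" by (auto simp: stage_def)
    have "{i\<in>{1..k}. i < j} = {1..j} - {j}" "{1..j} = insert j ({1..j} - {j})" using j by auto
    then have "insert (b j) (stage D {1..k} b j) = partial_set D b j"
      unfolding stage_def partial_set_def by (metis Un_insert_right image_insert)
    moreover have "UNIV \<in> partial_set D b j"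
      using \<open>flag_bs UNIV D\<close> by (simp add: flag_bs_def partial_set_def)
    ultimately show "flag_bs UNIV (insert (b j) (stage D {1..k} b j))"
      using flag[of j] j flag_building_set_UNIV by auto
  qed simp
qed

lemma Gamma_complex_eq_cliques: "Gamma_complex D k b = cliques {1..k} (Gamma_adj D {1..k} b)"
proof -
  have UV: "i \<in> U_set D b j \<union> V_set D b j \<longleftrightarrow> Gamma_adj D {1..k} b i j"
    if ij: "i \<in> {1..k}" "j \<in> {1..k}" "i < j" for i j
  proof -
    have "{l\<in>{1..k}. l < i} = {1..i - 1}" using ij by auto
    then have "stage D {1..k} b i = partial_set D b (i - 1)" by (simp only: stage_def partial_set_def)
    then show ?thesis
      using ij by (simp add: Gamma_adj_def U_set_def V_set_def U_rel_def V_rel_def)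
  qed
  show ?thesis
  proof (intro equalityI subsetI)
    fix \<sigma> assume \<sigma>: "\<sigma> \<in> Gamma_complex D k b"
    have "Gamma_adj D {1..k} b i j" if ij: "i \<in> \<sigma>" "j \<in> \<sigma>" "i \<noteq> j" for i j
    proof -
      have "i \<in> {1..k}" "j \<in> {1..k}" using \<sigma> ij by (auto simp: Gamma_complex_def)
      then show ?thesis
        using \<sigma> ij UV[of i j] UV[of j i] Gamma_adj_sym[of D "{1..k}" b j i]
        by (cases "i < j") (auto simp: Gamma_complex_def)
    qed
    then show "\<sigma> \<in> cliques {1..k} (Gamma_adj D {1..k} b)"
      using \<sigma> by (auto simp: cliques_def Gamma_complex_def)
  next
    fix \<sigma> assume \<sigma>: "\<sigma> \<in> cliques {1..k} (Gamma_adj D {1..k} b)"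
    have "i \<in> U_set D b j \<union> V_set D b j" if ij: "i \<in> \<sigma>" "j \<in> \<sigma>" "i < j" for i j
    proof -
      have "i \<in> {1..k}" "j \<in> {1..k}" "Gamma_adj D {1..k} b i j" using \<sigma> ij by (auto simp: cliques_def)
      then show ?thesis using UV ij(3) by blast
    qed
    then show "\<sigma> \<in> Gamma_complex D k b" using \<sigma> by (auto simp: Gamma_complex_def cliques_def)
  qed
qed


section \<open>The \<open>\<gamma>\<close>-polynomial from the \<open>f\<close>-polynomial\<close>

lemma poly_f_poly:
  assumes "finite K"
  shows "poly (f_poly K) s = (\<Sum>\<sigma>\<in>K. s ^ card \<sigma>)"
proof -
  have le: "card ` K \<subseteq> {..complex_rank K}" using assms by (auto simp: complex_rank_def)
  have "(\<Sum>\<sigma>\<in>K. s ^ card \<sigma>) = (\<Sum>i\<le>complex_rank K. \<Sum>\<sigma> | \<sigma> \<in> K \<and> card \<sigma> = i. s ^ card \<sigma>)"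
    by (rule sum.group[OF assms _ le, symmetric]) simp
  also have "\<dots> = (\<Sum>i\<le>complex_rank K. real (face_count K i) * s ^ i)"
    by (simp add: face_count_def)
  finally show ?thesis by (simp add: f_poly_def poly_sum poly_monom)
qed

lemma coeff_f_poly: "coeff (f_poly K) i = (if i \<le> complex_rank K then real (face_count K i) else 0)"
  by (simp add: f_poly_def coeff_sum)

lemma face_count_rank:
  assumes "finite K" "K \<noteq> {}"
  shows "face_count K (complex_rank K) > 0"
proof -
  have "complex_rank K \<in> card ` K" unfolding complex_rank_def using assms by (intro Max_in) auto
  then show ?thesis using assms(1) by (auto simp: face_count_def card_gt_0_iff)
qed

lemma degree_f_poly:
  assumes "finite K" "K \<noteq> {}"
  shows "degree (f_poly K) = complex_rank K"
proof (rule antisym)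
  show "degree (f_poly K) \<le> complex_rank K" by (rule degree_le) (simp add: coeff_f_poly)
  show "complex_rank K \<le> degree (f_poly K)"
    using face_count_rank[OF assms] by (intro le_degree) (simp add: coeff_f_poly)
qed

lemma poly_eq_of_infinite:
  fixes p q :: "real poly"
  assumes "infinite S" "\<And>x. x \<in> S \<Longrightarrow> poly p x = poly q x"
  shows "p = q"
proof (rule ccontr)
  assume "p \<noteq> q"
  then have "finite {x. poly (p - q) x = 0}" by (intro poly_roots_finite) simp
  moreover have "S \<subseteq> {x. poly (p - q) x = 0}" using assms(2) by auto
  ultimately show False using assms(1) finite_subset by blast
qed

text \<open>Dividing by \<open>(1 + t) ^ d\<close> leaves only powers of
  \<open>t / (1 + t)\<^sup>2\<close>. The range of \<open>i\<close> makes the subtraction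
  \<open>d - 2 * i\<close> exact, and the degree bound lets the sum see all coefficients of
  \<open>g\<close>.\<close>

lemma poly_gamma_expansion:
  fixes g :: "real poly"
  assumes "degree g \<le> d div 2" "1 + t \<noteq> 0"
  shows "poly (\<Sum>i\<le>d div 2. monom (coeff g i) i * [:1, 1:] ^ (d - 2 * i)) t = (1 + t) ^ d * poly g (t / (1 + t)\<^sup>2)"
proof -
  have "poly g x = (\<Sum>i\<le>d div 2. coeff g i * x ^ i)" for x
    unfolding poly_altdef using assms(1)
    by (intro sum.mono_neutral_left) (auto simp: coeff_eq_0)
  moreover have "(1 + t) ^ d * (t / (1 + t)\<^sup>2) ^ i = t ^ i * (1 + t) ^ (d - 2 * i)" if "i \<le> d div 2" for i
  proof -
    have "(1 + t) ^ d = (1 + t) ^ (d - 2 * i) * ((1 + t)\<^sup>2) ^ i"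
      using that by (simp flip: power_mult power_add)
    then show ?thesis using assms(2) by (simp add: power_divide)
  qed
  ultimately show ?thesis
    by (simp add: poly_sum poly_monom sum_distrib_left add.commute mult_ac)
qed

text \<open>Uniqueness in the \<open>THE\<close>: two candidates agree at all values of
  \<open>t / (1 + t)\<^sup>2\<close>, and these are infinitely many since the map is injective on
  the open unit interval.\<close>

lemma gamma_poly_eq:
  assumes K: "complex_rank K = d"
    and g: "degree g \<le> d div 2"
    and h: "h_poly K = (\<Sum>i\<le>d div 2. monom (coeff g i) i * [:1, 1:] ^ (d - 2 * i))"
  shows "gamma_poly K = g"
  unfolding gamma_poly_def K
proof (rule the_equality)
  show "degree g \<le> d div 2 \<and> h_poly K = (\<Sum>i\<le>d div 2. monom (coeff g i) i * [:1, 1:] ^ (d - 2 * i))"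
    using g h by simp
next
  fix g' assume g': "degree g' \<le> d div 2 \<and>
    h_poly K = (\<Sum>i\<le>d div 2. monom (coeff g' i) i * [:1, 1:] ^ (d - 2 * i))"
  let ?u = "\<lambda>t::real. t / (1 + t)\<^sup>2"
  have "inj_on ?u {0<..<1}"
  proof (rule inj_onI)
    fix x y :: real assume xy: "x \<in> {0<..<1}" "y \<in> {0<..<1}" "?u x = ?u y"
    then have "x * (1 + y)\<^sup>2 = y * (1 + x)\<^sup>2" by (auto simp: field_simps add_eq_0_iff)
    then have "(x - y) * (1 - x * y) = 0" by (simp add: power2_eq_square algebra_simps)
    moreover have "x * y < 1" using xy mult_strict_mono[of x 1 y 1] by auto
    ultimately show "x = y" by simp
  qed
  then have "infinite (?u ` {0<..<1})" by (simp add: finite_image_iff)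
  then show "g' = g"
  proof (rule poly_eq_of_infinite)
    fix x assume "x \<in> ?u ` {0<..<1}"
    then obtain t where t: "t > 0" "x = ?u t" by auto
    then have "(1 + t) ^ d * poly g' x = (1 + t) ^ d * poly g x"
      using poly_gamma_expansion[of g' d t] poly_gamma_expansion[of g d t] g g' h by auto
    then show "poly g' x = poly g x" using t(1) by simp
  qed
qed

text \<open>
  In terms of \<open>f\<close> the relation between \<open>h\<close> and \<open>\<gamma>\<close> reads
  \<open>f(s) = (1 + 2s)\<^sup>d \<gamma>((s + s\<^sup>2) / (1 + 2s)\<^sup>2)\<close>, with \<open>s = 1 / (t - 1)\<close>.
\<close>

lemma gamma_poly_of_f_poly:
  assumes K: "finite K" "K \<noteq> {}" and G: "finite G" "{} \<in> G"
    and id: "\<And>s. s > 0 \<Longrightarrow>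
      poly (f_poly K) s = (1 + 2 * s) ^ d * poly (f_poly G) ((s + s\<^sup>2) / (1 + 2 * s)\<^sup>2)"
  shows "gamma_poly K = f_poly G"
proof -
  define q where "q = complex_rank G"
  define m where "m i = real (face_count G i)" for i
  have Gne: "G \<noteq> {}" using G(2) by blast
  have mq: "m q > 0" using face_count_rank[OF G(1) Gne] by (simp add: m_def q_def)
  have pg: "poly (f_poly G) x = (\<Sum>i\<le>q. m i * x ^ i)" for x
    by (simp add: f_poly_def q_def m_def poly_sum poly_monom)
  have pos: "infinite {0::real<..}" by (rule infinite_Ioi)
  have expand: "(1 + 2 * s) ^ e * ((s + s\<^sup>2) / (1 + 2 * s)\<^sup>2) ^ i = (s + s\<^sup>2) ^ i * (1 + 2 * s) ^ (e - 2 * i)"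
    if "s > 0" "2 * i \<le> e" for s :: real and e i
  proof -
    have "(1 + 2 * s) ^ e = (1 + 2 * s) ^ (e - 2 * i) * ((1 + 2 * s)\<^sup>2) ^ i"
      using that by (simp flip: power_mult power_add)
    then show ?thesis using that(1) by (simp add: power_divide)
  qed
  \<comment> \<open>The exponent is left variable because \<open>2 * q \<le> d\<close> is not known
    yet: the subtraction is exact at \<open>e = 2 * q\<close>, and at \<open>e = d\<close> only
    after \<open>qd\<close>.\<close>
  define R where "R e = (\<Sum>i\<le>q. smult (m i) ([:0, 1, 1:] ^ i * [:1, 2:] ^ (e - 2 * i)))" for e
  have R: "poly (R e) s = (1 + 2 * s) ^ e * poly (f_poly G) ((s + s\<^sup>2) / (1 + 2 * s)\<^sup>2)"
    if s: "s > 0" and e: "2 * q \<le> e" for s e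
  proof -
    have "(1 + 2 * s) ^ e * poly (f_poly G) ((s + s\<^sup>2) / (1 + 2 * s)\<^sup>2) =
        (\<Sum>i\<le>q. m i * ((1 + 2 * s) ^ e * ((s + s\<^sup>2) / (1 + 2 * s)\<^sup>2) ^ i))"
      by (simp add: pg sum_distrib_left mult_ac)
    also have "\<dots> = (\<Sum>i\<le>q. m i * ((s + s\<^sup>2) ^ i * (1 + 2 * s) ^ (e - 2 * i)))"
      using e s by (intro sum.cong) (simp_all add: expand)
    also have "\<dots> = poly (R e) s"
      by (simp add: R_def poly_sum power2_eq_square algebra_simps)
    finally show ?thesis ..
  qed
  \<comment> \<open>The dimension bound for \<open>G\<close> follows from the identity: if
    \<open>d < 2 * q\<close>, multiply by the missing power of \<open>1 + 2s\<close> and evaluate at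
    \<open>s = -1/2\<close>. The side of \<open>K\<close> vanishes; on the other only the term
    \<open>i = q\<close> survives, with value \<open>m q * (- 1 / 4) ^ q\<close>.\<close>
  have qd: "2 * q \<le> d"
  proof (rule ccontr)
    assume less: "\<not> 2 * q \<le> d"
    have "f_poly K * [:1, 2:] ^ (2 * q - d) = R (2 * q)"
    proof (rule poly_eq_of_infinite[OF pos])
      fix s :: real assume "s \<in> {0<..}"
      then have s: "s > 0" by simp
      have "(1 + 2 * s) ^ (2 * q) = (1 + 2 * s) ^ d * (1 + 2 * s) ^ (2 * q - d)"
        using less by (simp flip: power_add)
      then show "poly (f_poly K * [:1, 2:] ^ (2 * q - d)) s = poly (R (2 * q)) s"
        using id[OF s] R[OF s order_refl] by (simp add: mult_ac)
    qed
    then have "poly (R (2 * q)) (- 1 / 2) = poly (f_poly K * [:1, 2:] ^ (2 * q - d)) (- 1 / 2)" by simp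
    also have "\<dots> = 0" using less by simp
    finally have "(\<Sum>i\<le>q. m i * ((- 1 / 4) ^ i * 0 ^ (2 * q - 2 * i))) = 0"
      by (simp add: R_def poly_sum)
    moreover have "(\<Sum>i\<le>q. m i * ((- 1 / 4) ^ i * 0 ^ (2 * q - 2 * i))) =
        (\<Sum>i\<in>{q}. m i * ((- 1 / 4) ^ i * 0 ^ (2 * q - 2 * i)))"
      by (rule sum.mono_neutral_right) auto
    ultimately show False using mq by simp
  qed
  have fK: "f_poly K = R d"
    by (rule poly_eq_of_infinite[OF pos]) (use id R qd in auto)
  \<comment> \<open>Up to the weights \<open>m i \<ge> 0\<close>, every term of \<open>R d\<close>
    has degree \<open>d\<close> and positive leading coefficient, so nothing cancels; the dimension
    of \<open>K\<close> comes out of the identity as well.\<close>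
  have rank: "complex_rank K = d"
  proof -
    have deg: "degree ([:0, 1, 1:] ^ i * [:1, 2:] ^ (d - 2 * i) :: real poly) = d"
      and lead: "coeff ([:0, 1, 1:] ^ i * [:1, 2:] ^ (d - 2 * i) :: real poly) d = 2 ^ (d - 2 * i)"
      if "i \<le> q" for i
    proof -
      show deg: "degree ([:0, 1, 1:] ^ i * [:1, 2:] ^ (d - 2 * i) :: real poly) = d"
        using that qd by (simp add: degree_mult_eq degree_power_eq)
      have "lead_coeff ([:0, 1, 1:] ^ i * [:1, 2:] ^ (d - 2 * i) :: real poly) = 2 ^ (d - 2 * i)"
        by (simp add: lead_coeff_mult lead_coeff_power)
      then show "coeff ([:0, 1, 1:] ^ i * [:1, 2:] ^ (d - 2 * i) :: real poly) d = 2 ^ (d - 2 * i)"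
        using deg by simp
    qed
    have "degree (R d) \<le> d"
      unfolding R_def by (rule degree_sum_le) (auto intro: order_trans[OF degree_smult_le] simp: deg)
    moreover have "coeff (R d) d = (\<Sum>i\<le>q. m i * 2 ^ (d - 2 * i))"
      by (simp add: R_def coeff_sum lead)
    then have "coeff (R d) d > 0"
      using mq by (auto simp: m_def intro!: sum_pos2[of _ q])
    then have "d \<le> degree (R d)" by (intro le_degree) simp
    ultimately show ?thesis using degree_f_poly[OF K] fK by simp
  qed
  have deg: "degree (f_poly G) \<le> d div 2" using degree_f_poly[OF G(1) Gne] qd by (simp add: q_def)
  show ?thesis
  proof (rule gamma_poly_eq[OF rank deg], rule poly_eq_of_infinite[of "{1<..}"])
    show "infinite {1::real<..}" by (rule infinite_Ioi)
    fix t :: real assume "t \<in> {1<..}"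
    then have t: "t > 1" by simp
    define s where "s = 1 / (t - 1)"
    have s: "s > 0" using t by (simp add: s_def)
    have st: "s * (t - 1) = 1" using t by (simp add: s_def)
    have w: "1 + 2 * s = (1 + t) * s" using st by (simp add: algebra_simps)
    have "s + s\<^sup>2 = s * (s * (t - 1)) + s\<^sup>2" by (simp add: st)
    also have "\<dots> = t * s\<^sup>2" by (simp add: algebra_simps power2_eq_square)
    finally have x: "(s + s\<^sup>2) / (1 + 2 * s)\<^sup>2 = t / (1 + t)\<^sup>2"
      using s unfolding w by (simp add: power_mult_distrib)
    have "poly (h_poly K) t = (t - 1) ^ d * poly (f_poly K) s"
      using poly_h_poly[of t K] t by (simp add: rank s_def)
    also have "\<dots> = (t - 1) ^ d * (((1 + t) * s) ^ d * poly (f_poly G) (t / (1 + t)\<^sup>2))"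
      using id[OF s] x w by simp
    also have "\<dots> = (s * (t - 1)) ^ d * ((1 + t) ^ d * poly (f_poly G) (t / (1 + t)\<^sup>2))"
      by (simp only: power_mult_distrib mult_ac)
    also have "\<dots> = (1 + t) ^ d * poly (f_poly G) (t / (1 + t)\<^sup>2)" by (simp add: st)
    also have "\<dots> = poly (\<Sum>i\<le>d div 2. monom (coeff (f_poly G) i) i * [:1, 1:] ^ (d - 2 * i)) t"
      using poly_gamma_expansion[OF deg, of t] t by simp
    finally show "poly (h_poly K) t =
      poly (\<Sum>i\<le>d div 2. monom (coeff (f_poly G) i) i * [:1, 1:] ^ (d - 2 * i)) t" .
  qed
qed

theorem theorem3p5:
  fixes B D :: "'n::finite set set"
    and k :: nat
    and b :: "nat \<Rightarrow> 'n set"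
  assumes "connected_flag_building_set UNIV B"
    and "flag_ordering UNIV B D k b"
  shows "polytope_gamma (nestohedron B) = f_poly (Gamma_complex D k b)"
proof -
  have B: "flag_bs UNIV B" using assms(1) by (simp add: connected_flag_building_set_UNIV)
  then interpret connected_building_set B by unfold_locales (auto simp: flag_bs_def)
  have sp: "splitting B" using B by (simp add: flag_bs_def)
  note ord = flag_ordering_UNIV[OF assms(2)]
  let ?K = "boundary_complex (polar_dual (nestohedron B))" and ?G = "Gamma_complex D k b"
  have G: "finite ?G" "{} \<in> ?G"
    unfolding Gamma_complex_eq_cliques by (auto simp: finite_cliques) (auto simp: cliques_def)
  have K: "(\<Sum>\<sigma>\<in>?K. s ^ card \<sigma>) = nested_sum s UNIV B" for s :: real
    unfolding sum_boundary_complex nested_sum_def clique_sum_def nested_iff_clique[OF sp] by simp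
  \<comment> \<open>The exponent is the number of inner vertices of the decomposition tree; that it
    also is the rank of the boundary complex is deduced inside
    \<open>gamma_poly_of_f_poly\<close>.\<close>
  have id: "poly (f_poly ?K) s =
      (1 + 2 * s) ^ (CARD('n) - 1) * poly (f_poly ?G) ((s + s\<^sup>2) / (1 + 2 * s)\<^sup>2)" if s: "s > 0" for s
  proof -
    have "poly (f_poly ?K) s = nested_sum s UNIV (D \<union> b ` {1..k})"
      using poly_f_poly[OF finite_boundary_complex, of s] K[of s] ord(2) by simp
    also have "\<dots> = (1 + 2 * s) ^ (CARD('n) - 1) *
        clique_sum ((s + s\<^sup>2) / (1 + 2 * s)\<^sup>2) {1..k} (Gamma_adj D {1..k} b)"
      by (rule nested_sum_eq_clique_sum[OF ord(1) s])
    also have "clique_sum ((s + s\<^sup>2) / (1 + 2 * s)\<^sup>2) {1..k} (Gamma_adj D {1..k} b) =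
        poly (f_poly ?G) ((s + s\<^sup>2) / (1 + 2 * s)\<^sup>2)"
      unfolding poly_f_poly[OF G(1)] by (simp only: clique_sum_def Gamma_complex_eq_cliques)
    finally show ?thesis .
  qed
  have "?K \<noteq> {}"
  proof
    assume "?K = {}"
    then have "(\<Sum>N | nested N. (\<lambda>n. 1::real) (card N)) = 0"
      using sum_boundary_complex[of "\<lambda>n. 1::real"] by simp
    moreover have "finite {N. nested N}" by simp
    ultimately show False using nested_empty by (auto simp: card_eq_0_iff)
  qed
  then show ?thesis
    unfolding polytope_gamma_def by (rule gamma_poly_of_f_poly[OF finite_boundary_complex _ G id])
qed

end
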